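(* Let $d\ge 1$ and let $V(z,\omega)$, $z\in\mathbb{Z}^d$, be i.i.d. random variables on a probability space $(\Omega,\mathcal{F},\mathbb{P})$ such that $V(0,\omega)\in[0,\infty]$ a.s., $\mathbb{P}(V(0,\omega)=0)<1$, and $\operatorname{ess\,inf}_{\omega\in\Omega}V(0,\omega)=0$. If $d=1$, assume in addition that $\mathbb{P}(V(0,\omega)\in(0,\infty))>0$. Then there exists a constant $C\in(0,\infty)$ such that $$\limsup_{\|y\|\to\infty}\frac{E_{Q^0_y}(\tau_y)}{\|y\|}\le C,$$ where $y$ ranges over $\mathbb{Z}^d\setminus\{0\}$ and $Q^0_y$ is the annealed path measure.
   Context: $\mathbb{E}$ is expectation with respect to $\mathbb{P}$. $P^x$ is the law of the simple symmetric nearest-neighbor random walk $(S_n)_{n\ge0}$ on $\mathbb{Z}^d$ started at $x$ (independent of the environment $\omega$), with expectation $E^x$. For $y\in\mathbb{Z}^d$, $\tau_y=\inf\{n\ge0: S_n=y\}$. The convention $e^{-\infty}=0$ is used. For $y\ne x$, the annealed path measure is $$Q^x_y(A)=(Z^x_y)^{-1}\,\mathbb{E}E^x\Big(\mathbf{1}_{\{\tau_y<\infty\}}\mathbf{1}_A\,e^{-\sum_{n=0}^{\tau_y-1}V(S_n,\omega)}\Big),\qquad Z^x_y=\mathbb{E}E^x\Big(\mathbf{1}_{\{\tau_y<\infty\}}e^{-\sum_{n=0}^{\tau_y-1}V(S_n,\omega)}\Big),$$ and $E_{Q^x_y}$ is the corresponding expectation. $\|\cdot\|$ is a fixed norm on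 $\mathbb{R}^d$ (e.g. Euclidean). *)

theory Defs
  imports "HOL-Probability.Probability"
begin

definition essinf :: "'w measure \<Rightarrow> ('w \<Rightarrow> ereal) \<Rightarrow> ereal" where
  "essinf M f = Liminf (ae_filter M) f"

definition is_norm :: "('v::real_vector \<Rightarrow> real) \<Rightarrow> bool" where
  "is_norm N \<longleftrightarrow>
     (\<forall>x. 0 \<le> N x) \<and> (\<forall>x. N x = 0 \<longleftrightarrow> x = 0) \<and>
     (\<forall>a x. N (a *\<^sub>R x) = \<bar>a\<bar> * N x) \<and> (\<forall>x y. N (x + y) \<le> N x + N y)"

definition real_vec :: "int ^ 'd \<Rightarrow> real ^ 'd" where
  "real_vec z = (\<chi> i. real_of_int (z $ i))"

definition unit_steps :: "(int ^ 'd::finite) set" where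
  "unit_steps = (\<Union>i. {axis i 1, axis i (-1)})"

abbreviation path_space :: "(nat \<Rightarrow> int ^ 'd::finite) measure" where
  "path_space \<equiv> Pi\<^sub>M UNIV (\<lambda>_. count_space UNIV)"

definition srw :: "int ^ 'd::finite \<Rightarrow> (nat \<Rightarrow> int ^ 'd) measure" where
  "srw x = distr (Pi\<^sub>M UNIV (\<lambda>_::nat. measure_pmf (pmf_of_set unit_steps))) path_space
     (\<lambda>\<xi> n. x + (\<Sum>k<n. \<xi> k))"

definition hit :: "'s \<Rightarrow> (nat \<Rightarrow> 's) \<Rightarrow> enat" where
  "hit y S = (INF n\<in>{n. S n = y}. enat n)"

(* e^{-v} with e^{-\<infinity>} = 0. The value at v = -\<infinity> is irrelevant for
   almost surely nonnegative potentials. *)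
definition exp_neg :: "ereal \<Rightarrow> ennreal" where
  "exp_neg v = (case v of ereal r \<Rightarrow> ennreal (exp (- r)) | PInfty \<Rightarrow> 0 | MInfty \<Rightarrow> \<infinity>)"

definition path_weight ::
    "('s \<Rightarrow> 'w \<Rightarrow> ereal) \<Rightarrow> 's \<Rightarrow> 'w \<Rightarrow> (nat \<Rightarrow> 's) \<Rightarrow> ennreal" where
  "path_weight V y \<omega> S =
     (if hit y S < \<infinity> then exp_neg (\<Sum>n<the_enat (hit y S). V (S n) \<omega>) else 0)"

definition annealed_integral ::
    "'w measure \<Rightarrow> (int ^ 'd \<Rightarrow> 'w \<Rightarrow> ereal) \<Rightarrow> int ^ 'd::finite \<Rightarrow> int ^ 'd \<Rightarrow>
     (nat \<Rightarrow> int ^ 'd) set \<Rightarrow> ennreal" where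
  "annealed_integral M V x y A =
     (\<integral>\<^sup>+\<omega>. (\<integral>\<^sup>+S. indicator A S * path_weight V y \<omega> S \<partial>srw x) \<partial>M)"

definition partition_function ::
    "'w measure \<Rightarrow> (int ^ 'd \<Rightarrow> 'w \<Rightarrow> ereal) \<Rightarrow> int ^ 'd::finite \<Rightarrow> int ^ 'd \<Rightarrow> ennreal" where
  "partition_function M V x y = (\<integral>\<^sup>+\<omega>. (\<integral>\<^sup>+S. path_weight V y \<omega> S \<partial>srw x) \<partial>M)"

(* The set function is countably additive as soon as the potential is measurable;
   see emeasure_annealed_path_measure below. *)
definition annealed_path_measure ::
    "'w measure \<Rightarrow> (int ^ 'd \<Rightarrow> 'w \<Rightarrow> ereal) \<Rightarrow> int ^ 'd::finite \<Rightarrow> int ^ 'd \<Rightarrow>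
     (nat \<Rightarrow> int ^ 'd) measure" where
  "annealed_path_measure M V x y =
     measure_of (space path_space) (sets path_space)
       (\<lambda>A. inverse (partition_function M V x y) * annealed_integral M V x y A)"

lemma sets_annealed_path_measure [simp, measurable_cong]:
  "sets (annealed_path_measure M V x y) = sets path_space"
  unfolding annealed_path_measure_def by (rule sets.sets_measure_of_eq)

lemma space_annealed_path_measure [simp]:
  "space (annealed_path_measure M V x y) = UNIV"
  by (simp add: annealed_path_measure_def space_PiM)

lemma sets_srw [simp, measurable_cong]: "sets (srw x) = sets path_space"
  by (simp add: srw_def)

lemma prob_space_srw: "prob_space (srw x)"
proof -
  interpret product_prob_space "\<lambda>_::nat. measure_pmf (pmf_of_set unit_steps)" UNIV
    by unfold_locales
  show ?thesis
    unfolding srw_def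
  proof (rule prob_space_distr)
    have [measurable]: "(\<lambda>\<xi>. \<xi> k) \<in> Pi\<^sub>M UNIV (\<lambda>_::nat. measure_pmf (pmf_of_set unit_steps))
        \<rightarrow>\<^sub>M count_space UNIV" for k
      using measurable_component_singleton[of k UNIV "\<lambda>_. measure_pmf (pmf_of_set unit_steps)"]
      by (simp cong: measurable_cong_sets)
    have m: "(\<lambda>\<xi>. x + (\<Sum>k<n. \<xi> k)) \<in> Pi\<^sub>M UNIV (\<lambda>_::nat. measure_pmf (pmf_of_set unit_steps))
        \<rightarrow>\<^sub>M count_space UNIV" for n
    proof (induction n)
      case (Suc n)
      have "(\<lambda>\<xi>. (\<lambda>(a, b). a + b) (x + (\<Sum>k<n. \<xi> k), \<xi> n)) \<in>
        Pi\<^sub>M UNIV (\<lambda>_::nat. measure_pmf (pmf_of_set unit_steps)) \<rightarrow>\<^sub>M count_space UNIV"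
        by (rule measurable_compose[OF measurable_Pair[OF Suc, of _ "count_space UNIV"]])
           (auto simp: pair_measure_countable)
      then show ?case by (simp add: add.assoc)
    qed simp
    show "(\<lambda>\<xi> n. x + (\<Sum>k<n. \<xi> k)) \<in>
        Pi\<^sub>M UNIV (\<lambda>_::nat. measure_pmf (pmf_of_set unit_steps)) \<rightarrow>\<^sub>M path_space"
      by (rule measurable_PiM_single') (auto simp: m)
  qed
qed

lemma measurable_exp_neg [measurable]: "exp_neg \<in> borel \<rightarrow>\<^sub>M borel"
proof -
  have "exp_neg = (\<lambda>v. if v = \<infinity> then 0 else if v = -\<infinity> then \<infinity>
      else ennreal (exp (- real_of_ereal v)))"
    by (auto simp: exp_neg_def split: ereal.splits)
  also have "\<dots> \<in> borel \<rightarrow>\<^sub>M borel" by measurable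
  finally show ?thesis .
qed

lemma measurable_hit [measurable]: "hit y \<in> path_space \<rightarrow>\<^sub>M count_space UNIV"
proof -
  have "hit y S = (INF n. if S n = y then enat n else \<infinity>)" for S
  proof (rule antisym)
    show "hit y S \<le> (INF n. if S n = y then enat n else \<infinity>)"
      unfolding hit_def by (rule INF_greatest) (auto intro: INF_lower)
    show "(INF n. if S n = y then enat n else \<infinity>) \<le> hit y S"
      unfolding hit_def
    proof (rule INF_greatest)
      fix n assume "n \<in> {n. S n = y}"
      then show "(INF n. if S n = y then enat n else \<infinity>) \<le> enat n"
        by (intro INF_lower2[of n]) auto
    qed
  qed
  then have "hit y = (\<lambda>S. INF n. if S n = y then enat n else \<infinity>)" by blast
  also have "\<dots> \<in> path_space \<rightarrow>\<^sub>M count_space UNIV" by measurable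
  finally show ?thesis .
qed

lemma measurable_path_weight:
  fixes V :: "int ^ 'd::finite \<Rightarrow> 'w \<Rightarrow> ereal"
  assumes V [measurable]: "\<And>z. V z \<in> borel_measurable M"
  shows "(\<lambda>(\<omega>, S). path_weight V y \<omega> S) \<in> borel_measurable (M \<Otimes>\<^sub>M path_space)"
proof -
  have S [measurable]: "(\<lambda>p. snd p n) \<in> M \<Otimes>\<^sub>M path_space \<rightarrow>\<^sub>M count_space UNIV" for n
    by measurable
  have V' [measurable]: "(\<lambda>p. V (snd p n) (fst p)) \<in> borel_measurable (M \<Otimes>\<^sub>M path_space)" for n
    by (rule measurable_compose_countable[OF _ S]) measurable
  have h [measurable]: "(\<lambda>p. hit y (snd p)) \<in> M \<Otimes>\<^sub>M path_space \<rightarrow>\<^sub>M count_space UNIV"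
    by measurable
  have "(\<lambda>p. (\<lambda>k p. if k < \<infinity> then exp_neg (\<Sum>n<the_enat k. V (snd p n) (fst p)) else 0)
      (hit y (snd p)) p) \<in> borel_measurable (M \<Otimes>\<^sub>M path_space)"
    by (rule measurable_compose_countable[OF _ h]) measurable
  then show ?thesis by (simp add: path_weight_def split_beta)
qed

lemma emeasure_annealed_path_measure:
  fixes V :: "int ^ 'd::finite \<Rightarrow> 'w \<Rightarrow> ereal"
  assumes V: "\<And>z. V z \<in> borel_measurable M" and A: "A \<in> sets path_space"
  shows "emeasure (annealed_path_measure M V x y) A =
    inverse (partition_function M V x y) * annealed_integral M V x y A"
proof -
  interpret srw: prob_space "srw x" by (rule prob_space_srw)
  note w = measurable_path_weight[OF V, where y = y]
  have w1: "path_weight V y \<omega> \<in> borel_measurable (srw x)" if "\<omega> \<in> space M" for \<omega>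
    using measurable_compose[OF measurable_Pair1'[OF that] w] by (simp cong: measurable_cong_sets)
  have s: "(\<lambda>\<omega>. \<integral>\<^sup>+S. indicator B S * path_weight V y \<omega> S \<partial>srw x) \<in> borel_measurable M"
    if [measurable]: "B \<in> sets path_space" for B
  proof (rule srw.borel_measurable_nn_integral)
    have [measurable]: "(\<lambda>(\<omega>, S). path_weight V y \<omega> S) \<in> borel_measurable (M \<Otimes>\<^sub>M srw x)"
      using w by (simp cong: measurable_cong_sets sets_pair_measure_cong)
    show "(\<lambda>(\<omega>, S). indicator B S * path_weight V y \<omega> S) \<in> borel_measurable (M \<Otimes>\<^sub>M srw x)"
      by measurable
  qed
  show ?thesis
  proof (rule emeasure_measure_of[OF annealed_path_measure_def])
    show "sets path_space \<subseteq> Pow (space path_space)" by (rule sets.space_closed)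
    show "A \<in> sets (annealed_path_measure M V x y)" using A by simp
    show "positive (sets (annealed_path_measure M V x y))
        (\<lambda>A. inverse (partition_function M V x y) * annealed_integral M V x y A)"
      by (simp add: positive_def annealed_integral_def)
    show "countably_additive (sets (annealed_path_measure M V x y))
        (\<lambda>A. inverse (partition_function M V x y) * annealed_integral M V x y A)"
    proof (rule countably_additiveI)
      fix B :: "nat \<Rightarrow> (nat \<Rightarrow> int ^ 'd) set"
      assume B: "range B \<subseteq> sets (annealed_path_measure M V x y)" "disjoint_family B"
      then have Bm [measurable]: "B i \<in> sets path_space" for i by auto
      have "annealed_integral M V x y (\<Union>i. B i) =
          (\<integral>\<^sup>+\<omega>. (\<Sum>i. \<integral>\<^sup>+S. indicator (B i) S * path_weight V y \<omega> S \<partial>srw x) \<partial>M)"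
        unfolding annealed_integral_def
      proof (rule nn_integral_cong)
        fix \<omega> assume "\<omega> \<in> space M"
        note [measurable] = w1[OF this]
        have "(\<integral>\<^sup>+S. indicator (\<Union>i. B i) S * path_weight V y \<omega> S \<partial>srw x) =
            (\<integral>\<^sup>+S. (\<Sum>i. indicator (B i) S * path_weight V y \<omega> S) \<partial>srw x)"
          by (simp add: suminf_indicator[OF B(2), symmetric] ennreal_suminf_multc)
        also have "\<dots> = (\<Sum>i. \<integral>\<^sup>+S. indicator (B i) S * path_weight V y \<omega> S \<partial>srw x)"
          by (rule nn_integral_suminf) measurable
        finally show "(\<integral>\<^sup>+S. indicator (\<Union>i. B i) S * path_weight V y \<omega> S \<partial>srw x) = \<dots>" .
      qed
      also have "\<dots> = (\<Sum>i. annealed_integral M V x y (B i))"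
        unfolding annealed_integral_def by (rule nn_integral_suminf) (rule s[OF Bm])
      finally show "(\<Sum>i. inverse (partition_function M V x y) * annealed_integral M V x y (B i)) =
          inverse (partition_function M V x y) * annealed_integral M V x y (\<Union>i. B i)"
        by simp
    qed
  qed
qed

end

theory Submission
  imports Defs
begin

text \<open>
  Averaging over the environment gives a path with local times \<open>l(z)\<close> the weight
  \<open>(2d)^(-length) * \<Prod>z. \<phi> (l z)\<close> with \<open>\<phi> l = E exp (-l V(0))\<close>, so the claim is about weighted sums
  over finite paths. Since \<open>\<phi> 1 < 1\<close>, the weight decays exponentially in the range, while the
  partition function is at least exponentially small in \<open>|y|\<close>; hence the mean range is \<open>O(|y|)\<close>,
  and it remains to bound the mean local time at \<open>z\<close> by a multiple of the probability of coming
  near \<open>z\<close>, summed over scales.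

  Let \<open>K\<close> be maximal such that every site of the cube of radius \<open>K\<close> around \<open>z\<close> is visited at least
  \<open>m\<close> times, so that some site \<open>w\<close> of the next cube is visited fewer than \<open>m\<close> times. Cut the path at
  its first and last visits to the cube. The middle piece avoids an \<open>m\<close>-th visit to \<open>w\<close>, which makes
  the sum over all middle pieces, weighted by their local time at \<open>z\<close>, a product of two killed Green
  functions, and each site of the cube contributes a factor \<open>\<phi> m\<close>. Replacing the middle piece by
  short connections inside the cube gives back a path counted by the partition function. For
  \<open>d \<ge> 2\<close> take \<open>m = 1\<close>: the gain is exponential in the volume of the cube, while the Green functions
  and the connection cost only an exponential in \<open>K\<close>. For \<open>d = 1\<close> the Green functions are polynomial
  in \<open>K\<close>, and a renewal argument at the sites visited exactly once shows that the weight of crossing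
  an interval decays at a rate \<open>lam\<close> strictly larger than \<open>P(V(0) = 0) = lim \<phi>\<close>; choose \<open>m\<close> with
  \<open>\<phi> m < lam\<close>.
\<close>
section \<open>Sums over sets of paths\<close>

text \<open>Re-routing works because the environment has been integrated out into a product over
  sites of a decreasing function of the local times. Visits of the discarded middle piece outside
  the cube can then be ignored in an upper bound, and a substitute that stays in the cube shares no
  site with the outer pieces. A Green function killed at the \<open>m\<close>-th visit to
  \<open>w\<close> is at most \<open>m\<close> divided by the probability of reaching
  \<open>w\<close> before returning to its endpoint, because paths that end at a fixed visit to
  \<open>w\<close> describe disjoint events. In dimension one the volume gain and the connection
  cost are both exponential in \<open>2 * K + 1\<close>, so their rates must be compared. Here
  \<open>\<phi> m\<close> comes close to \<open>p = P(V(0) = 0)\<close> but never falls below it,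
  hence the crossing rate has to exceed \<open>p\<close> strictly. The surplus is earned at sites
  visited exactly once, which pay \<open>\<phi> 1 > p\<close>; this is where the mass of
  \<open>V(0)\<close> in the open half-line enters. Such sites are frequent enough because the
  simple walk crosses \<open>n\<close> sites with probability \<open>1 / (n + 1)\<close>, which is
  not summable in \<open>n\<close>.\<close>

definition psum :: "'a set \<Rightarrow> ('a \<Rightarrow> ennreal) \<Rightarrow> ennreal" where
  "psum A f = (\<integral>\<^sup>+x. f x \<partial>count_space A)"

lemma psum_cong: "A = B \<Longrightarrow> (\<And>x. x \<in> B \<Longrightarrow> f x = g x) \<Longrightarrow> psum A f = psum B g"
  unfolding psum_def by (auto intro!: nn_integral_cong)

lemma psum_mono: "(\<And>x. x \<in> A \<Longrightarrow> f x \<le> g x) \<Longrightarrow> psum A f \<le> psum A g"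
  unfolding psum_def by (auto intro!: nn_integral_mono)

lemma psum_indicator: "psum A f = psum UNIV (\<lambda>x. f x * indicator A x)"
  unfolding psum_def by (cases "A = UNIV") (auto simp: nn_integral_count_space_indicator)

lemma psum_subset: "A \<subseteq> B \<Longrightarrow> psum A f \<le> psum B f"
  by (subst (1 2) psum_indicator) (auto intro!: psum_mono split: split_indicator)

lemma psum_restrict: "psum {x \<in> A. P x} f = psum A (\<lambda>x. if P x then f x else 0)"
  by (subst (1 2) psum_indicator) (auto intro!: psum_cong split: split_indicator)

lemma psum_finite: "finite A \<Longrightarrow> psum A f = sum f A"
  unfolding psum_def by (rule nn_integral_count_space_finite)

lemma psum_empty [simp]: "psum {} f = 0"
  by (simp add: psum_finite)

lemma psum_singleton [simp]: "psum {x} f = f x"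
  by (simp add: psum_finite)

lemma psum_cmult: "psum A (\<lambda>x. c * f x) = c * psum A f"
  unfolding psum_def by (rule nn_integral_cmult) simp

lemma psum_multc: "psum A (\<lambda>x. f x * c) = psum A f * c"
  unfolding psum_def by (rule nn_integral_multc) simp

lemma psum_add: "psum A (\<lambda>x. f x + g x) = psum A f + psum A g"
  unfolding psum_def by (rule nn_integral_add) auto

lemma psum_suminf: "psum A (\<lambda>x. \<Sum>i. f i x) = (\<Sum>i. psum A (f i))"
  unfolding psum_def by (rule nn_integral_suminf) auto

lemma psum_nat: "psum UNIV f = (\<Sum>i. f i)"
  unfolding psum_def by (rule nn_integral_count_space_nat)

lemma psum_Sigma: "psum (SIGMA x:A. B x) f = psum A (\<lambda>x. psum (B x) (\<lambda>y. f (x, y)))"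
proof -
  have "psum A (\<lambda>x. psum (B x) (\<lambda>y. f (x, y))) =
      psum UNIV (\<lambda>x. psum UNIV (\<lambda>y. f (x, y) * indicator (Sigma A B) (x, y)))"
    unfolding psum_indicator[of A] psum_indicator[of "B _"] psum_multc[symmetric]
    by (intro psum_cong refl) (auto split: split_indicator)
  also have "\<dots> = psum (Sigma A B) f"
    unfolding psum_indicator[of "Sigma A B"]
    unfolding psum_def by (rule nn_integral_fst_count_space)
  finally show ?thesis ..
qed

lemma psum_swap: "psum A (\<lambda>x. psum B (\<lambda>y. f x y)) = psum B (\<lambda>y. psum A (\<lambda>x. f x y))"
proof -
  have "psum A (\<lambda>x. psum B (\<lambda>y. f x y)) = psum (A \<times> B) (\<lambda>(x, y). f x y)"
    by (simp add: psum_Sigma)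
  also have "\<dots> = psum (B \<times> A) ((\<lambda>(x, y). f x y) \<circ> prod.swap)"
    unfolding psum_def comp_def
    by (rule nn_integral_bij_count_space[symmetric]) (auto simp: bij_betw_def inj_on_def)
  also have "\<dots> = psum B (\<lambda>y. psum A (\<lambda>x. f x y))"
    by (simp add: psum_Sigma)
  finally show ?thesis .
qed

lemma psum_reindex: "inj_on h A \<Longrightarrow> psum (h ` A) f = psum A (\<lambda>x. f (h x))"
  unfolding psum_def by (rule nn_integral_bij_count_space[symmetric]) (simp add: bij_betw_def)

lemma psum_inj_le:
  assumes "inj_on h A" "h ` A \<subseteq> B" "\<And>x. x \<in> A \<Longrightarrow> g x \<le> f (h x)"
  shows "psum A g \<le> psum B f"
proof -
  have "psum A g \<le> psum A (\<lambda>x. f (h x))" using assms(3) by (rule psum_mono)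
  also have "\<dots> = psum (h ` A) f" by (rule psum_reindex[OF assms(1), symmetric])
  also have "\<dots> \<le> psum B f" using assms(2) by (rule psum_subset)
  finally show ?thesis .
qed

text \<open>A choice of preimages is automatically injective, having \<open>h\<close> as left
  inverse, so \<open>h\<close> itself may identify elements of \<open>A\<close>. This form suits
  decompositions of paths whose uniqueness has not been established.\<close>

lemma psum_surj_le:
  assumes "\<And>y. y \<in> B \<Longrightarrow> \<exists>x\<in>A. h x = y \<and> f y \<le> g x"
  shows "psum B f \<le> psum A g"
proof -
  obtain k where k: "k y \<in> A" "h (k y) = y" "f y \<le> g (k y)" if "y \<in> B" for y
    using assms by metis
  show ?thesis
    by (rule psum_inj_le[of k]) (auto intro: inj_on_inverseI[of B h] simp: k)
qed

lemma psum_UN_le: "psum (\<Union>i\<in>I. A i) f \<le> psum I (\<lambda>i. psum (A i) f)"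
proof -
  have "psum (\<Union>i\<in>I. A i) f \<le> psum (Sigma I A) (\<lambda>(i, x). f x)"
    by (rule psum_surj_le[of _ _ snd]) force
  then show ?thesis by (simp add: psum_Sigma)
qed

lemma psum_Un_disjoint:
  assumes "A \<inter> B = {}"
  shows "psum (A \<union> B) f = psum A f + psum B f"
proof -
  have "psum (A \<union> B) f = psum UNIV (\<lambda>x. f x * indicator A x + f x * indicator B x)"
    using assms unfolding psum_indicator[of "A \<union> B"]
    by (intro psum_cong refl) (auto split: split_indicator)
  then show ?thesis by (simp only: psum_add psum_indicator[symmetric])
qed

lemma psum_mem_le: "x \<in> A \<Longrightarrow> f x \<le> psum A f"
  using psum_subset[of "{x}" A f] by simp

lemma psum_const: "finite A \<Longrightarrow> psum A (\<lambda>_. c) = of_nat (card A) * c"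
  by (simp add: psum_finite)

lemma psum_eq_card: "finite {x. P x} \<Longrightarrow> psum UNIV (\<lambda>x. if P x then c else 0) = of_nat (card {x. P x}) * c"
  using psum_restrict[of UNIV P "\<lambda>_. c"] psum_const[of "{x. P x}" c] by simp

section \<open>Visited sites, local times and the law of the first steps\<close>

fun vis :: "'v::monoid_add \<Rightarrow> 'v list \<Rightarrow> 'v list" where
  "vis x [] = []"
| "vis x (u # us) = x # vis (x + u) us"

lemma length_vis [simp]: "length (vis x us) = length us"
  by (induction us arbitrary: x) auto

lemma vis_append: "vis x (us @ vs) = vis x us @ vis (x + sum_list us) vs"
  by (induction us arbitrary: x) (auto simp: add.assoc)

lemma nth_vis: "k < length us \<Longrightarrow> vis x us ! k = x + sum_list (take k us)"
proof (induction us arbitrary: x k)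
  case (Cons u us)
  then show ?case by (cases k) (auto simp: add.assoc)
qed simp

text \<open>The endpoint of the path is not counted, in agreement with the exponent of the annealed
  measure, where the sum stops one step before the hitting time.\<close>

abbreviation loc :: "'v::monoid_add \<Rightarrow> 'v list \<Rightarrow> 'v \<Rightarrow> nat" where
  "loc x us \<equiv> count_list (vis x us)"

lemma finite_unit_steps [simp]: "finite (unit_steps :: (int ^ 'd::finite) set)"
  by (simp add: unit_steps_def)

lemma unit_steps_nonempty [simp]: "(unit_steps :: (int ^ 'd::finite) set) \<noteq> {}"
  by (auto simp: unit_steps_def)

lemma axis_in_unit_steps [simp]: "axis i 1 \<in> unit_steps" "axis i (-1) \<in> unit_steps"
  by (auto simp: unit_steps_def)

lemma zero_notin_unit_steps: "0 \<notin> (unit_steps :: (int ^ 'd::finite) set)"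
proof -
  have "axis i (1::int) \<noteq> 0" "axis i (-1::int) \<noteq> 0" for i :: 'd
    by (simp_all add: axis_eq_0_iff)
  then show ?thesis by (simp add: unit_steps_def eq_commute[of 0])
qed

lemma card_unit_steps_pos: "0 < card (unit_steps :: (int ^ 'd::finite) set)"
  by (simp add: card_gt_0_iff)

text \<open>For a list of unit steps, the probability that the walk begins with exactly these
  steps.\<close>

definition srw_prob :: "(int ^ 'd::finite) list \<Rightarrow> ennreal" where
  "srw_prob us = ennreal (inverse (real (card (unit_steps :: (int ^ 'd) set))) ^ length us)"

lemma srw_prob_Nil [simp]: "srw_prob [] = 1"
  by (simp add: srw_prob_def)

lemma srw_prob_append: "srw_prob (us @ vs) = srw_prob us * srw_prob vs"
  by (simp add: srw_prob_def power_add ennreal_mult)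

lemma srw_prob_Cons: "srw_prob (u # us) = srw_prob [u] * srw_prob us"
  using srw_prob_append[of "[u]" us] by (simp only: append.simps)

abbreviation step_space :: "(nat \<Rightarrow> int ^ 'd::finite) measure" where
  "step_space \<equiv> Pi\<^sub>M UNIV (\<lambda>_::nat. measure_pmf (pmf_of_set unit_steps))"

definition cyl :: "'v list \<Rightarrow> (nat \<Rightarrow> 'v) set" where
  "cyl us = {\<xi>. \<forall>k<length us. \<xi> k = us ! k}"

lemma cyl_step_space:
  fixes us :: "(int ^ 'd::finite) list"
  assumes "set us \<subseteq> unit_steps"
  shows "cyl us \<in> sets step_space" "emeasure step_space (cyl us) = srw_prob us"
proof -
  interpret product_prob_space "\<lambda>_::nat. measure_pmf (pmf_of_set (unit_steps :: (int ^ 'd) set))" UNIV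
    by unfold_locales
  have *: "cyl us = prod_emb UNIV (\<lambda>_. measure_pmf (pmf_of_set unit_steps)) {..<length us}
      (Pi\<^sub>E {..<length us} (\<lambda>k. {us ! k}))"
    by (intro set_eqI) (simp only: cyl_def prod_emb_iff mem_Collect_eq PiE_iff restrict_extensional
      extensional_UNIV lessThan_iff Ball_def space_measure_pmf UNIV_I singleton_iff restrict_apply, simp)
  show "cyl us \<in> sets step_space"
    unfolding * by (rule sets_PiM_I) auto
  have "emeasure step_space (cyl us) = (\<Prod>k<length us. emeasure (measure_pmf (pmf_of_set unit_steps)) {us ! k})"
    unfolding * by (rule emeasure_PiM_emb) auto
  also have "\<dots> = (\<Prod>k<length us. ennreal (inverse (card (unit_steps :: (int ^ 'd) set))))"
  proof (intro prod.cong refl)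
    fix k assume "k \<in> {..<length us}"
    then have "us ! k \<in> unit_steps" using assms by auto
    then show "emeasure (measure_pmf (pmf_of_set unit_steps)) {us ! k} = ennreal (inverse (card (unit_steps :: (int ^ 'd) set)))"
      by (simp add: emeasure_pmf_single inverse_eq_divide)
  qed
  also have "\<dots> = srw_prob us"
    unfolding srw_prob_def by (subst ennreal_power[symmetric]) simp_all
  finally show "emeasure step_space (cyl us) = srw_prob us" .
qed

definition prefix_free :: "'v list set \<Rightarrow> bool" where
  "prefix_free A \<longleftrightarrow> (\<forall>us vs. us \<in> A \<longrightarrow> us @ vs \<in> A \<longrightarrow> vs = [])"

lemma cyl_disjoint:
  assumes "us \<noteq> vs" "prefix_free {us, vs}"
  shows "cyl us \<inter> cyl vs = {}"
proof -
  have *: False if "\<xi> \<in> cyl us" "\<xi> \<in> cyl vs" "length us \<le> length vs" "us \<noteq> vs" "prefix_free {us, vs}" for \<xi> us vs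
  proof -
    have "us = take (length us) vs"
      using that by (intro nth_equalityI) (auto simp: cyl_def)
    then have "vs = us @ drop (length us) vs" by (metis append_take_drop_id)
    with that(4,5) show False unfolding prefix_free_def
      by (metis append_Nil2 insertI1 insertI2)
  qed
  show ?thesis
    using *[of _ us vs] *[of _ vs us] assms by (cases "length us \<le> length vs") (auto simp: insert_commute)
qed

text \<open>Kraft's inequality: no path of \<open>A\<close> extends another one, so the events that
  the walk starts with a given element of \<open>A\<close> are disjoint.\<close>

lemma psum_prefix_free:
  fixes A :: "(int ^ 'd::finite) list set"
  assumes "A \<subseteq> lists unit_steps" "prefix_free A"
  shows "psum A srw_prob \<le> 1"
proof -
  interpret product_prob_space "\<lambda>_::nat. measure_pmf (pmf_of_set (unit_steps :: (int ^ 'd) set))" UNIV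
    by unfold_locales
  have "psum A srw_prob = psum A (\<lambda>us. emeasure step_space (cyl us))"
    using assms(1) by (intro psum_cong) (auto simp: cyl_step_space lists_eq_set)
  also have "\<dots> = emeasure step_space (\<Union>us\<in>A. cyl us)"
    unfolding psum_def
  proof (rule emeasure_UN_countable[symmetric])
    show "disjoint_family_on cyl A"
      using assms(2) unfolding disjoint_family_on_def
      by (intro ballI impI cyl_disjoint) (auto simp: prefix_free_def)
  qed (use assms(1) in \<open>auto simp: cyl_step_space lists_eq_set\<close>)
  also have "\<dots> \<le> 1" by (rule P.emeasure_le_1)
  finally show ?thesis .
qed

section \<open>Surgery on paths\<close>

definition paths :: "int ^ 'd::finite \<Rightarrow> int ^ 'd \<Rightarrow> (int ^ 'd) list set" where
  "paths x y = {us \<in> lists unit_steps. x + sum_list us = y}"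

text \<open>Since the endpoint is not among the visited sites, these are the trajectories up to the
  hitting time of \<open>y\<close>. For \<open>x = y\<close> only the empty path remains.\<close>

definition hpaths :: "int ^ 'd::finite \<Rightarrow> int ^ 'd \<Rightarrow> (int ^ 'd) list set" where
  "hpaths x y = {us \<in> paths x y. y \<notin> set (vis x us)}"

lemma Nil_in_paths [simp]: "[] \<in> paths x y \<longleftrightarrow> x = y"
  by (auto simp: paths_def)

lemma Cons_in_paths [simp]: "u # us \<in> paths x y \<longleftrightarrow> u \<in> unit_steps \<and> us \<in> paths (x + u) y"
  by (auto simp: paths_def add.assoc)

lemma append_in_paths:
  "us @ vs \<in> paths x y \<longleftrightarrow> us \<in> paths x (x + sum_list us) \<and> vs \<in> paths (x + sum_list us) y"
  by (auto simp: paths_def add.assoc)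

lemma paths_endpoint: "us \<in> paths x y \<Longrightarrow> x + sum_list us = y"
  by (simp add: paths_def)

lemma paths_append: "us \<in> paths x y \<Longrightarrow> vs \<in> paths y z \<Longrightarrow> us @ vs \<in> paths x z"
  by (auto simp: paths_def add.assoc)

text \<open>A proper extension counts the old endpoint \<open>y\<close> as one further
  visit.\<close>

lemma prefix_free_nth_visit: "prefix_free {us \<in> paths x y. loc x us y = j}"
proof -
  have "vs = []" if "us \<in> paths x y" "us @ vs \<in> paths x y" "loc x us y = j" "loc x (us @ vs) y = j" for us vs
    using that by (cases vs) (auto simp: vis_append count_list_append paths_endpoint)
  then show ?thesis by (auto simp: prefix_free_def)
qed

lemma hpaths_eq: "hpaths x y = {us \<in> paths x y. loc x us y = 0}"
  by (auto simp: hpaths_def count_list_0_iff)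

lemma paths_lists: "paths x y \<subseteq> lists unit_steps"
  by (auto simp: paths_def)

lemma psum_hpaths_le_1: "psum (hpaths x y) srw_prob \<le> 1"
  unfolding hpaths_eq
  by (rule psum_prefix_free[OF _ prefix_free_nth_visit]) (use paths_lists in blast)

text \<open>Probability that the walk from \<open>v\<close> reaches \<open>w\<close> before it
  returns to \<open>v\<close>. The tail discards the visit at time 0; for \<open>v = w\<close> the
  empty path gives the value 1.\<close>

definition escape_prob :: "int ^ 'd::finite \<Rightarrow> int ^ 'd \<Rightarrow> ennreal" where
  "escape_prob v w = psum {r \<in> hpaths v w. v \<notin> set (tl (vis v r))} srw_prob"

text \<open>The junction is the last time at which the concatenated path is at \<open>v\<close>,
  hence determined by that path.\<close>

lemma append_escape_inj:
  "inj_on (\<lambda>(b, r). b @ r) (paths x v \<times> {r \<in> hpaths v w. v \<notin> set (tl (vis v r))})"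
proof -
  have *: "b = b'"
    if "b @ r = b' @ r'" "length b \<le> length b'" "b \<in> paths x v" "b' \<in> paths x v"
      "r \<in> hpaths v w" "v \<notin> set (tl (vis v r))" "r' \<in> hpaths v w" for b b' r r'
  proof (rule ccontr)
    assume "b \<noteq> b'"
    from that(1,2) obtain d where d: "b' = b @ d" "r = d @ r'"
      by (metis append_eq_append_conv_if append_eq_conv_conj)
    with \<open>b \<noteq> b'\<close> have "d \<noteq> []" by auto
    then obtain u d' where u: "d = u # d'" by (cases d) auto
    \<comment> \<open>The surplus \<open>d\<close> is a nonempty loop at \<open>v\<close> with which
      \<open>r\<close> begins. So \<open>r\<close> returns to \<open>v\<close>, or ends there when
      \<open>r'\<close> is empty; both are excluded.\<close>
    have "v + sum_list d = v"
      using paths_endpoint[OF that(3)] paths_endpoint[OF that(4)] d by (simp add: add.assoc[symmetric])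
    then have vr: "vis v r = vis v d @ vis v r'" by (simp add: d vis_append)
    show False
    proof (cases r')
      case Nil
      then have "v = w" using that(7) by (simp add: hpaths_def)
      with that(5) vr u show False by (simp add: hpaths_def)
    next
      case (Cons u' r'')
      with vr u that(6) show False by simp
    qed
  qed
  show ?thesis
  proof (rule inj_onI, clarify)
    fix b r b' r'
    assume h: "b \<in> paths x v" "r \<in> hpaths v w" "v \<notin> set (tl (vis v r))"
      "b' \<in> paths x v" "r' \<in> hpaths v w" "v \<notin> set (tl (vis v r'))" "b @ r = b' @ r'"
    then have "b = b'"
      using *[of b r b' r'] *[of b' r' b r] by (cases "length b \<le> length b'") auto
    with h show "b = b' \<and> r = r'" by simp
  qed
qed

text \<open>Appending an escape path to a path ending at \<open>v\<close> marks the last visit to \<open>v\<close>, and the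
  concatenation ends at a visit to \<open>w\<close> with a prescribed number; such paths are prefix free.\<close>

lemma green_escape_le:
  "psum {b \<in> paths x v. loc x b w < m} srw_prob * escape_prob v w \<le> of_nat m"
proof -
  let ?R = "{r \<in> hpaths v w. v \<notin> set (tl (vis v r))}"
  let ?A = "\<lambda>j. {b \<in> paths x v. loc x b w = j}"
  have one: "psum (?A j) srw_prob * escape_prob v w \<le> 1" for j
  proof -
    have "psum (?A j) srw_prob * escape_prob v w = psum (?A j \<times> ?R) (\<lambda>(b, r). srw_prob b * srw_prob r)"
      by (simp add: psum_Sigma escape_prob_def psum_cmult psum_multc)
    also have "\<dots> \<le> psum {us \<in> paths x w. loc x us w = j} srw_prob"
    proof (rule psum_inj_le[of "\<lambda>(b, r). b @ r"])
      show "inj_on (\<lambda>(b, r). b @ r) (?A j \<times> ?R)"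
        by (rule inj_on_subset[OF append_escape_inj[of x v w]]) auto
      show "(\<lambda>(b, r). b @ r) ` (?A j \<times> ?R) \<subseteq> {us \<in> paths x w. loc x us w = j}"
        by (auto simp: hpaths_def vis_append count_list_append paths_endpoint count_list_0_iff
            intro: paths_append)
    qed (auto simp: srw_prob_append)
    also have "\<dots> \<le> 1"
      by (rule psum_prefix_free[OF _ prefix_free_nth_visit]) (use paths_lists in blast)
    finally show ?thesis .
  qed
  have "psum {b \<in> paths x v. loc x b w < m} srw_prob \<le> psum {..<m} (\<lambda>j. psum (?A j) srw_prob)"
    by (rule order_trans[OF psum_subset psum_UN_le]) auto
  then have "psum {b \<in> paths x v. loc x b w < m} srw_prob * escape_prob v w
      \<le> (\<Sum>j<m. psum (?A j) srw_prob * escape_prob v w)"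
    by (simp add: psum_finite sum_distrib_right[symmetric] mult_right_mono)
  also have "\<dots> \<le> (\<Sum>j<m. 1)" by (rule sum_mono) (rule one)
  finally show ?thesis by simp
qed

lemma loc_eq_card: "loc x us z = card {k. k < length us \<and> x + sum_list (take k us) = z}"
proof -
  have "loc x us z = card {k. k < length us \<and> z = vis x us ! k}"
    by (simp add: count_list_eq_length_filter length_filter_conv_card)
  also have "{k. k < length us \<and> z = vis x us ! k} = {k. k < length us \<and> x + sum_list (take k us) = z}"
    by (auto simp: nth_vis)
  finally show ?thesis .
qed

text \<open>The factor \<open>loc x b z\<close> amounts to marking one visit to \<open>z\<close>.
  Cutting there gives two paths, each visiting \<open>w\<close> at most as often as
  \<open>b\<close>, and the two pieces determine both the path and the mark.\<close>

lemma psum_local_time_le: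
  "psum {b \<in> paths x y. loc x b w < m} (\<lambda>b. of_nat (loc x b z) * srw_prob b)
    \<le> psum {b \<in> paths x z. loc x b w < m} srw_prob * psum {b \<in> paths z y. loc z b w < m} srw_prob"
proof -
  let ?K = "\<lambda>b. {k. k < length b \<and> x + sum_list (take k b) = z}"
  let ?P = "\<lambda>x y. {b \<in> paths x y. loc x b w < m}"
  have "psum (?P x y) (\<lambda>b. of_nat (loc x b z) * srw_prob b) = psum (SIGMA b:?P x y. ?K b) (\<lambda>(b, k). srw_prob b)"
    by (simp add: psum_Sigma psum_const loc_eq_card)
  also have "\<dots> \<le> psum (?P x z \<times> ?P z y) (\<lambda>(b, b'). srw_prob b * srw_prob b')"
  proof (rule psum_inj_le[of "\<lambda>(b, k). (take k b, drop k b)"])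
    show "inj_on (\<lambda>(b, k). (take k b, drop k b)) (SIGMA b:?P x y. ?K b)"
    proof (rule inj_onI, clarify)
      fix b k b' k'
      assume h: "k < length b" "k' < length b'" "take k b = take k' b'" "drop k b = drop k' b'"
      then have "b = b'" by (metis append_take_drop_id)
      moreover have "k = k'" using h(1-3) by (metis length_take min.absorb4)
      ultimately show "b = b' \<and> k = k'" by simp
    qed
    show "(\<lambda>(b, k). (take k b, drop k b)) ` (SIGMA b:?P x y. ?K b) \<subseteq> ?P x z \<times> ?P z y"
    proof (rule image_subsetI)
      fix q assume "q \<in> (SIGMA b:?P x y. ?K b)"
      then obtain b k where q: "q = (b, k)" and
        h: "b \<in> paths x y" "loc x b w < m" "k < length b" "x + sum_list (take k b) = z"
        by auto
      have v: "vis x b = vis x (take k b) @ vis (x + sum_list (take k b)) (drop k b)"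
        by (metis append_take_drop_id vis_append)
      have p: "take k b \<in> paths x (x + sum_list (take k b)) \<and> drop k b \<in> paths (x + sum_list (take k b)) y"
        using append_in_paths[of "take k b" "drop k b" x y] h(1) by simp
      show "(\<lambda>(b, k). (take k b, drop k b)) q \<in> ?P x z \<times> ?P z y"
        using p h(2) by (simp add: q v h(4) count_list_append)
    qed
    fix p assume "p \<in> (SIGMA b:?P x y. ?K b)"
    then show "(\<lambda>(b, k). srw_prob b) p \<le> (\<lambda>(b, b'). srw_prob b * srw_prob b') ((\<lambda>(b, k). (take k b, drop k b)) p)"
      by (auto simp: srw_prob_append[symmetric])
  qed
  also have "\<dots> = psum (?P x z) srw_prob * psum (?P z y) srw_prob"
    by (simp add: psum_Sigma psum_cmult psum_multc)
  finally show ?thesis .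
qed

section \<open>Decomposition at the first and the last visit to a set\<close>

lemma split_first_visit:
  "set (vis x us) \<inter> B \<noteq> {} \<Longrightarrow> \<exists>a b. us = a @ b \<and> set (vis x a) \<inter> B = {} \<and> x + sum_list a \<in> B"
proof (induction us arbitrary: x)
  case (Cons u us)
  show ?case
  proof (cases "x \<in> B")
    case True
    then show ?thesis by (intro exI[of _ "[]"] exI[of _ "u # us"]) auto
  next
    case False
    with Cons.prems have "set (vis (x + u) us) \<inter> B \<noteq> {}" by simp
    from Cons.IH[OF this] obtain a b where
      "us = a @ b" "set (vis (x + u) a) \<inter> B = {}" "(x + u) + sum_list a \<in> B"
      by blast
    with False show ?thesis by (intro exI[of _ "u # a"] exI[of _ b]) (auto simp: add.assoc)
  qed
qed simp

lemma split_last_visit: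
  "set (vis x us) \<inter> B \<noteq> {} \<Longrightarrow> \<exists>b u c. us = b @ u # c \<and> x + sum_list b \<in> B \<and>
     set (vis (x + sum_list b + u) c) \<inter> B = {}"
proof (induction us arbitrary: x)
  case (Cons u us)
  show ?case
  proof (cases "set (vis (x + u) us) \<inter> B = {}")
    case True
    with Cons.prems have "x \<in> B" by auto
    with True show ?thesis by (intro exI[of _ "[]"] exI[of _ u] exI[of _ us]) auto
  next
    case False
    then obtain b u' c where "us = b @ u' # c" "(x + u) + sum_list b \<in> B"
       "set (vis ((x + u) + sum_list b + u') c) \<inter> B = {}"
      using Cons.IH by metis
    then show ?thesis by (intro exI[of _ "u # b"] exI[of _ u'] exI[of _ c]) (auto simp: add.assoc)
  qed
qed simp

definition outer_boundary :: "(int ^ 'd::finite) set \<Rightarrow> (int ^ 'd) set" where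
  "outer_boundary B = {x + u | x u. x \<in> B \<and> u \<in> unit_steps} - B"

text \<open>The middle piece includes the step that leaves \<open>B\<close> for good. If
  \<open>c\<close> is empty, then \<open>x2\<close> is the endpoint \<open>y\<close>, which no list
  of visited sites records; there \<open>y \<notin> B\<close> places \<open>x2\<close>
  outside.\<close>

lemma split_visits:
  fixes us :: "(int ^ 'd::finite) list"
  assumes "us \<in> paths x y" "y \<notin> B" "set (vis x us) \<inter> B \<noteq> {}"
  shows "\<exists>a b c x1 x2. us = a @ b @ c \<and> a \<in> paths x x1 \<and> b \<in> paths x1 x2 \<and> c \<in> paths x2 y \<and>
    set (vis x a) \<inter> B = {} \<and> set (vis x2 c) \<inter> B = {} \<and> x1 \<in> B \<and> x2 \<in> outer_boundary B"
proof -
  obtain b0 u c where 1: "us = b0 @ u # c" "x + sum_list b0 \<in> B"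
     "set (vis (x + sum_list b0 + u) c) \<inter> B = {}"
    using split_last_visit[OF assms(3)] by blast
  have "set (vis x (b0 @ [u])) \<inter> B \<noteq> {}" using 1 by (auto simp: vis_append)
  then obtain a b where 2: "b0 @ [u] = a @ b" "set (vis x a) \<inter> B = {}" "x + sum_list a \<in> B"
    using split_first_visit by blast
  define x2 where "x2 = x + sum_list b0 + u"
  have x2: "x2 = x + sum_list a + sum_list b"
    using arg_cong[OF 2(1), of sum_list] by (simp add: x2_def add.assoc)
  have us: "us = a @ b @ c" using 1(1) 2(1) by (metis append.assoc append_Cons append_Nil)
  have p: "a \<in> paths x (x + sum_list a)" "b \<in> paths (x + sum_list a) x2" "c \<in> paths x2 y"
    using assms(1) unfolding us x2 by (auto simp: append_in_paths)
  have u: "u \<in> unit_steps" using assms(1) unfolding 1 by (auto simp: append_in_paths)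
  have "x2 \<notin> B"
  proof (cases c)
    case Nil
    with p(3) assms(2) show ?thesis by auto
  next
    case (Cons v c')
    with 1(3) show ?thesis by (auto simp: x2_def)
  qed
  with 1(2) u have "x2 \<in> outer_boundary B" by (auto simp: outer_boundary_def x2_def)
  with us p 1(3) 2(2,3) show ?thesis unfolding x2_def[symmetric] by blast
qed

text \<open>Both cuts can be read off the whole path: \<open>a\<close> lasts until the first visit
  to \<open>B\<close>, and \<open>k\<close> has as many steps as the path has visits to
  \<open>B\<close>.\<close>

lemma append3_inj:
  assumes "set (vis x a) \<inter> B = {}" "set (vis x2 c) \<inter> B = {}" "set (vis x1 k) \<subseteq> B" "k \<noteq> []"
    "x + sum_list a = x1" "x1 + sum_list k = x2"
    "set (vis x a') \<inter> B = {}" "set (vis x2' c') \<inter> B = {}" "set (vis x1' k') \<subseteq> B" "k' \<noteq> []"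
    "x + sum_list a' = x1'" "x1' + sum_list k' = x2'"
    "a @ k @ c = a' @ k' @ c'"
  shows "a = a' \<and> k = k' \<and> c = c'"
proof -
  have *: "length a = length (takeWhile (\<lambda>v. v \<notin> B) (vis x (a @ k @ c))) \<and>
      length k = length (filter (\<lambda>v. v \<in> B) (vis x (a @ k @ c)))"
    if "set (vis x a) \<inter> B = {}" "set (vis x2 c) \<inter> B = {}" "set (vis x1 k) \<subseteq> B" "k \<noteq> []"
      "x + sum_list a = x1" "x1 + sum_list k = x2" for a k c x1 x2
  proof -
    have v: "vis x (a @ k @ c) = vis x a @ vis x1 k @ vis x2 c"
      using that(5,6) by (simp add: vis_append)
    have "takeWhile (\<lambda>v. v \<notin> B) (vis x1 k @ vis x2 c) = []"
      using that(3,4) by (cases k) auto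
    then have "takeWhile (\<lambda>v. v \<notin> B) (vis x (a @ k @ c)) = vis x a"
      unfolding v using that(1) by (subst takeWhile_append2) auto
    moreover have "filter (\<lambda>v. v \<in> B) (vis x a) = []" "filter (\<lambda>v. v \<in> B) (vis x2 c) = []"
        "filter (\<lambda>v. v \<in> B) (vis x1 k) = vis x1 k"
      using that(1-3) by (auto simp: filter_empty_conv filter_id_conv)
    ultimately show ?thesis by (simp add: v)
  qed
  have "length a = length a'" "length k = length k'"
    using *[OF assms(1-6)] *[OF assms(7-12)] assms(13) by metis+
  with assms(13) show ?thesis by simp
qed

section \<open>Site weights and the surgery inequality\<close>

locale site_weights =
  fixes \<phi> :: "nat \<Rightarrow> ennreal"
  assumes phi_0: "\<phi> 0 = 1" and phi_antimono: "antimono \<phi>"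
begin

definition Phi :: "'v::monoid_add \<Rightarrow> 'v list \<Rightarrow> ennreal" where
  "Phi x us = (\<Prod>z\<in>set (vis x us). \<phi> (loc x us z))"

definition wt :: "int ^ 'd::finite \<Rightarrow> (int ^ 'd) list \<Rightarrow> ennreal" where
  "wt x us = srw_prob us * Phi x us"

lemma phi_mono: "i \<le> j \<Longrightarrow> \<phi> j \<le> \<phi> i"
  using phi_antimono by (auto simp: antimono_def)

lemma phi_le_1: "\<phi> i \<le> 1"
  using phi_mono[of 0 i] by (simp add: phi_0)

lemma Phi_superset:
  assumes "finite S" "set (vis x us) \<subseteq> S"
  shows "Phi x us = (\<Prod>z\<in>S. \<phi> (loc x us z))"
  unfolding Phi_def using assms
  by (intro prod.mono_neutral_left) (auto simp: phi_0 count_list_0_iff)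

lemma Phi_le_range: "Phi x us \<le> \<phi> 1 ^ card (set (vis x us))"
proof -
  have "Phi x us \<le> (\<Prod>z\<in>set (vis x us). \<phi> 1)"
    unfolding Phi_def
  proof (intro prod_mono_ennreal)
    fix z assume "z \<in> set (vis x us)"
    then have "loc x us z \<noteq> 0" by (simp add: count_list_0_iff)
    then show "\<phi> (loc x us z) \<le> \<phi> 1" by (intro phi_mono) simp
  qed
  then show ?thesis by simp
qed

text \<open>Only the visited sites are confined to \<open>B\<close>, so the endpoint
  \<open>y\<close> may lie on the outer boundary.\<close>

definition conn :: "(int ^ 'd::finite) set \<Rightarrow> int ^ 'd \<Rightarrow> int ^ 'd \<Rightarrow> ennreal" where
  "conn B x y = psum {k \<in> paths x y. set (vis x k) \<subseteq> B} (wt x)"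

text \<open>The weight, outside the set that is to be re-routed, of the pieces before the first and
  after the last visit to it.\<close>

definition outer_wt :: "int ^ 'd::finite \<Rightarrow> (int ^ 'd) list \<Rightarrow> int ^ 'd \<Rightarrow> (int ^ 'd) list \<Rightarrow> ennreal" where
  "outer_wt x a x2 c = srw_prob a * srw_prob c *
     (\<Prod>v\<in>set (vis x a) \<union> set (vis x2 c). \<phi> (loc x a v + loc x2 c v))"

text \<open>Each site of \<open>B\<close> contributes at most \<open>\<phi> m\<close>. Elsewhere the
  visits made by \<open>b\<close> are ignored, which can only increase the product because
  \<open>\<phi>\<close> is decreasing.\<close>

lemma wt_surgery_upper:
  assumes "finite B" "x + sum_list a = x1" "x1 + sum_list b = x2"
    "set (vis x a) \<inter> B = {}" "set (vis x2 c) \<inter> B = {}"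
    "\<And>v. v \<in> B \<Longrightarrow> m \<le> loc x (a @ b @ c) v"
  shows "wt x (a @ b @ c) \<le> outer_wt x a x2 c * \<phi> m ^ card B * srw_prob b"
proof -
  let ?us = "a @ b @ c" and ?AC = "set (vis x a) \<union> set (vis x2 c)"
  let ?S = "set (vis x ?us) - B"
  have v: "vis x ?us = vis x a @ vis x1 b @ vis x2 c"
    using assms(2,3) by (simp add: vis_append)
  have "Phi x ?us = (\<Prod>z\<in>B \<union> ?S. \<phi> (loc x ?us z))"
    by (rule Phi_superset) (use assms(1) in auto)
  also have "\<dots> = (\<Prod>z\<in>B. \<phi> (loc x ?us z)) * (\<Prod>z\<in>?S. \<phi> (loc x ?us z))"
    by (rule prod.union_disjoint) (use assms(1) in auto)
  also have "\<dots> \<le> (\<Prod>z\<in>B. \<phi> m) * (\<Prod>z\<in>?S. \<phi> (loc x a z + loc x2 c z))"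
    using assms(6)
    by (intro mult_mono prod_mono_ennreal phi_mono) (auto simp: v count_list_append)
  also have "(\<Prod>z\<in>?S. \<phi> (loc x a z + loc x2 c z)) = (\<Prod>z\<in>?AC. \<phi> (loc x a z + loc x2 c z))"
    by (rule prod.mono_neutral_right) (use assms(4,5) in \<open>auto simp: v phi_0 count_list_0_iff\<close>)
  finally have "Phi x ?us \<le> \<phi> m ^ card B * (\<Prod>z\<in>?AC. \<phi> (loc x a z + loc x2 c z))" by simp
  then have "wt x ?us \<le> srw_prob a * (srw_prob b * srw_prob c) * (\<phi> m ^ card B * (\<Prod>z\<in>?AC. \<phi> (loc x a z + loc x2 c z)))"
    unfolding wt_def srw_prob_append by (rule mult_left_mono) simp
  then show ?thesis by (simp add: outer_wt_def mult_ac)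
qed

text \<open>The connection visits only sites of \<open>B\<close> and the outer pieces none, so local
  times do not mix and the weight factorizes exactly.\<close>

lemma wt_surgery_lower:
  assumes "x + sum_list a = x1" "x1 + sum_list k = x2"
    "set (vis x a) \<inter> B = {}" "set (vis x2 c) \<inter> B = {}" "set (vis x1 k) \<subseteq> B"
  shows "outer_wt x a x2 c * wt x1 k = wt x (a @ k @ c)"
proof -
  let ?us = "a @ k @ c" and ?AC = "set (vis x a) \<union> set (vis x2 c)"
  have v: "vis x ?us = vis x a @ vis x1 k @ vis x2 c"
    using assms(1,2) by (simp add: vis_append)
  have "Phi x ?us = (\<Prod>z\<in>?AC \<union> set (vis x1 k). \<phi> (loc x ?us z))"
    by (rule Phi_superset) (auto simp: v)
  also have "\<dots> = (\<Prod>z\<in>?AC. \<phi> (loc x ?us z)) * (\<Prod>z\<in>set (vis x1 k). \<phi> (loc x ?us z))"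
    by (rule prod.union_disjoint) (use assms(3-5) in auto)
  also have "(\<Prod>z\<in>?AC. \<phi> (loc x ?us z)) = (\<Prod>z\<in>?AC. \<phi> (loc x a z + loc x2 c z))"
  proof (intro prod.cong refl)
    fix z assume "z \<in> ?AC"
    then have "z \<notin> set (vis x1 k)" using assms(3-5) by auto
    then show "\<phi> (loc x ?us z) = \<phi> (loc x a z + loc x2 c z)"
      by (simp add: v count_list_append)
  qed
  also have "(\<Prod>z\<in>set (vis x1 k). \<phi> (loc x ?us z)) = Phi x1 k"
    unfolding Phi_def
  proof (intro prod.cong refl)
    fix z assume "z \<in> set (vis x1 k)"
    then have "z \<notin> set (vis x a)" "z \<notin> set (vis x2 c)" using assms(3-5) by auto
    then show "\<phi> (loc x ?us z) = \<phi> (loc x1 k z)"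
      by (simp add: v count_list_append)
  qed
  finally show ?thesis by (simp add: wt_def outer_wt_def srw_prob_append mult_ac)
qed

text \<open>Both sums are compared with the total outer weight \<open>psum AC OW\<close>. The
  discarded middle pieces contribute at most \<open>m / e\<close> for each of the two killed Green
  functions, and the substituted connections contribute at least \<open>s\<close>. Keeping
  \<open>s\<close> and the square of \<open>e\<close> as factors on the left avoids division in
  \<open>ennreal\<close>.\<close>

lemma surgery:
  fixes x y :: "int ^ 'd::finite"
  assumes "finite B" "z \<in> B" "0 < m"
    and esc: "\<And>v. v \<in> insert z (outer_boundary B) \<Longrightarrow> e \<le> escape_prob v w"
    and con: "\<And>x1 x2. x1 \<in> B \<Longrightarrow> x2 \<in> outer_boundary B \<Longrightarrow> s \<le> conn B x1 x2"
  shows "psum {us \<in> hpaths x y. (\<forall>v\<in>B. m \<le> loc x us v) \<and> loc x us w < m} (\<lambda>us. of_nat (loc x us z) * wt x us)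
      * (s * e\<^sup>2)
    \<le> \<phi> m ^ card B * of_nat m ^ 2 * psum {us \<in> hpaths x y. set (vis x us) \<inter> B \<noteq> {}} (wt x)"
    (is "psum ?L ?f * _ \<le> _ * psum ?R _")
proof (cases "y \<in> B")
  case True
  \<comment> \<open>A path stopped on hitting \<open>y\<close> has local time 0 there.\<close>
  have "\<not> (\<forall>v\<in>B. m \<le> loc x us v)" if "us \<in> hpaths x y" for us
    using that True assms(3) by (auto simp: hpaths_eq intro!: bexI[of _ y])
  then have "?L = {}" by blast
  then show ?thesis by (simp only: psum_empty) simp
next
  case False
  \<comment> \<open>Pairs of outer pieces, before the first and after the last visit to
    \<open>B\<close>. The ends of the missing piece are not stored, being
    \<open>x + sum_list a\<close> and \<open>y - sum_list c\<close>.\<close>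
  define AC where "AC = {(a, c). a \<in> paths x (x + sum_list a) \<and> c \<in> paths (y - sum_list c) y \<and>
     set (vis x a) \<inter> B = {} \<and> set (vis (y - sum_list c) c) \<inter> B = {} \<and>
     y \<notin> set (vis x a) \<and> y \<notin> set (vis (y - sum_list c) c) \<and>
     x + sum_list a \<in> B \<and> y - sum_list c \<in> outer_boundary B}"
  define OW where "OW = (\<lambda>(a, c). outer_wt x a (y - sum_list c) c)"
  define Mid where "Mid = (\<lambda>(a, c). {b \<in> paths (x + sum_list a) (y - sum_list c). loc (x + sum_list a) b w < m})"
  define Con where "Con = (\<lambda>(a, c). {k \<in> paths (x + sum_list a) (y - sum_list c). set (vis (x + sum_list a) k) \<subseteq> B})"
  have "psum ?L ?f \<le> psum (Sigma AC Mid) (\<lambda>(ac, b). OW ac * \<phi> m ^ card B * (of_nat (loc (x + sum_list (fst ac)) b z) * srw_prob b))"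
  proof (rule psum_surj_le[of _ _ "\<lambda>((a, c), b). a @ b @ c"])
    fix us assume us: "us \<in> ?L"
    then have "0 < loc x us z" using assms(2,3) by (auto intro: less_le_trans)
    then have "z \<in> set (vis x us)" by (metis count_list_0_iff less_irrefl)
    then have "set (vis x us) \<inter> B \<noteq> {}" using assms(2) by blast
    moreover have p: "us \<in> paths x y" using us by (simp add: hpaths_def)
    ultimately obtain a b c x1 x2 where d: "us = a @ b @ c" "a \<in> paths x x1" "b \<in> paths x1 x2" "c \<in> paths x2 y"
       "set (vis x a) \<inter> B = {}" "set (vis x2 c) \<inter> B = {}" "x1 \<in> B" "x2 \<in> outer_boundary B"
      using split_visits[OF _ False, of us x] by blast
    have x: "x1 = x + sum_list a" "x2 = y - sum_list c" "x2 = x1 + sum_list b"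
      using d(2-4) by (auto simp: paths_def)
    have v: "vis x us = vis x a @ vis x1 b @ vis x2 c"
      using x(1,3) by (simp add: d(1) vis_append)
    have yn: "y \<notin> set (vis x a)" "y \<notin> set (vis x2 c)" and yw: "loc x1 b w < m"
      using us by (simp_all add: hpaths_def v count_list_append)
    have ac: "(a, c) \<in> AC" using d(2,4-8) yn by (simp add: AC_def x(1)[symmetric] x(2)[symmetric])
    have b: "b \<in> Mid (a, c)" using d(3) yw by (simp add: Mid_def x(1)[symmetric] x(2)[symmetric])
    have l: "loc x us z = loc x1 b z"
      using d(5,6) assms(2) by (auto simp: v count_list_append count_list_0_iff)
    have "wt x us \<le> outer_wt x a x2 c * \<phi> m ^ card B * srw_prob b"
      unfolding d(1) by (rule wt_surgery_upper[where ?x1.0 = x1]) (use assms(1) x d us in auto)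
    then have "?f us \<le> of_nat (loc x1 b z) * (outer_wt x a x2 c * \<phi> m ^ card B * srw_prob b)"
      unfolding l by (rule mult_left_mono) simp
    then show "\<exists>p\<in>Sigma AC Mid. (\<lambda>((a, c), b). a @ b @ c) p = us \<and> ?f us \<le> (\<lambda>(ac, b). OW ac * \<phi> m ^ card B * (of_nat (loc (x + sum_list (fst ac)) b z) * srw_prob b)) p"
      using ac b by (intro bexI[of _ "((a, c), b)"]) (auto simp: d(1) OW_def x(1,2) mult_ac)
  qed
  also have "\<dots> = psum AC (\<lambda>ac. OW ac * \<phi> m ^ card B * psum (Mid ac) (\<lambda>b. of_nat (loc (x + sum_list (fst ac)) b z) * srw_prob b))"
    by (simp add: psum_Sigma psum_cmult)
  finally have upper: "psum ?L ?f * e\<^sup>2 \<le> psum AC (\<lambda>ac. OW ac * \<phi> m ^ card B * psum (Mid ac) (\<lambda>b. of_nat (loc (x + sum_list (fst ac)) b z) * srw_prob b)) * e\<^sup>2"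
    by (rule mult_right_mono) simp
  also have "\<dots> = psum AC (\<lambda>ac. OW ac * \<phi> m ^ card B * (psum (Mid ac) (\<lambda>b. of_nat (loc (x + sum_list (fst ac)) b z) * srw_prob b) * e\<^sup>2))"
    by (simp only: psum_multc[symmetric] mult.assoc)
  also have "\<dots> \<le> psum AC (\<lambda>ac. OW ac * \<phi> m ^ card B * of_nat m ^ 2)"
  proof (intro psum_mono mult_left_mono)
    fix ac assume "ac \<in> AC"
    then obtain a c where ac: "ac = (a, c)" "(a, c) \<in> AC" by (cases ac) auto
    define x1 x2 where "x1 = x + sum_list a" and "x2 = y - sum_list c"
    have x2: "x2 \<in> outer_boundary B" using ac by (simp add: AC_def x2_def)
    have "psum (Mid ac) (\<lambda>b. of_nat (loc (x + sum_list (fst ac)) b z) * srw_prob b) \<le>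
       psum {b \<in> paths x1 z. loc x1 b w < m} srw_prob * psum {b \<in> paths z x2. loc z b w < m} srw_prob"
      using psum_local_time_le[of x1 x2 w m z] by (simp add: ac Mid_def x1_def x2_def)
    then have "psum (Mid ac) (\<lambda>b. of_nat (loc (x + sum_list (fst ac)) b z) * srw_prob b) * e\<^sup>2 \<le>
       psum {b \<in> paths x1 z. loc x1 b w < m} srw_prob * psum {b \<in> paths z x2. loc z b w < m} srw_prob * e\<^sup>2"
      by (rule mult_right_mono) simp
    also have "\<dots> = (psum {b \<in> paths x1 z. loc x1 b w < m} srw_prob * e) * (psum {b \<in> paths z x2. loc z b w < m} srw_prob * e)"
      by (simp add: power2_eq_square mult_ac)
    \<comment> \<open>Each escape probability belongs to the endpoint of the Green function that it
      bounds: \<open>z\<close> for the first factor and \<open>x2\<close> for the second.\<close>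
    also have "\<dots> \<le> (psum {b \<in> paths x1 z. loc x1 b w < m} srw_prob * escape_prob z w)
        * (psum {b \<in> paths z x2. loc z b w < m} srw_prob * escape_prob x2 w)"
      using esc[of z] esc[of x2] x2 by (intro mult_mono order_refl) auto
    also have "\<dots> \<le> of_nat m * of_nat m"
      by (intro mult_mono green_escape_le) auto
    finally show "psum (Mid ac) (\<lambda>b. of_nat (loc (x + sum_list (fst ac)) b z) * srw_prob b) * e\<^sup>2 \<le> of_nat m ^ 2"
      by (simp add: power2_eq_square)
  qed simp
  also have "\<dots> = \<phi> m ^ card B * of_nat m ^ 2 * psum AC OW"
    by (simp only: psum_multc mult_ac)
  finally have up: "psum ?L ?f * e\<^sup>2 \<le> \<phi> m ^ card B * of_nat m ^ 2 * psum AC OW" .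
  have "psum AC OW * s = psum AC (\<lambda>ac. OW ac * s)" by (simp add: psum_multc)
  also have "\<dots> \<le> psum AC (\<lambda>ac. OW ac * psum (Con ac) (wt (x + sum_list (fst ac))))"
    using con by (intro psum_mono mult_left_mono) (auto simp: AC_def Con_def conn_def)
  also have "\<dots> = psum (Sigma AC Con) (\<lambda>(ac, k). OW ac * wt (x + sum_list (fst ac)) k)"
    by (simp add: psum_Sigma psum_cmult)
  also have "\<dots> \<le> psum ?R (wt x)"
  proof (rule psum_inj_le[of "\<lambda>((a, c), k). a @ k @ c"])
    have ne: "k \<noteq> []" if "((a, c), k) \<in> Sigma AC Con" for a c k
      using that by (auto simp: AC_def Con_def outer_boundary_def)
    show "inj_on (\<lambda>((a, c), k). a @ k @ c) (Sigma AC Con)"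
    proof (rule inj_onI)
      fix p q
      assume pq: "p \<in> Sigma AC Con" "q \<in> Sigma AC Con"
        "(\<lambda>((a, c), k). a @ k @ c) p = (\<lambda>((a, c), k). a @ k @ c) q"
      obtain a c k a' c' k' where e: "p = ((a, c), k)" "q = ((a', c'), k')"
        by (metis prod.exhaust)
      have h: "(a, c) \<in> AC" "k \<in> Con (a, c)" "(a', c') \<in> AC" "k' \<in> Con (a', c')" "a @ k @ c = a' @ k' @ c'"
        using pq e by auto
      have "k \<noteq> []" "k' \<noteq> []" using ne[of a c k] ne[of a' c' k'] pq e by auto
      then have "a = a' \<and> k = k' \<and> c = c'"
        using h by (intro append3_inj[of x a B "y - sum_list c" c "x + sum_list a" k a' "y - sum_list c'" c' "x + sum_list a'" k'])
          (simp_all add: AC_def Con_def paths_endpoint)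
      then show "p = q" using e by simp
    qed
    show "(\<lambda>((a, c), k). a @ k @ c) ` Sigma AC Con \<subseteq> ?R"
    proof (rule image_subsetI)
      fix q assume q: "q \<in> Sigma AC Con"
      then obtain a c k where e: "q = ((a, c), k)" and h: "(a, c) \<in> AC" "k \<in> Con (a, c)" by auto
      define x1 x2 where "x1 = x + sum_list a" and "x2 = y - sum_list c"
      have p: "a \<in> paths x x1" "k \<in> paths x1 x2" "c \<in> paths x2 y" "set (vis x1 k) \<subseteq> B" "x1 \<in> B"
        "y \<notin> set (vis x a)" "y \<notin> set (vis x2 c)"
        using h by (simp_all add: AC_def Con_def x1_def x2_def)
      have v: "vis x (a @ k @ c) = vis x a @ vis x1 k @ vis x2 c"
        using p(1,2) by (simp add: vis_append paths_endpoint flip: add.assoc)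
      have "x1 \<in> set (vis x1 k)" using ne[of a c k] q e by (cases k) auto
      then have "set (vis x (a @ k @ c)) \<inter> B \<noteq> {}" using p(5) by (auto simp: v)
      moreover have "a @ k @ c \<in> paths x y"
        using p(1-3) by (intro paths_append[of _ x x1] paths_append[of _ x1 x2])
      moreover have "y \<notin> set (vis x (a @ k @ c))" using p(4,6,7) False by (auto simp: v)
      ultimately show "(\<lambda>((a, c), k). a @ k @ c) q \<in> ?R" by (simp add: hpaths_def e)
    qed
    fix q assume "q \<in> Sigma AC Con"
    then obtain a c k where q: "q = ((a, c), k)" "(a, c) \<in> AC" "k \<in> Con (a, c)" by auto
    have "OW (a, c) * wt (x + sum_list a) k = wt x (a @ k @ c)"
      unfolding OW_def prod.case
      by (rule wt_surgery_lower[where B = B]) (use q in \<open>auto simp: AC_def Con_def paths_endpoint\<close>)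
    then show "(\<lambda>(ac, k). OW ac * wt (x + sum_list (fst ac)) k) q \<le> wt x ((\<lambda>((a, c), k). a @ k @ c) q)"
      by (simp add: q(1))
  qed
  finally have low: "psum AC OW * s \<le> psum ?R (wt x)" .
  have "psum ?L ?f * (s * e\<^sup>2) = (psum ?L ?f * e\<^sup>2) * s" by (simp only: mult_ac)
  also have "\<dots> \<le> (\<phi> m ^ card B * of_nat m ^ 2 * psum AC OW) * s"
    by (rule mult_right_mono[OF up]) simp
  also have "\<dots> = \<phi> m ^ card B * of_nat m ^ 2 * (psum AC OW * s)" by (simp only: mult_ac)
  also have "\<dots> \<le> \<phi> m ^ card B * of_nat m ^ 2 * psum ?R (wt x)"
    by (rule mult_left_mono[OF low]) simp
  finally show ?thesis .
qed

end

section \<open>Local times and ranges\<close>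

definition cube :: "int ^ 'd::finite \<Rightarrow> nat \<Rightarrow> (int ^ 'd) set" where
  "cube z K = {v. \<forall>i. \<bar>v $ i - z $ i\<bar> \<le> int K}"

lemma cube_eq_image:
  "cube z K = vec_lambda ` (Pi\<^sub>E UNIV (\<lambda>i. {z $ i - int K..z $ i + int K}))"
proof (intro equalityI subsetI)
  fix v assume "v \<in> cube z K"
  then have "vec_nth v \<in> Pi\<^sub>E UNIV (\<lambda>i. {z $ i - int K..z $ i + int K})"
    by (auto simp: cube_def PiE_iff abs_le_iff algebra_simps)
  then show "v \<in> vec_lambda ` (Pi\<^sub>E UNIV (\<lambda>i. {z $ i - int K..z $ i + int K}))"
    by (rule image_eqI[rotated]) (simp add: vec_nth_inverse)
next
  fix v assume "v \<in> vec_lambda ` (Pi\<^sub>E UNIV (\<lambda>i. {z $ i - int K..z $ i + int K}))"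
  then show "v \<in> cube z K"
    by (auto simp: cube_def PiE_iff abs_le_iff algebra_simps)
qed

lemma finite_cube [simp]: "finite (cube z K)"
  unfolding cube_eq_image by (intro finite_imageI finite_PiE) auto

lemma card_cube: "card (cube (z :: int ^ 'd::finite) K) = (2 * K + 1) ^ CARD('d)"
proof -
  have "card (cube z K) = card (Pi\<^sub>E UNIV (\<lambda>i. {z $ i - int K..z $ i + int K}))"
    unfolding cube_eq_image by (rule card_image) (auto intro!: inj_onI simp: vec_lambda_inject)
  also have "\<dots> = (\<Prod>i\<in>(UNIV :: 'd set). card {z $ i - int K..z $ i + int K})"
    by (rule card_PiE) simp
  also have "\<dots> = (2 * K + 1) ^ CARD('d)"
  proof -
    have "card {a - int K..a + int K} = 2 * K + 1" for a :: int by simp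
    then show ?thesis by simp
  qed
  finally show ?thesis .
qed

lemma cube_0 [simp]: "cube z 0 = {z}"
  by (auto simp: cube_def vec_eq_iff)

lemma cube_sym: "v \<in> cube z K \<longleftrightarrow> z \<in> cube v K"
  by (simp add: cube_def abs_minus_commute)

lemma self_in_cube [simp]: "z \<in> cube z K"
  by (simp add: cube_def)

definition dist1 :: "int ^ 'd::finite \<Rightarrow> int ^ 'd \<Rightarrow> nat" where
  "dist1 x y = (\<Sum>i\<in>UNIV. nat \<bar>x $ i - y $ i\<bar>)"

lemma dist1_eq_0_iff: "dist1 x y = 0 \<longleftrightarrow> x = y"
  by (simp add: dist1_def vec_eq_iff)

lemma coord_le_dist1: "\<bar>x $ i - y $ i\<bar> \<le> int (dist1 x y)"
proof -
  have "nat \<bar>x $ i - y $ i\<bar> \<le> dist1 x y"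
    unfolding dist1_def by (rule member_le_sum) auto
  then show ?thesis by linarith
qed

lemma in_cube_dist1: "y \<in> cube z (dist1 y z)"
  by (simp add: cube_def coord_le_dist1)

lemma dist1_le_cube: "v \<in> cube z K \<Longrightarrow> dist1 z v \<le> CARD('d) * K" for z :: "int ^ 'd::finite"
proof -
  assume v: "v \<in> cube z K"
  have "dist1 z v \<le> (\<Sum>i\<in>(UNIV :: 'd set). K)"
    unfolding dist1_def
  proof (rule sum_mono)
    fix i have "\<bar>v $ i - z $ i\<bar> \<le> int K" using v by (simp add: cube_def)
    then show "nat \<bar>z $ i - v $ i\<bar> \<le> K" by linarith
  qed
  then show ?thesis by simp
qed

text \<open>A path that is monotone in every coordinate. Its length serves the lower bound on the
  partition function, the absence of a return to \<open>x\<close> serves the escape probability, and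
  confinement to the bounding box serves the connections inside a cube.\<close>

lemma shortest_path:
  "\<exists>us\<in>hpaths x y. length us = dist1 x y \<and> x \<notin> set (tl (vis x us)) \<and>
     (\<forall>v\<in>set (vis x us). \<forall>i. min (x $ i) (y $ i) \<le> v $ i \<and> v $ i \<le> max (x $ i) (y $ i))"
proof (induction "dist1 x y" arbitrary: x)
  case 0
  then have "x = y" by (simp add: dist1_eq_0_iff)
  then show ?case by (intro bexI[of _ "[]"]) (auto simp: hpaths_def dist1_eq_0_iff)
next
  case (Suc n)
  then have "x \<noteq> y" by (auto simp: dist1_eq_0_iff[symmetric])
  then obtain i where i: "x $ i \<noteq> y $ i" by (auto simp: vec_eq_iff)
  define s where "s = (if x $ i < y $ i then 1 else - 1 :: int)"
  define x' where "x' = x + axis i s"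
  have x'i: "x' $ i = x $ i + s" and x'j: "\<And>j. j \<noteq> i \<Longrightarrow> x' $ j = x $ j"
    by (auto simp: x'_def axis_def)
  have u: "axis i s \<in> unit_steps" by (simp add: s_def)
  have "dist1 x y = nat \<bar>x $ i - y $ i\<bar> + (\<Sum>j\<in>UNIV - {i}. nat \<bar>x $ j - y $ j\<bar>)"
    unfolding dist1_def by (rule sum.remove) auto
  moreover have "dist1 x' y = nat \<bar>x' $ i - y $ i\<bar> + (\<Sum>j\<in>UNIV - {i}. nat \<bar>x' $ j - y $ j\<bar>)"
    unfolding dist1_def by (rule sum.remove) auto
  moreover have "(\<Sum>j\<in>UNIV - {i}. nat \<bar>x' $ j - y $ j\<bar>) = (\<Sum>j\<in>UNIV - {i}. nat \<bar>x $ j - y $ j\<bar>)"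
    by (rule sum.cong) (auto simp: x'j)
  moreover have "nat \<bar>x $ i - y $ i\<bar> = Suc (nat \<bar>x' $ i - y $ i\<bar>)"
    using i by (auto simp: x'i s_def)
  ultimately have d: "dist1 x y = Suc (dist1 x' y)" by simp
  with Suc(2) have "n = dist1 x' y" by simp
  from Suc(1)[OF this] obtain us where us: "us \<in> hpaths x' y" "length us = dist1 x' y"
     "\<And>v j. v \<in> set (vis x' us) \<Longrightarrow> min (x' $ j) (y $ j) \<le> v $ j \<and> v $ j \<le> max (x' $ j) (y $ j)"
    by blast
  have mm: "min (x $ j) (y $ j) \<le> min (x' $ j) (y $ j) \<and> max (x' $ j) (y $ j) \<le> max (x $ j) (y $ j)" for j
    using i by (cases "j = i") (auto simp: x'i x'j s_def)
  have "axis i s # us \<in> hpaths x y"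
    using us(1) u \<open>x \<noteq> y\<close> by (auto simp: hpaths_def x'_def)
  moreover have "\<forall>v\<in>set (vis x (axis i s # us)). \<forall>j. min (x $ j) (y $ j) \<le> v $ j \<and> v $ j \<le> max (x $ j) (y $ j)"
  proof (intro ballI allI)
    fix v j assume "v \<in> set (vis x (axis i s # us))"
    then consider "v = x" | "v \<in> set (vis x' us)" by (auto simp: x'_def)
    then show "min (x $ j) (y $ j) \<le> v $ j \<and> v $ j \<le> max (x $ j) (y $ j)"
    proof cases
      case 2
      from us(3)[OF this, of j] mm[of j] show ?thesis by linarith
    qed auto
  qed
  \<comment> \<open>The first step moves coordinate \<open>i\<close> towards \<open>y\<close>, and
    the box spanned by \<open>x'\<close> and \<open>y\<close>, which confines the rest, no longer
    contains \<open>x\<close>.\<close>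
  moreover have "x \<notin> set (vis x' us)"
  proof
    assume "x \<in> set (vis x' us)"
    from us(3)[OF this, of i] i show False by (auto simp: x'i s_def split: if_splits)
  qed
  ultimately show ?case using us(2) d by (intro bexI[of _ "axis i s # us"]) (auto simp: x'_def)
qed

lemma sum_loc: "sum (loc x us) (set (vis x us)) = length us"
  using sum_count_set[of "vis x us" "set (vis x us)"] by simp

lemma psum_loc: "psum UNIV (\<lambda>z. of_nat (loc x us z)) = of_nat (length us)"
proof -
  have "psum UNIV (\<lambda>z. of_nat (loc x us z)) = psum (set (vis x us)) (\<lambda>z. of_nat (loc x us z))"
    by (subst (2) psum_indicator)
      (auto intro!: psum_cong simp: count_list_0_iff split: split_indicator)
  then show ?thesis by (simp add: psum_finite of_nat_sum[symmetric] sum_loc del: of_nat_sum)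
qed

text \<open>The \<open>k\<close> copies of \<open>q ^ k\<close> are dominated one by one by the
  terms of the geometric series.\<close>

lemma real_mult_power_le:
  fixes q :: real assumes "0 \<le> q" "q < 1" shows "real k * q ^ k \<le> 1 / (1 - q)"
proof -
  have "real k * q ^ k = (\<Sum>j<k. q ^ k)" by simp
  also have "\<dots> \<le> (\<Sum>j<k. q ^ j)"
    using assms by (intro sum_mono power_decreasing) auto
  also have "\<dots> = (1 - q ^ k) / (1 - q)" using assms by (simp add: sum_gp_strict)
  also have "\<dots> \<le> 1 / (1 - q)" using assms by (intro divide_right_mono) auto
  finally show ?thesis .
qed

section \<open>Range, partition function and the sum over scales\<close>

context site_weights
begin

text \<open>Up to \<open>n\<close> visited sites cost at most \<open>n\<close> times the partition
  function. A range of \<open>n + k\<close> makes the weight at most \<open>q ^ (n + k)\<close>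
  times the path probability, which absorbs the excess \<open>k\<close>; the path probabilities sum
  to at most 1.\<close>

lemma range_bound:
  assumes q: "\<phi> 1 = ennreal q" "0 \<le> q" "q < 1"
  shows "psum (hpaths x y) (\<lambda>us. of_nat (card (set (vis x us))) * wt x us)
    \<le> of_nat n * psum (hpaths x y) (wt x) + ennreal (q ^ n / (1 - q))"
proof -
  have "of_nat (card (set (vis x us))) * wt x us
      \<le> of_nat n * wt x us + ennreal (q ^ n / (1 - q)) * srw_prob us" for us :: "(int ^ 'a) list" and x
  proof (cases "card (set (vis x us)) \<le> n")
    case True
    then have "of_nat (card (set (vis x us))) * wt x us \<le> of_nat n * wt x us"
      by (intro mult_right_mono) auto
    then show ?thesis by (simp add: add_increasing2)
  next
    case False
    then obtain k where k: "card (set (vis x us)) = n + k"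
      by (metis le_add_diff_inverse nat_le_linear)
    have "of_nat k * wt x us \<le> of_nat k * (srw_prob us * ennreal (q ^ (n + k)))"
      unfolding wt_def using Phi_le_range[of x us] q
      by (intro mult_left_mono) (auto simp: k ennreal_power)
    also have "\<dots> = ennreal (real k * q ^ (n + k)) * srw_prob us"
      using q by (simp add: ennreal_mult ennreal_of_nat_eq_real_of_nat mult_ac)
    also have "\<dots> \<le> ennreal (q ^ n / (1 - q)) * srw_prob us"
    proof (intro mult_right_mono ennreal_leI)
      show "real k * q ^ (n + k) \<le> q ^ n / (1 - q)"
        using mult_left_mono[OF real_mult_power_le[of q k], of "q ^ n"] q
        by (simp add: power_add mult_ac)
    qed simp
    finally show ?thesis by (simp add: k distrib_right)
  qed
  then have "psum (hpaths x y) (\<lambda>us. of_nat (card (set (vis x us))) * wt x us)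
      \<le> psum (hpaths x y) (\<lambda>us. of_nat n * wt x us + ennreal (q ^ n / (1 - q)) * srw_prob us)"
    by (rule psum_mono)
  also have "\<dots> = of_nat n * psum (hpaths x y) (wt x) + ennreal (q ^ n / (1 - q)) * psum (hpaths x y) srw_prob"
    by (simp add: psum_add psum_cmult)
  also have "\<dots> \<le> of_nat n * psum (hpaths x y) (wt x) + ennreal (q ^ n / (1 - q)) * 1"
    by (intro add_left_mono mult_left_mono psum_hpaths_le_1) simp
  finally show ?thesis by simp
qed

text \<open>The local times add up to the length, so a factor \<open>c\<close> per visit becomes a
  factor \<open>c\<close> per step.\<close>

lemma wt_ge:
  fixes us :: "(int ^ 'd::finite) list"
  assumes "0 < c" "\<And>l. ennreal (c ^ l) \<le> \<phi> l"
  shows "ennreal ((c / card (unit_steps :: (int ^ 'd) set)) ^ length us) \<le> wt x us"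
proof -
  have "ennreal (c ^ length us) = ennreal (\<Prod>z\<in>set (vis x us). c ^ loc x us z)"
    by (simp only: power_sum[symmetric] sum_loc)
  also have "\<dots> = (\<Prod>z\<in>set (vis x us). ennreal (c ^ loc x us z))"
    using assms(1) by (intro prod_ennreal[symmetric]) auto
  also have "\<dots> \<le> Phi x us"
    unfolding Phi_def using assms(2) by (intro prod_mono_ennreal) auto
  finally have "srw_prob us * ennreal (c ^ length us) \<le> wt x us"
    unfolding wt_def by (rule mult_left_mono) simp
  then show ?thesis
    using assms(1) by (simp add: srw_prob_def ennreal_mult[symmetric] power_divide divide_inverse power_inverse power_mult_distrib mult.commute)
qed

lemma partition_ge:
  fixes x y :: "int ^ 'd::finite"
  assumes "0 < c" "\<And>l. ennreal (c ^ l) \<le> \<phi> l"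
  shows "ennreal ((c / card (unit_steps :: (int ^ 'd) set)) ^ dist1 x y) \<le> psum (hpaths x y) (wt x)"
proof -
  obtain us where "us \<in> hpaths x y" "length us = dist1 x y"
    using shortest_path by blast
  then show ?thesis
    using wt_ge[OF assms, of us x] psum_mem_le[of us "hpaths x y" "wt x"] by simp
qed

text \<open>The cube around \<open>z\<close> meets the path iff \<open>z\<close> lies in the cube of
  the same radius around a visited site. So a path is counted for at most as many \<open>z\<close>
  as its range times the volume of the cube.\<close>

lemma psum_hits_cube:
  fixes x y :: "int ^ 'd::finite"
  shows "psum UNIV (\<lambda>z. psum {us \<in> hpaths x y. set (vis x us) \<inter> cube z K \<noteq> {}} (wt x))
    \<le> of_nat ((2 * K + 1) ^ CARD('d)) * psum (hpaths x y) (\<lambda>us. of_nat (card (set (vis x us))) * wt x us)"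
proof -
  have "psum UNIV (\<lambda>z. psum {us \<in> hpaths x y. set (vis x us) \<inter> cube z K \<noteq> {}} (wt x)) =
      psum (hpaths x y) (\<lambda>us. psum UNIV (\<lambda>z. if set (vis x us) \<inter> cube z K \<noteq> {} then wt x us else 0))"
    unfolding psum_restrict by (rule psum_swap)
  also have "\<dots> \<le> psum (hpaths x y) (\<lambda>us. of_nat ((2 * K + 1) ^ CARD('d)) * (of_nat (card (set (vis x us))) * wt x us))"
  proof (rule psum_mono)
    fix us :: "(int ^ 'd) list"
    have "psum UNIV (\<lambda>z. if set (vis x us) \<inter> cube z K \<noteq> {} then wt x us else 0) =
        psum {z. set (vis x us) \<inter> cube z K \<noteq> {}} (\<lambda>_. wt x us)"
      using psum_restrict[of UNIV "\<lambda>z. set (vis x us) \<inter> cube z K \<noteq> {}" "\<lambda>_. wt x us"] by simp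
    also have "\<dots> \<le> psum (\<Union>v\<in>set (vis x us). cube v K) (\<lambda>_. wt x us)"
      by (rule psum_subset) (auto intro: cube_sym[THEN iffD1])
    also have "\<dots> \<le> psum (set (vis x us)) (\<lambda>v. psum (cube v K) (\<lambda>_. wt x us))"
      by (rule psum_UN_le)
    also have "\<dots> = of_nat ((2 * K + 1) ^ CARD('d)) * (of_nat (card (set (vis x us))) * wt x us)"
      by (simp only: psum_const finite_cube card_cube finite_set mult_ac)
    finally show "psum UNIV (\<lambda>z. if set (vis x us) \<inter> cube z K \<noteq> {} then wt x us else 0) \<le> \<dots>" .
  qed
  finally show ?thesis by (simp only: psum_cmult)
qed

text \<open>Instead of selecting the maximal scale and a deficient site \<open>w\<close>, all
  candidates are summed. This costs a volume factor and lets the sums over paths, sites and scales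
  be interchanged.\<close>

lemma loc_le_sum_cubees:
  assumes "us \<in> hpaths x y" "0 < m"
  shows "of_nat (loc x us z) \<le> (if z \<in> set (vis x us) then of_nat m else 0) +
    (\<Sum>K. psum (cube z (Suc K)) (\<lambda>w. if (\<forall>v\<in>cube z K. m \<le> loc x us v) \<and> loc x us w < m
       then of_nat (loc x us z) else (0 :: ennreal)))" (is "_ \<le> _ + (\<Sum>K. ?S K)")
proof (cases "loc x us z \<le> m")
  case True
  have "of_nat (loc x us z) \<le> (if z \<in> set (vis x us) then of_nat m else (0 :: ennreal))"
    using True by (auto simp: count_list_0_iff)
  then show ?thesis by (rule add_increasing2[rotated]) simp
next
  case False
  let ?P = "\<lambda>K. \<forall>v\<in>cube z K. m \<le> loc x us v"
  have P0: "?P 0" using False by simp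
  \<comment> \<open>The cube that reaches \<open>y\<close> contains a site of local time 0, so the
    scales with \<open>?P\<close> end.\<close>
  have "\<not> ?P (dist1 y z)"
    using assms in_cube_dist1[of y z] unfolding hpaths_eq by (metis (lifting) mem_Collect_eq not_le)
  then obtain K where K: "?P K" "\<not> ?P (Suc K)"
  proof -
    have "\<exists>K. ?P K \<and> \<not> ?P (Suc K)"
    proof (rule ccontr)
      assume "\<not> ?thesis"
      then have "?P K" for K using P0 by (induction K) blast+
      with \<open>\<not> ?P (dist1 y z)\<close> show False by blast
    qed
    then show thesis using that by blast
  qed
  then obtain w where w: "w \<in> cube z (Suc K)" "loc x us w < m" by (auto simp: not_le)
  have "of_nat (loc x us z) \<le> ?S K"
    using psum_mem_le[OF w(1), of "\<lambda>w. if ?P K \<and> loc x us w < m then of_nat (loc x us z) else 0"] K(1) w(2)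
    by simp
  also have "\<dots> \<le> (\<Sum>K. ?S K)"
    using psum_mem_le[of K UNIV ?S] by (simp add: psum_nat)
  finally show ?thesis by (rule add_increasing[rotated]) simp
qed

text \<open>The length is the sum of all local times, to which the scale decomposition is applied.
  One volume factor counts the candidates for \<open>w\<close>, the other comes from
  \<open>psum_hits_cube\<close>.\<close>

lemma length_le_range:
  fixes x y :: "int ^ 'd::finite"
  assumes "0 < m"
    and T: "\<And>K z w. w \<in> cube z (Suc K) \<Longrightarrow>
      psum {us \<in> hpaths x y. (\<forall>v\<in>cube z K. m \<le> loc x us v) \<and> loc x us w < m} (\<lambda>us. of_nat (loc x us z) * wt x us)
      \<le> \<rho> K * psum {us \<in> hpaths x y. set (vis x us) \<inter> cube z K \<noteq> {}} (wt x)"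
  shows "psum (hpaths x y) (\<lambda>us. of_nat (length us) * wt x us) \<le>
    (of_nat m + (\<Sum>K. of_nat ((2 * Suc K + 1) ^ CARD('d)) * \<rho> K * of_nat ((2 * K + 1) ^ CARD('d)))) *
    psum (hpaths x y) (\<lambda>us. of_nat (card (set (vis x us))) * wt x us)" (is "?E \<le> (_ + ?S) * ?R")
proof -
  let ?H = "hpaths x y"
  let ?c = "\<lambda>z K us w. (\<forall>v\<in>cube z K. m \<le> loc x us v) \<and> loc x us w < m"
  let ?g = "\<lambda>z K us w. if ?c z K us w then of_nat (loc x us z) * wt x us else 0"
  have "?E = psum ?H (\<lambda>us. psum UNIV (\<lambda>z. of_nat (loc x us z) * wt x us))"
    by (simp add: psum_multc psum_loc)
  also have "\<dots> \<le> psum ?H (\<lambda>us. psum UNIV (\<lambda>z. (if z \<in> set (vis x us) then of_nat m * wt x us else 0) +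
      (\<Sum>K. psum (cube z (Suc K)) (?g z K us))))"
  proof (intro psum_mono)
    fix us z assume us: "us \<in> ?H"
    have "of_nat (loc x us z) * wt x us \<le> ((if z \<in> set (vis x us) then of_nat m else 0) +
      (\<Sum>K. psum (cube z (Suc K)) (\<lambda>w. if ?c z K us w then of_nat (loc x us z) else 0))) * wt x us"
      by (intro mult_right_mono loc_le_sum_cubees[OF us assms(1)]) simp
    also have "\<dots> = (if z \<in> set (vis x us) then of_nat m * wt x us else 0) +
      (\<Sum>K. psum (cube z (Suc K)) (\<lambda>w. (if ?c z K us w then of_nat (loc x us z) else 0) * wt x us))"
      by (simp add: distrib_right psum_multc)
    also have "(\<lambda>K. psum (cube z (Suc K)) (\<lambda>w. (if ?c z K us w then of_nat (loc x us z) else 0) * wt x us)) =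
       (\<lambda>K. psum (cube z (Suc K)) (?g z K us))"
      by (intro ext psum_cong) auto
    finally show "of_nat (loc x us z) * wt x us \<le> (if z \<in> set (vis x us) then of_nat m * wt x us else 0) +
      (\<Sum>K. psum (cube z (Suc K)) (?g z K us))" .
  qed
  also have "\<dots> = psum ?H (\<lambda>us. psum UNIV (\<lambda>z. if z \<in> set (vis x us) then of_nat m * wt x us else 0)) +
      psum UNIV (\<lambda>z. psum ?H (\<lambda>us. \<Sum>K. psum (cube z (Suc K)) (?g z K us)))"
    unfolding psum_add by (rule arg_cong2[where f = "(+)"]) (rule refl, rule psum_swap)
  also have "psum ?H (\<lambda>us. psum UNIV (\<lambda>z. if z \<in> set (vis x us) then of_nat m * wt x us else 0)) = of_nat m * ?R"
    by (subst psum_cmult[symmetric], rule psum_cong) (simp_all add: psum_eq_card mult_ac)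
  also have "psum UNIV (\<lambda>z. psum ?H (\<lambda>us. \<Sum>K. psum (cube z (Suc K)) (?g z K us))) =
      psum UNIV (\<lambda>z. \<Sum>K. psum (cube z (Suc K)) (\<lambda>w. psum ?H (\<lambda>us. ?g z K us w)))"
    unfolding psum_suminf by (subst psum_swap) simp
  also have "\<dots> \<le> psum UNIV (\<lambda>z. \<Sum>K. psum (cube z (Suc K)) (\<lambda>w.
      \<rho> K * psum {us \<in> ?H. set (vis x us) \<inter> cube z K \<noteq> {}} (wt x)))"
  proof (intro psum_mono suminf_le)
    fix z w :: "int ^ 'd" and K assume "w \<in> cube z (Suc K)"
    from T[OF this] show "psum ?H (\<lambda>us. ?g z K us w) \<le> \<rho> K * psum {us \<in> ?H. set (vis x us) \<inter> cube z K \<noteq> {}} (wt x)"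
      by (simp add: psum_restrict[of ?H "\<lambda>us. ?c z K us w"])
  qed auto
  also have "\<dots> = (\<Sum>K. of_nat ((2 * Suc K + 1) ^ CARD('d)) * \<rho> K *
      psum UNIV (\<lambda>z. psum {us \<in> ?H. set (vis x us) \<inter> cube z K \<noteq> {}} (wt x)))"
    unfolding psum_suminf by (simp only: psum_const finite_cube card_cube psum_cmult mult_ac)
  also have "\<dots> \<le> (\<Sum>K. of_nat ((2 * Suc K + 1) ^ CARD('d)) * \<rho> K * (of_nat ((2 * K + 1) ^ CARD('d)) * ?R))"
    by (intro suminf_le mult_left_mono psum_hits_cube) auto
  also have "\<dots> = ?S * ?R"
    by (simp only: mult.assoc[symmetric] ennreal_suminf_multc)
  finally show ?thesis by (simp add: distrib_right add_left_mono)
qed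

end

section \<open>Nearest-neighbour paths on the integers\<close>

lemma vis_map:
  assumes "\<And>x u. g (x + u) = g x + h u"
  shows "vis (g x) (map h us) = map g (vis x us)"
proof (induction us arbitrary: x)
  case (Cons u us)
  show ?case using Cons[of "x + u"] by (simp add: assms)
qed simp

text \<open>For a start \<open>k\<close> in \<open>{0..<n}\<close>: the walk leaves this interval at
  \<open>n\<close> rather than at \<open>-1\<close>.\<close>

definition ipaths :: "int \<Rightarrow> int \<Rightarrow> int list set" where
  "ipaths n k = {us \<in> lists {1, -1}. k + sum_list us = n \<and> set (vis k us) \<subseteq> {0..<n}}"

definition half :: "int list \<Rightarrow> ennreal" where
  "half us = ennreal ((1 / 2) ^ length us)"

lemma half_Nil [simp]: "half [] = 1"
  by (simp add: half_def)

lemma half_append: "half (us @ vs) = half us * half vs"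
  by (simp add: half_def power_add ennreal_mult)

lemma half_Cons: "half (u # us) = ennreal (1 / 2) * half us"
  unfolding half_def by (subst ennreal_mult[symmetric]) simp_all

lemma unit_steps_card_1:
  fixes e :: "int ^ 'd::finite"
  assumes "CARD('d) = 1" "e \<in> unit_steps"
  shows "unit_steps = {e, -e}" "e \<noteq> 0" "card (unit_steps :: (int ^ 'd) set) = 2"
proof -
  obtain i :: 'd where i: "UNIV = {i}" using assms(1) by (auto simp: card_1_singleton_iff)
  have n: "- axis i (1 :: int) = axis i (-1)" by (simp add: vec_eq_iff axis_def)
  have U: "unit_steps = {axis i 1, axis i (-1)}" by (simp add: unit_steps_def i)
  then show 1: "unit_steps = {e, -e}" using assms(2) unfolding U n[symmetric] by auto
  show "e \<noteq> 0" using assms(2) zero_notin_unit_steps by metis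
  then obtain j where "e $ j \<noteq> 0" by (auto simp: vec_eq_iff)
  then have "e $ j \<noteq> (- e) $ j" by simp
  then have "e \<noteq> - e" using arg_cong[of e "- e" "\<lambda>v. v $ j"] by blast
  then show "card (unit_steps :: (int ^ 'd) set) = 2" unfolding 1 by simp
qed

text \<open>Places the integer line into the lattice along the step \<open>e\<close>. In dimension
  one \<open>e\<close> and its negative are all the steps, and the choice of \<open>e\<close>
  decides the direction of a crossing.\<close>

definition emb :: "int ^ 'd::finite \<Rightarrow> int list \<Rightarrow> (int ^ 'd) list" where
  "emb e us = map (\<lambda>k. k *s e) us"

lemma vis_emb: "vis (x + k *s e) (emb e us) = map (\<lambda>j. x + j *s e) (vis k us)"
  unfolding emb_def by (rule vis_map) (simp add: vector_sadd_rdistrib add.assoc)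

lemma sum_list_emb: "sum_list (emb e us) = sum_list us *s e"
  by (induction us) (auto simp: emb_def vector_sadd_rdistrib)

lemma inj_smult: "(e :: int ^ 'd::finite) \<noteq> 0 \<Longrightarrow> inj (\<lambda>k. x + k *s e)"
  by (auto simp: inj_def vec_eq_iff)

lemma inj_emb: "(e :: int ^ 'd::finite) \<noteq> 0 \<Longrightarrow> inj (emb e)"
  unfolding emb_def using inj_smult[of e 0] by (simp add: inj_mapI)

lemma neg_one_smult: "(-1) *s e = - (e :: int ^ 'd::finite)"
  by (simp add: vec_eq_iff)

lemma emb_lists:
  fixes e :: "int ^ 'd::finite"
  assumes "CARD('d) = 1" "e \<in> unit_steps" "us \<in> lists {1, -1}"
  shows "emb e us \<in> lists unit_steps" "srw_prob (emb e us) = half us"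
proof -
  show "emb e us \<in> lists unit_steps"
  proof -
    have "k *s e \<in> unit_steps" if "k \<in> {1, -1}" for k
      using that unfolding unit_steps_card_1(1)[OF assms(1,2)] by (auto simp: neg_one_smult)
    then show ?thesis using assms(3) by (simp add: emb_def in_lists_conv_set)
  qed
  show "srw_prob (emb e us) = half us"
    by (simp add: srw_prob_def half_def emb_def unit_steps_card_1(3)[OF assms(1,2)] inverse_eq_divide)
qed

lemma emb_ipaths:
  fixes e :: "int ^ 'd::finite"
  assumes "CARD('d) = 1" "e \<in> unit_steps" "us \<in> ipaths n k"
  shows "emb e us \<in> hpaths (x + k *s e) (x + n *s e)"
    "set (vis (x + k *s e) (emb e us)) \<subseteq> (\<lambda>j. x + j *s e) ` {0..<n}"
proof -
  have us: "us \<in> lists {1, -1}" "k + sum_list us = n" "set (vis k us) \<subseteq> {0..<n}"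
    using assms(3) by (auto simp: ipaths_def)
  show v: "set (vis (x + k *s e) (emb e us)) \<subseteq> (\<lambda>j. x + j *s e) ` {0..<n}"
    unfolding vis_emb using us(3) by auto
  have "x + n *s e \<notin> (\<lambda>j. x + j *s e) ` {0..<n}"
    using inj_smult[OF unit_steps_card_1(2)[OF assms(1,2)], of x] by (auto dest: injD)
  with v show "emb e us \<in> hpaths (x + k *s e) (x + n *s e)"
    using us(2) emb_lists(1)[OF assms(1,2) us(1)]
    by (auto simp: hpaths_def paths_def sum_list_emb vector_sadd_rdistrib add.assoc)
qed

text \<open>Crossings of an integer interval are hitting paths of the walk on
  \<open>int ^ 1\<close>, so the bound for \<open>hpaths\<close> carries over.\<close>

lemma psum_ipaths_le_1: "psum (ipaths n k) half \<le> 1"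
proof -
  define e :: "int ^ 1" where "e = axis 1 1"
  have e: "e \<in> unit_steps" by (simp add: e_def)
  have c: "CARD(1) = 1" by simp
  have "psum (ipaths n k) half \<le> psum (hpaths (0 + k *s e) (0 + n *s e)) srw_prob"
  proof (rule psum_inj_le[of "emb e"])
    show "inj_on (emb e) (ipaths n k)"
      using inj_emb[OF unit_steps_card_1(2)[OF c e]] by (rule inj_on_subset) simp
    show "emb e ` ipaths n k \<subseteq> hpaths (0 + k *s e) (0 + n *s e)"
      using emb_ipaths(1)[OF c e] by blast
  qed (use emb_lists(2)[OF c e] in \<open>auto simp: ipaths_def\<close>)
  also have "\<dots> \<le> 1" by (rule psum_hpaths_le_1)
  finally show ?thesis .
qed

lemma Cons_ipaths:
  assumes "0 \<le> k" "k < n"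
  shows "u # us \<in> ipaths n k \<longleftrightarrow> (u = 1 \<or> u = -1) \<and> us \<in> ipaths n (k + u)"
  using assms by (simp add: ipaths_def add.assoc conj_ac)

lemma ipaths_step:
  assumes "0 \<le> k" "k < n"
  shows "psum (ipaths n k) half = ennreal (1/2) * psum (ipaths n (k + 1)) half + ennreal (1/2) * psum (ipaths n (k - 1)) half"
proof -
  have eq: "ipaths n k = (#) 1 ` ipaths n (k + 1) \<union> (#) (-1) ` ipaths n (k - 1)"
  proof (intro equalityI subsetI)
    fix us assume us: "us \<in> ipaths n k"
    then obtain u us' where e: "us = u # us'" using assms by (cases us) (auto simp: ipaths_def)
    have "u = 1 \<or> u = -1" "us' \<in> ipaths n (k + u)" using us assms by (simp_all add: Cons_ipaths e)
    then show "us \<in> (#) 1 ` ipaths n (k + 1) \<union> (#) (-1) ` ipaths n (k - 1)"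
      unfolding e by (elim disjE) auto
  qed (use assms in \<open>auto simp: Cons_ipaths\<close>)
  have "psum (ipaths n k) half = psum ((#) 1 ` ipaths n (k + 1)) half + psum ((#) (-1) ` ipaths n (k - 1)) half"
    unfolding eq by (rule psum_Un_disjoint) auto
  also have "\<dots> = psum (ipaths n (k + 1)) (\<lambda>us. half (1 # us)) + psum (ipaths n (k - 1)) (\<lambda>us. half (-1 # us))"
    by (subst (1 2) psum_reindex) (auto intro!: inj_onI)
  also have "\<dots> = ennreal (1/2) * psum (ipaths n (k + 1)) half + ennreal (1/2) * psum (ipaths n (k - 1)) half"
    by (simp only: half_Cons psum_cmult)
  finally show ?thesis .
qed

text \<open>Gambler's ruin: the exit probability is harmonic, hence linear, in the starting point.\<close>

lemma psum_ipaths_0: "psum (ipaths (int n) 0) half = ennreal (1 / real (n + 1))"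
proof -
  define h where "h k = enn2real (psum (ipaths (int n) k) half)" for k
  have fin: "psum (ipaths (int n) k) half < \<top>" for k
    using psum_ipaths_le_1[of "int n" k] by (rule order.strict_trans1) simp
  then have hp: "psum (ipaths (int n) k) half = ennreal (h k)" for k
    by (simp add: h_def)
  have h0: "0 \<le> h k" for k by (simp add: h_def)
  have step: "2 * h k = h (k + 1) + h (k - 1)" if "0 \<le> k" "k < int n" for k
  proof -
    have m: "ennreal (1/2 * h j) = ennreal (1/2) * ennreal (h j)" for j
      using h0 by (intro ennreal_mult) auto
    have "ennreal (h k) = ennreal (1/2) * ennreal (h (k + 1)) + ennreal (1/2) * ennreal (h (k - 1))"
      using ipaths_step[OF that] unfolding hp .
    also have "\<dots> = ennreal (1/2 * h (k + 1)) + ennreal (1/2 * h (k - 1))"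
      by (simp only: m)
    also have "\<dots> = ennreal (1/2 * h (k + 1) + 1/2 * h (k - 1))"
      using h0 by (intro ennreal_plus[symmetric]) auto
    finally have "ennreal (h k) = ennreal (1/2 * h (k + 1) + 1/2 * h (k - 1))" .
    then have "h k = 1/2 * h (k + 1) + 1/2 * h (k - 1)"
      using h0 by (subst (asm) ennreal_inj) auto
    then show ?thesis by simp
  qed
  have "ipaths (int n) (-1) = {}"
  proof -
    have "us \<notin> ipaths (int n) (-1)" for us by (cases us) (auto simp: ipaths_def)
    then show ?thesis by blast
  qed
  then have hm: "h (-1) = 0" by (simp add: h_def)
  have "ipaths (int n) (int n) = {[]}"
  proof -
    have "us \<in> ipaths (int n) (int n) \<longleftrightarrow> us = []" for us by (cases us) (auto simp: ipaths_def)
    then show ?thesis by blast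
  qed
  then have hn: "h (int n) = 1" by (simp add: h_def)
  have lin: "k \<le> n \<Longrightarrow> h (int k) = real (k + 1) * h 0 \<and> h (int k - 1) = real k * h 0" for k
  proof (induction k)
    case (Suc k)
    then have "2 * h (int k) = h (int k + 1) + h (int k - 1)" by (intro step) auto
    with Suc show ?case by (auto simp: algebra_simps)
  qed (simp add: hm)
  from lin[of n] hn have "real (n + 1) * h 0 = 1" by simp
  then have "h 0 = 1 / real (n + 1)" by (simp add: field_simps)
  then show ?thesis using hp[of 0] by simp
qed

text \<open>A step from \<open>v\<close> towards \<open>w\<close> has probability 1/2, and from
  there \<open>w\<close> is reached before \<open>v\<close> by gambler's ruin. The
  \<open>+ 1\<close> keeps the bound decreasing in the distance down to 0, where a division by zero
  would give the value 0.\<close>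

lemma escape_prob_card_1:
  fixes v w :: "int ^ 'd::finite"
  assumes "CARD('d) = 1"
  shows "ennreal (1 / (2 * real (dist1 v w + 1))) \<le> escape_prob v w"
proof (cases "v = w")
  case True
  have "escape_prob v w \<ge> srw_prob ([] :: (int ^ 'd) list)"
    unfolding escape_prob_def by (rule psum_mem_le[of "[]"]) (simp add: True hpaths_def)
  moreover have "ennreal (1 / (2 * real (dist1 v w + 1))) \<le> ennreal 1"
    by (rule ennreal_leI) (simp add: divide_simps)
  ultimately show ?thesis by (metis ennreal_1 order_trans srw_prob_Nil)
next
  case False
  obtain i :: 'd where i: "UNIV = {i}" using assms by (auto simp: card_1_singleton_iff)
  define e where "e = (axis i (if v $ i < w $ i then 1 else - 1) :: int ^ 'd)"
  define n where "n = dist1 v w"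
  have e: "e \<in> unit_steps" by (simp add: e_def)
  have n: "n = nat \<bar>v $ i - w $ i\<bar>" by (simp add: n_def dist1_def i)
  have w: "w = v + int n *s e"
    using i by (auto simp: vec_eq_iff e_def axis_def n)
  have n0: "0 < n" using False by (simp add: n_def dist1_eq_0_iff neq0_conv[symmetric])
  \<comment> \<open>With \<open>v + e\<close> as origin, \<open>w\<close> sits at
    \<open>n - 1\<close> and \<open>v\<close> at \<open>-1\<close>, so the crossings of
    \<open>n - 1\<close> sites are those that reach \<open>w\<close> before
    \<open>v\<close>.\<close>
  have "ennreal (1 / (2 * real n)) = ennreal (1/2) * psum (ipaths (int (n - 1)) 0) half"
  proof -
    have "psum (ipaths (int (n - 1)) 0) half = ennreal (1 / real n)"
      using psum_ipaths_0[of "n - 1"] n0 by simp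
    then show ?thesis by (simp only:) (subst ennreal_mult[symmetric], simp_all)
  qed
  also have "\<dots> = psum (ipaths (int (n - 1)) 0) (\<lambda>us. ennreal (1/2) * half us)"
    by (simp add: psum_cmult)
  also have "\<dots> \<le> escape_prob v w"
    unfolding escape_prob_def
  proof (rule psum_inj_le[of "\<lambda>us. e # emb e us"])
    show "inj_on (\<lambda>us. e # emb e us) (ipaths (int (n - 1)) 0)"
      using inj_emb[OF unit_steps_card_1(2)[OF assms e]] by (auto simp: inj_on_def)
    have s: "v + e + 0 *s e = v + e" "v + e + int (n - 1) *s e = w"
      using n0 by (simp_all add: w vec_eq_iff algebra_simps of_nat_diff)
    have ne: "v \<notin> (\<lambda>j. v + e + j *s e) ` {0..<int (n - 1)}" "v \<noteq> w"
    proof -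
      have "v + 0 *s e \<noteq> v + (j + 1) *s e" if "0 \<le> j" for j
      proof
        assume "v + 0 *s e = v + (j + 1) *s e"
        then have "0 = j + 1" by (rule injD[OF inj_smult[OF unit_steps_card_1(2)[OF assms e], of v]])
        with that show False by simp
      qed
      moreover have "v + 0 *s e = v" "v + (j + 1) *s e = v + e + j *s e" for j
        by (simp_all add: vec_eq_iff algebra_simps)
      ultimately have "v \<noteq> v + e + j *s e" if "0 \<le> j" for j using that by metis
      then show "v \<notin> (\<lambda>j. v + e + j *s e) ` {0..<int (n - 1)}"
        by auto
      show "v \<noteq> w" by (rule False)
    qed
    show "(\<lambda>us. e # emb e us) ` ipaths (int (n - 1)) 0 \<subseteq> {r \<in> hpaths v w. v \<notin> set (tl (vis v r))}"
    proof (rule image_subsetI)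
      fix us assume us: "us \<in> ipaths (int (n - 1)) 0"
      note emb_ipaths[OF assms e us, of "v + e", unfolded s]
      then show "e # emb e us \<in> {r \<in> hpaths v w. v \<notin> set (tl (vis v r))}"
        using e ne by (auto simp: hpaths_def)
    qed
    fix us assume "us \<in> ipaths (int (n - 1)) 0"
    then have "us \<in> lists {1, -1}" by (simp add: ipaths_def)
    then show "ennreal (1/2) * half us \<le> srw_prob (e # emb e us)"
      using emb_lists(2)[OF assms e, of us] srw_prob_Cons[of e "emb e us"]
      by (simp add: srw_prob_def[of "[e]"] unit_steps_card_1(3)[OF assms e] inverse_eq_divide)
  qed
  finally have "ennreal (1 / (2 * real n)) \<le> escape_prob v w" .
  moreover have "ennreal (1 / (2 * real (n + 1))) \<le> ennreal (1 / (2 * real n))"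
    using n0 by (intro ennreal_leI divide_left_mono) auto
  ultimately show ?thesis unfolding n_def by (rule order_trans[rotated])
qed

section \<open>Cut points of crossings\<close>

lemma avoid_below:
  assumes "set us \<subseteq> {1, -1}" "(x::int) < j" "j \<notin> set (vis x us)"
  shows "set (vis x us) \<subseteq> {..<j} \<and> x + sum_list us \<le> j"
  using assms
proof (induction us arbitrary: x)
  case (Cons u us)
  show ?case
  proof (cases us)
    case Nil
    with Cons show ?thesis by auto
  next
    case (Cons u' us')
    then have "x + u \<noteq> j" using Cons.prems by auto
    moreover have "u = 1 \<or> u = -1" using Cons.prems(1) by simp
    ultimately have "x + u < j" using Cons.prems(2) by linarith
    from Cons.IH[OF _ this] Cons.prems show ?thesis by auto
  qed
qed simp

lemma avoid_above:
  assumes "set us \<subseteq> {1, -1}" "j < (x::int)" "j \<notin> set (vis x us)"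
  shows "set (vis x us) \<subseteq> {j<..}"
  using assms
proof (induction us arbitrary: x)
  case (Cons u us)
  show ?case
  proof (cases us)
    case Nil
    with Cons show ?thesis by auto
  next
    case (Cons u' us')
    then have "x + u \<noteq> j" using Cons.prems by auto
    moreover have "u = 1 \<or> u = -1" using Cons.prems(1) by simp
    ultimately have "j < x + u" using Cons.prems(2) by linarith
    from Cons.IH[OF _ this] Cons.prems show ?thesis by auto
  qed
qed simp

text \<open>A crossing visits every site of its interval, so this says that each of them is visited
  at least twice.\<close>

definition nocut :: "nat \<Rightarrow> int list set" where
  "nocut n = {us \<in> ipaths (int n) 0. \<forall>j\<in>{0..<int n}. loc 0 us j \<noteq> 1}"

lemma vis_shift: "vis (t + x) us = map ((+) t) (vis x us)" for t :: int
  using vis_map[of "(+) t" id x us] by (simp add: add.assoc)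

text \<open>Renewal at the leftmost site \<open>k\<close> visited exactly once. A nearest-neighbour
  path passes such a site once and for all: it stays below before and above afterwards. The first
  piece has no cut site by minimality of \<open>k\<close>, and the last one, shifted by
  \<open>k + 1\<close>, crosses the remaining \<open>n - 1 - k\<close> sites.\<close>

lemma ipaths_split:
  assumes "us \<in> ipaths (int n) 0" "us \<notin> nocut n"
  shows "\<exists>k<n. \<exists>a\<in>nocut k. \<exists>c\<in>ipaths (int (n - 1 - k)) 0. us = a @ 1 # c"
proof -
  have us: "us \<in> lists {1, -1}" "sum_list us = int n" "set (vis 0 us) \<subseteq> {0..<int n}"
    using assms(1) by (auto simp: ipaths_def)
  define k where "k = (LEAST k. k < n \<and> loc 0 us (int k) = 1)"
  from assms obtain j where j: "0 \<le> j" "j < int n" "loc 0 us j = 1" by (auto simp: nocut_def)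
  then have "nat j < n \<and> loc 0 us (int (nat j)) = 1" by auto
  then have k: "k < n" "loc 0 us (int k) = 1"
    unfolding k_def by (metis (mono_tags, lifting) LeastI)+
  have kl: "loc 0 us (int i) \<noteq> 1" if "i < k" for i
    using that k(1) not_less_Least[of i "\<lambda>k. k < n \<and> loc 0 us (int k) = 1"] unfolding k_def[symmetric] by auto
  have "int k \<in> set (vis 0 us)" using k(2) by (metis count_list_0_iff zero_neq_one)
  then obtain l where l: "l < length us" "vis 0 us ! l = int k" by (auto simp: in_set_conv_nth)
  define a u c where "a = take l us" and "u = us ! l" and "c = drop (Suc l) us"
  have d: "us = a @ u # c" unfolding a_def u_def c_def using l(1) by (rule id_take_nth_drop)
  have sa: "sum_list a = int k" using l by (simp add: nth_vis a_def)
  have v: "vis 0 us = vis 0 a @ int k # vis (int k + u) c" by (simp add: d vis_append sa)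
  have na: "int k \<notin> set (vis 0 a)" and nc: "int k \<notin> set (vis (int k + u) c)"
    using k(2) by (auto simp: v count_list_append count_list_0_iff)
  have la: "set a \<subseteq> {1, -1}" and lc: "set c \<subseteq> {1, -1}" and lu: "u = 1 \<or> u = -1"
    using us(1) by (auto simp: d lists_eq_set)
  have va: "set (vis 0 a) \<subseteq> {0..<int k}"
  proof (cases "k = 0")
    case True
    then have "a = []" using na by (cases a) auto
    then show ?thesis by simp
  next
    case False
    then have "set (vis 0 a) \<subseteq> {..<int k}" using avoid_below[OF la _ na] by simp
    moreover have "set (vis 0 a) \<subseteq> {0..<int n}" using us(3) by (simp add: v)
    ultimately show ?thesis by (force simp: subset_eq)
  qed
  have u1: "u = 1"
  proof (rule ccontr)
    \<comment> \<open>A step down would trap the rest of the path at or below \<open>k\<close>,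
      short of its endpoint \<open>n\<close>.\<close>
    assume "u \<noteq> 1"
    with lu have "u = -1" by simp
    then have "int k + u + sum_list c \<le> int k" using avoid_below[OF lc _ nc] by simp
    then show False using us(2) k(1) by (simp add: d sa)
  qed
  have vc: "set (vis (int k + 1) c) \<subseteq> {int k<..}" using avoid_above[OF lc _ nc] u1 by simp
  have "vis (int k + 1) c = map ((+) (int k + 1)) (vis 0 c)" using vis_shift[of "int k + 1" 0 c] by simp
  then have "set (vis 0 c) = (\<lambda>x. x - (int k + 1)) ` set (vis (int k + 1) c)"
    by (auto simp: image_image)
  then have "set (vis 0 c) \<subseteq> {0..<int (n - 1 - k)}"
  proof -
    have "set (vis (int k + 1) c) \<subseteq> {0..<int n}" using us(3) u1 by (simp add: v)
    with vc have "set (vis (int k + 1) c) \<subseteq> {int k + 1..<int n}" by force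
    then have "(\<lambda>x. x - (int k + 1)) ` set (vis (int k + 1) c) \<subseteq> {0..<int (n - 1 - k)}"
      using k(1) by (force simp: of_nat_diff)
    then show ?thesis using \<open>set (vis 0 c) = _\<close> by simp
  qed
  then have c: "c \<in> ipaths (int (n - 1 - k)) 0"
    using lc us(2) k(1) by (auto simp: ipaths_def d sa u1 of_nat_diff lists_eq_set)
  have "a \<in> nocut k"
    unfolding nocut_def
  proof (intro CollectI conjI ballI)
    show "a \<in> ipaths (int k) 0" using la sa va by (simp add: ipaths_def lists_eq_set)
    fix i assume i: "i \<in> {0..<int k}"
    then have "i \<notin> set (vis (int k + u) c)" "i \<noteq> int k" using vc u1 by auto
    then have "loc 0 us i = loc 0 a i" by (simp add: v count_list_append)
    moreover have "loc 0 us i \<noteq> 1" using kl[of "nat i"] i by (auto simp: nat_less_iff)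
    ultimately show "loc 0 a i \<noteq> 1" by simp
  qed
  with k(1) c d u1 show ?thesis by blast
qed

definition cut_join :: "nat \<Rightarrow> (nat \<times> int list \<times> int list) set" where
  "cut_join n = (SIGMA k:{..<n}. nocut k \<times> ipaths (int (n - 1 - k)) 0)"

lemma vis_cut_join:
  assumes "a \<in> ipaths (int k) 0"
  shows "vis 0 (a @ 1 # c) = vis 0 a @ int k # map ((+) (int k + 1)) (vis 0 c)"
  using assms vis_shift[of "int k + 1" 0 c] by (simp add: vis_append ipaths_def)

text \<open>Together these identify \<open>k\<close> as the leftmost site of local time one, so the
  joined path determines where it was joined.\<close>

lemma loc_cut_join:
  assumes "a \<in> nocut k" "c \<in> ipaths m 0"
  shows "loc 0 (a @ 1 # c) (int k) = 1" "i < k \<Longrightarrow> loc 0 (a @ 1 # c) (int i) \<noteq> 1"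
proof -
  have a: "a \<in> ipaths (int k) 0" using assms(1) by (simp add: nocut_def)
  have va: "set (vis 0 a) \<subseteq> {0..<int k}" and vc: "set (vis 0 c) \<subseteq> {0..}"
    using a assms(2) by (auto simp: ipaths_def)
  have "int k \<notin> set (vis 0 a)" "int k \<notin> (+) (int k + 1) ` set (vis 0 c)" using va vc by auto
  then show "loc 0 (a @ 1 # c) (int k) = 1"
    by (simp add: vis_cut_join[OF a] count_list_append)
  assume i: "i < k"
  have "int i \<notin> (+) (int k + 1) ` set (vis 0 c)" using vc i by auto
  then have "loc 0 (a @ 1 # c) (int i) = loc 0 a (int i)"
    using i by (simp add: vis_cut_join[OF a] count_list_append)
  then show "loc 0 (a @ 1 # c) (int i) \<noteq> 1" using assms(1) i by (simp add: nocut_def)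
qed

lemma inj_cut_join: "inj_on (\<lambda>(k, a, c). a @ 1 # c) (cut_join n)"
proof -
  have "k = k' \<and> a = a' \<and> c = c'"
    if h: "a \<in> nocut k" "c \<in> ipaths m 0" "a' \<in> nocut k'" "c' \<in> ipaths m' 0" "a @ 1 # c = a' @ 1 # c'"
    for k a c k' a' c' m m'
  proof -
    have k: "k = k'"
      using loc_cut_join[OF h(1,2)] loc_cut_join[OF h(3,4)] h(5) by (metis linorder_neqE_nat)
    have *: "length a = length (takeWhile (\<lambda>v. v \<noteq> int k) (vis 0 (a @ 1 # c)))"
      if "a \<in> nocut k" for a c
    proof -
      have a: "a \<in> ipaths (int k) 0" using that by (simp add: nocut_def)
      then have "\<forall>v\<in>set (vis 0 a). v \<noteq> int k" by (auto simp: ipaths_def)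
      then show ?thesis by (simp add: vis_cut_join[OF a] takeWhile_append2)
    qed
    have "length a = length a'" using *[OF h(1), of c] *[of a' c'] h(3,5) k by simp
    with h(5) k show ?thesis by simp
  qed
  then show ?thesis unfolding inj_on_def cut_join_def by fast
qed

lemma cut_join_ipaths:
  assumes "a \<in> nocut k" "c \<in> ipaths (int (n - 1 - k)) 0" "k < n"
  shows "a @ 1 # c \<in> ipaths (int n) 0"
proof -
  have a: "a \<in> ipaths (int k) 0" using assms(1) by (simp add: nocut_def)
  then show ?thesis
    using assms(2,3) vis_cut_join[OF a, of c] by (auto simp: ipaths_def of_nat_diff)
qed

section \<open>Exponential growth of crossing weights in dimension one\<close>

definition exit_sum :: "nat \<Rightarrow> ennreal" where
  "exit_sum n = psum (ipaths (int n) 0) half"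

definition nocut_sum :: "nat \<Rightarrow> ennreal" where
  "nocut_sum n = psum (nocut n) half"

lemma psum_cut_join:
  "psum (cut_join n) (\<lambda>(k, a, c). A k * f a * g c) =
    (\<Sum>k<n. A k * psum (nocut k) f * psum (ipaths (int (n - 1 - k)) 0) g)"
  by (simp add: cut_join_def psum_Sigma psum_finite psum_cmult psum_multc)

text \<open>Renewal inequality: a crossing has no cut site, or it splits at the leftmost one. The
  factor 1/2 pays for the step out of the cut site.\<close>

lemma exit_sum_le:
  "exit_sum n \<le> nocut_sum n + (\<Sum>k<n. ennreal (1/2) * nocut_sum k * exit_sum (n - 1 - k))"
proof -
  let ?j = "\<lambda>(k, a, c). a @ 1 # c"
  have sub: "ipaths (int n) 0 \<subseteq> nocut n \<union> ?j ` cut_join n"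
  proof
    fix us assume us: "us \<in> ipaths (int n) 0"
    show "us \<in> nocut n \<union> ?j ` cut_join n"
    proof (cases "us \<in> nocut n")
      case False
      then obtain k a c where "k < n" "a \<in> nocut k" "c \<in> ipaths (int (n - 1 - k)) 0" "us = a @ 1 # c"
        using ipaths_split[OF us] by blast
      then have "(k, a, c) \<in> cut_join n" "us = ?j (k, a, c)" by (auto simp: cut_join_def)
      then show ?thesis by blast
    qed simp
  qed
  have "exit_sum n \<le> psum (nocut n \<union> (?j ` cut_join n - nocut n)) half"
    unfolding exit_sum_def by (rule psum_subset) (use sub in blast)
  also have "\<dots> = nocut_sum n + psum (?j ` cut_join n - nocut n) half"
    unfolding nocut_sum_def by (rule psum_Un_disjoint) blast
  also have "psum (?j ` cut_join n - nocut n) half \<le> psum (?j ` cut_join n) half"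
    by (rule psum_subset) blast
  also have "\<dots> = psum (cut_join n) (\<lambda>(k, a, c). ennreal (1/2) * half a * half c)"
    unfolding psum_reindex[OF inj_cut_join]
    by (intro psum_cong refl) (auto simp: half_append half_Cons mult_ac)
  also have "\<dots> = (\<Sum>k<n. ennreal (1/2) * nocut_sum k * exit_sum (n - 1 - k))"
    by (simp only: psum_cut_join nocut_sum_def exit_sum_def)
  finally show ?thesis by (simp add: add_left_mono)
qed

text \<open>Generating functions turn the renewal convolution into a product. The extra factor
  \<open>ennreal s\<close> stands for the cut site itself, since
  \<open>n = k + 1 + j\<close>.\<close>

lemma psum_convolution:
  assumes "0 \<le> s"
  shows "psum UNIV (\<lambda>n. ennreal (s ^ n) * (\<Sum>k<n. A k * B (n - 1 - k))) =
    ennreal s * psum UNIV (\<lambda>k. ennreal (s ^ k) * A k) * psum UNIV (\<lambda>j. ennreal (s ^ j) * B j)"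
proof -
  let ?F = "\<lambda>(n, k). ennreal (s ^ n) * (A k * B (n - 1 - k))"
  have "psum UNIV (\<lambda>n. ennreal (s ^ n) * (\<Sum>k<n. A k * B (n - 1 - k))) = psum (SIGMA n:UNIV. {..<n}) ?F"
    by (simp add: psum_Sigma psum_finite sum_distrib_left)
  also have "(SIGMA n:UNIV. {..<n}) = (\<lambda>(k, j). (k + 1 + j, k)) ` (UNIV \<times> UNIV :: (nat \<times> nat) set)"
  proof (intro equalityI subsetI)
    fix p :: "nat \<times> nat" assume "p \<in> (SIGMA n:UNIV. {..<n})"
    then have "p = (\<lambda>(k, j). (k + 1 + j, k)) (snd p, fst p - 1 - snd p)" by auto
    then show "p \<in> (\<lambda>(k, j). (k + 1 + j, k)) ` (UNIV \<times> UNIV :: (nat \<times> nat) set)" by blast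
  qed auto
  also have "psum \<dots> ?F = psum (UNIV \<times> UNIV) (\<lambda>p. ?F ((\<lambda>(k, j). (k + 1 + j, k)) p))"
    by (rule psum_reindex) (auto intro!: inj_onI)
  also have "\<dots> = psum UNIV (\<lambda>k. psum UNIV (\<lambda>j. ennreal (s ^ (k + 1 + j)) * (A k * B j)))"
    by (subst psum_Sigma) simp
  also have "\<dots> = psum UNIV (\<lambda>k. psum UNIV (\<lambda>j. (ennreal s * (ennreal (s ^ k) * A k)) * (ennreal (s ^ j) * B j)))"
    using assms by (intro psum_cong refl) (simp add: power_add ennreal_mult mult_ac)
  also have "\<dots> = ennreal s * psum UNIV (\<lambda>k. ennreal (s ^ k) * A k) * psum UNIV (\<lambda>j. ennreal (s ^ j) * B j)"
    by (simp only: psum_cmult psum_multc)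
  finally show ?thesis .
qed

lemma psum_geometric:
  assumes "0 \<le> s" "s < 1" shows "psum UNIV (\<lambda>n. ennreal (s ^ n)) = ennreal (1 / (1 - s))"
  unfolding psum_nat using assms by (intro suminf_ennreal_eq geometric_sums) auto

lemma nocut_sum_0: "nocut_sum 0 = 1"
proof -
  have "us \<in> nocut 0 \<longleftrightarrow> us = []" for us
    by (cases us) (auto simp: nocut_def ipaths_def)
  then have "nocut 0 = {[]}" by blast
  then show ?thesis by (simp add: nocut_sum_def)
qed

context site_weights
begin

lemma Phi_le_1: "Phi x us \<le> 1"
proof -
  have "Phi x us \<le> (\<Prod>z\<in>set (vis x us). 1)"
    unfolding Phi_def by (intro prod_mono_ennreal phi_le_1)
  then show ?thesis by simp
qed

lemma Phi_image:
  assumes "inj g" "vis x' vs = map g (vis x us)"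
  shows "Phi x' vs = Phi x us"
proof -
  have "Phi x' vs = (\<Prod>z\<in>g ` set (vis x us). \<phi> (count_list (map g (vis x us)) z))"
    by (simp add: Phi_def assms(2))
  also have "\<dots> = (\<Prod>z\<in>set (vis x us). \<phi> (count_list (map g (vis x us)) (g z)))"
    using assms(1) by (subst prod.reindex) (auto intro: inj_on_subset)
  finally show ?thesis by (simp add: Phi_def count_list_map_conv[OF assms(1)])
qed

definition cross :: "nat \<Rightarrow> ennreal" where
  "cross n = psum (ipaths (int n) 0) (\<lambda>us. half us * Phi 0 us)"

lemma cross_le_1: "cross n \<le> 1"
proof -
  have "cross n \<le> psum (ipaths (int n) 0) half"
    unfolding cross_def using mult_left_mono[OF Phi_le_1] by (intro psum_mono) fastforce
  then show ?thesis using psum_ipaths_le_1 order_trans by blast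
qed

lemma cross_0: "cross 0 = 1"
proof -
  have "us \<in> ipaths 0 0 \<longleftrightarrow> us = []" for us by (cases us) (auto simp: ipaths_def)
  then have "ipaths 0 0 = {[]}" by blast
  then show ?thesis by (simp add: cross_def Phi_def)
qed

text \<open>Renewal inequality in the opposite direction. The \<open>k\<close> sites left of the cut
  get the crude bound \<open>p\<close> each, the cut site pays exactly \<open>\<phi> 1\<close>, and
  the rest is a fresh crossing on sites of its own.\<close>

lemma cross_ge:
  assumes p: "\<And>l. ennreal p \<le> \<phi> l" "0 \<le> p"
  shows "(\<Sum>k<n. ennreal (1/2) * \<phi> 1 * (ennreal (p ^ k) * nocut_sum k) * cross (n - 1 - k)) \<le> cross n"
proof -
  have "(\<Sum>k<n. ennreal (1/2) * \<phi> 1 * (ennreal (p ^ k) * nocut_sum k) * cross (n - 1 - k)) =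
      psum (cut_join n) (\<lambda>(k, a, c). (ennreal (1/2) * \<phi> 1 * ennreal (p ^ k)) * half a * (half c * Phi 0 c))"
    unfolding psum_cut_join nocut_sum_def cross_def by (simp only: mult_ac)
  also have "\<dots> \<le> cross n"
    unfolding cross_def
  proof (rule psum_inj_le[OF inj_cut_join])
    show "(\<lambda>(k, a, c). a @ 1 # c) ` cut_join n \<subseteq> ipaths (int n) 0"
      by (rule image_subsetI) (auto simp: cut_join_def intro!: cut_join_ipaths)
    fix t assume "t \<in> cut_join n"
    then obtain k a c where t: "t = (k, a, c)" "a \<in> nocut k" "c \<in> ipaths (int (n - 1 - k)) 0"
      by (auto simp: cut_join_def)
    have a: "a \<in> ipaths (int k) 0" using t(2) by (simp add: nocut_def)
    let ?T = "(+) (int k + 1) ` set (vis 0 c)"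
    have va: "set (vis 0 a) \<subseteq> {0..<int k}" and vc: "set (vis 0 c) \<subseteq> {0..}"
      using a t(3) by (auto simp: ipaths_def)
    have vT: "v > int k" if "v \<in> ?T" for v using that vc by force
    note v = vis_cut_join[OF a, of c]
    have lT: "loc 0 (a @ 1 # c) v = count_list (map ((+) (int k + 1)) (vis 0 c)) v" if "v \<in> ?T" for v
      using vT[OF that] va by (force simp: v count_list_append count_list_0_iff)
    have "Phi 0 (a @ 1 # c) = (\<Prod>v\<in>({0..<int k} \<union> {int k}) \<union> ?T. \<phi> (loc 0 (a @ 1 # c) v))"
      using va by (intro Phi_superset) (auto simp: v)
    also have "\<dots> = (\<Prod>v\<in>{0..<int k} \<union> {int k}. \<phi> (loc 0 (a @ 1 # c) v)) * (\<Prod>v\<in>?T. \<phi> (loc 0 (a @ 1 # c) v))"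
      by (rule prod.union_disjoint) (use vT in force)+
    also have "(\<Prod>v\<in>?T. \<phi> (loc 0 (a @ 1 # c) v)) = Phi 0 c"
      unfolding Phi_def
      by (subst prod.reindex) (auto intro!: prod.cong simp: lT count_list_map_conv)
    also have "(\<Prod>v\<in>{0..<int k} \<union> {int k}. \<phi> (loc 0 (a @ 1 # c) v)) =
       (\<Prod>v\<in>{0..<int k}. \<phi> (loc 0 (a @ 1 # c) v)) * \<phi> 1"
      using loc_cut_join(1)[OF t(2,3)] by (subst prod.union_disjoint) auto
    finally have P: "Phi 0 (a @ 1 # c) = (\<Prod>v\<in>{0..<int k}. \<phi> (loc 0 (a @ 1 # c) v)) * \<phi> 1 * Phi 0 c" .
    have "ennreal (p ^ k) = (\<Prod>v\<in>{0..<int k}. ennreal p)"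
      using p(2) by (simp add: ennreal_power)
    also have "\<dots> \<le> (\<Prod>v\<in>{0..<int k}. \<phi> (loc 0 (a @ 1 # c) v))"
      by (intro prod_mono_ennreal p(1))
    finally have "ennreal (p ^ k) * \<phi> 1 * Phi 0 c \<le> Phi 0 (a @ 1 # c)"
      unfolding P by (intro mult_right_mono) auto
    then have "half (a @ 1 # c) * (ennreal (p ^ k) * \<phi> 1 * Phi 0 c) \<le> half (a @ 1 # c) * Phi 0 (a @ 1 # c)"
      by (rule mult_left_mono) simp
    then show "(\<lambda>(k, a, c). (ennreal (1/2) * \<phi> 1 * ennreal (p ^ k)) * half a * (half c * Phi 0 c)) t
        \<le> half ((\<lambda>(k, a, c). a @ 1 # c) t) * Phi 0 ((\<lambda>(k, a, c). a @ 1 # c) t)"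
      by (simp only: t(1) prod.case half_append half_Cons mult_ac)
  qed
  finally show ?thesis .
qed

text \<open>If the crossing weight grew no faster than \<open>p ^ n\<close>, the generating function of the
  pieces without cut points would stay bounded away from its critical value at \<open>s = 1\<close>, and the
  harmonic series \<open>exit_sum\<close> would converge.\<close>

lemma cross_grows:
  assumes p: "\<And>l. ennreal p \<le> \<phi> l" "0 \<le> p" and f: "\<phi> 1 = ennreal f" "p < f"
  shows "\<exists>n. ennreal (p ^ n) < cross n"
proof (cases "p = 0")
  case True
  have e: "ennreal (1/2) * \<phi> 1 = ennreal (f / 2)"
    unfolding f(1) using f True by (subst ennreal_mult[symmetric]) auto
  have "ennreal (1/2) * \<phi> 1 \<le> cross 1"
    using cross_ge[OF p, of 1] by (simp add: nocut_sum_0 cross_0)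
  moreover have "0 < ennreal (f / 2)" using f True by simp
  ultimately have "0 < cross 1" unfolding e by (rule order.strict_trans2[rotated])
  then show ?thesis using True by (intro exI[of _ 1]) simp
next
  case False
  with p have p0: "0 < p" by simp
  show ?thesis
  proof (rule ccontr)
    assume "\<not> ?thesis"
    then have le: "cross n \<le> ennreal (p ^ n)" for n by (simp add: not_less)
    \<comment> \<open>Crossing weight in units of \<open>p ^ n\<close>. It is at most 1 under the
      assumption to be refuted, and by \<open>cross_ge\<close> it obeys a renewal inequality whose
      kernel exceeds that of \<open>exit_sum\<close> by the factor \<open>f / p > 1\<close>.\<close>
    define v where "v n = ennreal (inverse p ^ n) * cross n" for n
    have v1: "v n \<le> 1" for n
    proof -
      have "v n \<le> ennreal (inverse p ^ n) * ennreal (p ^ n)"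
        unfolding v_def by (intro mult_left_mono le) simp
      also have "\<dots> = 1" using p0 by (simp add: ennreal_mult[symmetric] power_mult_distrib[symmetric])
      finally show ?thesis .
    qed
    have v_rec: "(\<Sum>k<n. ennreal (f / (2 * p)) * nocut_sum k * v (n - 1 - k)) \<le> v n" for n
    proof -
      have "(\<Sum>k<n. ennreal (f / (2 * p)) * nocut_sum k * v (n - 1 - k)) =
          ennreal (inverse p ^ n) * (\<Sum>k<n. ennreal (1/2) * \<phi> 1 * (ennreal (p ^ k) * nocut_sum k) * cross (n - 1 - k))"
        unfolding sum_distrib_left
      proof (rule sum.cong[OF refl])
        have regroup: "a * x * (b * y) = c * (d * g * (h * x) * y)" if "a * b = c * (d * g * h)" for a b c d g h x y :: ennreal
        proof -
          have "a * x * (b * y) = (a * b) * (x * y)" by (simp only: mult_ac)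
          then show ?thesis unfolding that by (simp only: mult_ac)
        qed
        fix k assume "k \<in> {..<n}"
        then have n: "n = Suc (k + (n - 1 - k))" by auto
        have "inverse p ^ n * (1/2 * f * p ^ k) = inverse p * (1/2 * f) * (inverse p ^ k * p ^ k) * inverse p ^ (n - 1 - k)"
          by (subst n) (simp only: power_Suc power_add mult_ac)
        also have "\<dots> = f / (2 * p) * inverse p ^ (n - 1 - k)"
        proof -
          have "inverse p ^ k * p ^ k = 1" using p0 by (simp add: power_inverse)
          moreover have "inverse p * (1/2 * f) = f / (2 * p)" using p0 by (simp add: field_simps)
          ultimately show ?thesis by (simp only: mult_1_right)
        qed
        finally have e: "f / (2 * p) * inverse p ^ (n - 1 - k) = inverse p ^ n * (1/2 * f * p ^ k)" ..
        have "ennreal (f / (2 * p)) * ennreal (inverse p ^ (n - 1 - k)) = ennreal (inverse p ^ n) * (ennreal (1/2) * ennreal f * ennreal (p ^ k))"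
        proof -
          have nn: "0 \<le> f / (2 * p)" "0 \<le> inverse p ^ (n - 1 - k)" "0 \<le> inverse p ^ n" "0 \<le> p ^ k" "0 \<le> f" "0 \<le> 1/2 * f"
              "0 \<le> 1/2 * f * p ^ k" "(0::real) \<le> 1/2"
            using p0 f(2) by auto
          show ?thesis unfolding ennreal_mult[OF nn(8,5), symmetric] ennreal_mult[OF nn(6,4), symmetric]
              ennreal_mult[OF nn(3,7), symmetric] ennreal_mult[OF nn(1,2), symmetric] e ..
        qed
        then show "ennreal (f / (2 * p)) * nocut_sum k * v (n - 1 - k) =
          ennreal (inverse p ^ n) * (ennreal (1/2) * \<phi> 1 * (ennreal (p ^ k) * nocut_sum k) * cross (n - 1 - k))"
          unfolding v_def f(1) by (rule regroup)
      qed
      also have "\<dots> \<le> v n" unfolding v_def by (intro mult_left_mono cross_ge[OF p]) simp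
      finally show ?thesis .
    qed
    have bound: "(\<Sum>n<N. s ^ n / real (n + 1)) \<le> 4 * p / (f - p)" if s: "1/2 \<le> s" "s < 1" for s N
    proof -
      have s0: "0 \<le> s" using s by simp
      define Q where "Q = psum UNIV (\<lambda>n. ennreal (s ^ n) * exit_sum n)"
      define G where "G = psum UNIV (\<lambda>n. ennreal (s ^ n) * nocut_sum n)"
      define W where "W = psum UNIV (\<lambda>n. ennreal (s ^ n) * v n)"
      have cG: "psum UNIV (\<lambda>k. ennreal (s ^ k) * (c * nocut_sum k)) = c * G" for c
        unfolding G_def psum_cmult[symmetric] by (intro psum_cong refl) (simp only: mult_ac)
      have top: "psum UNIV (\<lambda>n. ennreal (s ^ n) * A n) < \<top>" if "\<And>n. A n \<le> 1" for A
      proof -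
        have "psum UNIV (\<lambda>n. ennreal (s ^ n) * A n) \<le> psum UNIV (\<lambda>n. ennreal (s ^ n))"
          using that by (intro psum_mono) (metis mult.right_neutral mult_left_mono zero_le)
        then show ?thesis using psum_geometric[OF s0 s(2)] by (simp add: order.strict_trans1)
      qed
      have Wtop: "W < \<top>" unfolding W_def by (rule top[OF v1])
      have Qtop: "Q < \<top>" unfolding Q_def exit_sum_def by (rule top[OF psum_ipaths_le_1])
      have "1 \<le> W" unfolding W_def
        using psum_mem_le[of 0 UNIV "\<lambda>n. ennreal (s ^ n) * v n"] by (simp add: v_def cross_0)
      have "ennreal s * (ennreal (f / (2 * p)) * G) * W = psum UNIV (\<lambda>n. ennreal (s ^ n) * (\<Sum>k<n. (ennreal (f / (2 * p)) * nocut_sum k) * v (n - 1 - k)))"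
        unfolding psum_convolution[OF s0, of "\<lambda>k. ennreal (f / (2 * p)) * nocut_sum k" v] W_def[symmetric] cG ..
      also have "\<dots> \<le> W" unfolding W_def by (intro psum_mono mult_left_mono v_rec) simp
      \<comment> \<open>\<open>W\<close> is finite and at least 1, so it cancels. What remains says
        that \<open>s * G / 2\<close> is at most \<open>p / f < 1\<close>, uniformly in
        \<open>s\<close>.\<close>
      finally have "W * (ennreal s * (ennreal (f / (2 * p)) * G)) \<le> W * 1" by (simp add: mult.commute)
      then have sG: "ennreal s * (ennreal (f / (2 * p)) * G) \<le> 1"
        using \<open>1 \<le> W\<close> Wtop by (subst (asm) ennreal_mult_le_mult_iff) auto
      have "G \<noteq> \<top>"
      proof
        assume "G = \<top>"
        then have "ennreal s * (ennreal (f / (2 * p)) * G) = \<top>"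
          using s p0 f(2) by (simp add: ennreal_mult_top)
        with sG show False by (simp add: top_unique)
      qed
      then obtain \<gamma> where \<gamma>: "G = ennreal \<gamma>" "0 \<le> \<gamma>" by (cases G) auto
      from Qtop obtain \<rho> where \<rho>: "Q = ennreal \<rho>" "0 \<le> \<rho>" by (cases Q) auto
      have "s * (f / (2 * p) * \<gamma>) \<le> 1"
        using sG \<gamma> s p0 f(2) by (simp add: ennreal_mult[symmetric] del: ennreal_le_1) (simp add: ennreal_le_1)
      then have g1: "s * f * \<gamma> \<le> 2 * p" using p0 by (simp add: field_simps)
      have "Q \<le> psum UNIV (\<lambda>n. ennreal (s ^ n) * (nocut_sum n + (\<Sum>k<n. ennreal (1/2) * nocut_sum k * exit_sum (n - 1 - k))))"
        unfolding Q_def by (intro psum_mono mult_left_mono exit_sum_le) simp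
      also have "\<dots> = G + psum UNIV (\<lambda>n. ennreal (s ^ n) * (\<Sum>k<n. (ennreal (1/2) * nocut_sum k) * exit_sum (n - 1 - k)))"
        by (simp only: distrib_left psum_add G_def)
      also have "\<dots> = G + ennreal s * (ennreal (1/2) * G) * Q"
        unfolding psum_convolution[OF s0, of "\<lambda>k. ennreal (1/2) * nocut_sum k" exit_sum] Q_def[symmetric] cG ..
      finally have "ennreal \<rho> \<le> ennreal (\<gamma> + s * (1/2 * \<gamma>) * \<rho>)"
        using \<gamma> \<rho> s0 by (simp add: ennreal_mult[symmetric] ennreal_plus[symmetric] del: ennreal_plus ennreal_half)
      then have "\<rho> \<le> \<gamma> + s * (1/2 * \<gamma>) * \<rho>" using \<gamma> \<rho> s0 by (subst (asm) ennreal_le_iff) auto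
      \<comment> \<open>Solving the renewal inequality for \<open>\<rho>\<close>: its coefficient
        \<open>s * \<gamma> / 2\<close> is at most \<open>p / f\<close>. The restriction
        \<open>1/2 \<le> s\<close> turns the bound on \<open>s * f * \<gamma>\<close> into one on
        \<open>f * \<gamma>\<close>, so the result does not depend on \<open>s\<close>.\<close>
      then have "f * \<rho> \<le> f * \<gamma> + (s * f * \<gamma>) * \<rho> / 2"
        using mult_left_mono[of \<rho> "\<gamma> + s * (1/2 * \<gamma>) * \<rho>" f] p0 f(2) by (simp add: algebra_simps)
      also have "\<dots> \<le> f * \<gamma> + p * \<rho>"
        using mult_right_mono[OF g1 \<rho>(2)] by simp
      finally have "(f - p) * \<rho> \<le> f * \<gamma>" by (simp add: algebra_simps)
      also have "f * \<gamma> \<le> 4 * p"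
      proof -
        have "1/2 * (f * \<gamma>) \<le> s * (f * \<gamma>)" using s \<gamma> p0 f(2) by (intro mult_right_mono) auto
        then show ?thesis using g1 by (simp add: mult.assoc)
      qed
      finally have r: "\<rho> \<le> 4 * p / (f - p)" using f(2) by (simp add: pos_le_divide_eq mult.commute)
      have "ennreal (s ^ n / real (n + 1)) = ennreal (s ^ n) * exit_sum n" for n
        unfolding exit_sum_def psum_ipaths_0 using s0 by (subst ennreal_mult[symmetric]) simp_all
      then have "(\<Sum>n<N. ennreal (s ^ n / real (n + 1))) = (\<Sum>n<N. ennreal (s ^ n) * exit_sum n)"
        by (simp only:)
      moreover have "(\<Sum>n<N. ennreal (s ^ n / real (n + 1))) = ennreal (\<Sum>n<N. s ^ n / real (n + 1))"
        using s0 by (intro sum_ennreal) auto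
      ultimately have "ennreal (\<Sum>n<N. s ^ n / real (n + 1)) = (\<Sum>n<N. ennreal (s ^ n) * exit_sum n)"
        by (simp only:)
      also have "\<dots> \<le> Q"
        unfolding Q_def psum_finite[OF finite_lessThan, symmetric] by (rule psum_subset) simp
      finally have "(\<Sum>n<N. s ^ n / real (n + 1)) \<le> \<rho>" using \<rho> by (simp add: ennreal_le_iff)
      with r show ?thesis by simp
    qed
    have "harm N \<le> 2 * (4 * p / (f - p))" for N
    proof (cases "N = 0")
      case True
      then show ?thesis using p0 f(2) by (simp add: harm_def)
    next
      case False
      \<comment> \<open>By Bernoulli's inequality \<open>s ^ N\<close> is at least 1/2, so damping
        costs the first \<open>N\<close> terms of the harmonic series at most half.\<close>
      define s where "s = 1 - 1 / (2 * real N)"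
      have N: "1 \<le> real N" using False by simp
      have s: "1/2 \<le> s" "s < 1" using N by (auto simp: s_def field_simps)
      have sN: "1/2 \<le> s ^ N"
        using Bernoulli_inequality[of "- (1 / (2 * real N))" N] N by (simp add: s_def field_simps)
      have "1/2 * harm N = (\<Sum>n<N. 1/2 * (1 / real (n + 1)))"
        unfolding harm_def sum_distrib_left
        by (rule sum.reindex_bij_witness[of _ Suc "\<lambda>k. k - 1"]) (auto simp: inverse_eq_divide)
      also have "\<dots> \<le> (\<Sum>n<N. s ^ n * (1 / real (n + 1)))"
      proof (intro sum_mono mult_right_mono)
        fix n assume "n \<in> {..<N}"
        then have "s ^ N \<le> s ^ n" using s by (intro power_decreasing) auto
        with sN show "1/2 \<le> s ^ n" by simp
      qed simp
      also have "\<dots> \<le> 4 * p / (f - p)" using bound[OF s, of N] by simp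
      finally show ?thesis by simp
    qed
    moreover obtain N where "2 * (4 * p / (f - p)) + 1 \<le> harm N"
      using harm_at_top by (auto simp: filterlim_at_top eventually_sequentially)
    ultimately show False by (metis add_le_same_cancel1 dual_order.trans not_one_le_zero)
  qed
qed

text \<open>The second crossing, shifted by \<open>i\<close>, never goes below \<open>i\<close>. So
  the two pieces use disjoint sites, the weight factorizes, and counting the visits below
  \<open>i\<close> recovers the cut.\<close>

lemma cross_mult: "cross i * cross j \<le> cross (i + j)"
proof -
  have v: "vis 0 (a @ c) = vis 0 a @ map ((+) (int i)) (vis 0 c)" if "a \<in> ipaths (int i) 0" for a c
    using that vis_shift[of "int i" 0 c] by (simp add: vis_append ipaths_def)
  have sub: "set (vis 0 a) \<subseteq> {0..<int n}" if "a \<in> ipaths (int n) 0" for a n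
    using that by (simp add: ipaths_def)
  have "cross i * cross j = psum (ipaths (int i) 0 \<times> ipaths (int j) 0)
      (\<lambda>(a, c). (half a * Phi 0 a) * (half c * Phi 0 c))"
    by (simp add: psum_Sigma psum_cmult psum_multc cross_def)
  also have "\<dots> \<le> cross (i + j)"
    unfolding cross_def
  proof (rule psum_inj_le[of "\<lambda>(a, c). a @ c"])
    show "inj_on (\<lambda>(a, c). a @ c) (ipaths (int i) 0 \<times> ipaths (int j) 0)"
    proof (rule inj_onI, clarify)
      fix a c a' c' assume h: "a \<in> ipaths (int i) 0" "c \<in> ipaths (int j) 0"
        "a' \<in> ipaths (int i) 0" "c' \<in> ipaths (int j) 0" "a @ c = a' @ c'"
      have "length a = length (filter (\<lambda>v. v < int i) (vis 0 (a @ c)))"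
        if "a \<in> ipaths (int i) 0" "c \<in> ipaths (int j) 0" for a c
      proof -
        have "filter (\<lambda>v. v < int i) (vis 0 a) = vis 0 a"
          using sub[OF that(1)] by (subst filter_id_conv) force
        moreover have "filter (\<lambda>v. v < int i) (map ((+) (int i)) (vis 0 c)) = []"
          using sub[OF that(2)] by (subst filter_empty_conv) force
        ultimately show ?thesis by (simp add: v[OF that(1)])
      qed
      from this[OF h(1,2)] this[OF h(3,4)] h(5) have "length a = length a'" by simp
      with h(5) show "a = a' \<and> c = c'" by simp
    qed
    show "(\<lambda>(a, c). a @ c) ` (ipaths (int i) 0 \<times> ipaths (int j) 0) \<subseteq> ipaths (int (i + j)) 0"
    proof (rule image_subsetI)
      fix q assume "q \<in> ipaths (int i) 0 \<times> ipaths (int j) 0"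
      then obtain a c where q: "q = (a, c)" "a \<in> ipaths (int i) 0" "c \<in> ipaths (int j) 0" by auto
      have "set (vis 0 (a @ c)) \<subseteq> {0..<int (i + j)}"
        using sub[OF q(2)] sub[OF q(3)] by (force simp: v[OF q(2)])
      then show "(\<lambda>(a, c). a @ c) q \<in> ipaths (int (i + j)) 0"
        using q by (simp add: ipaths_def)
    qed
    fix q assume "q \<in> ipaths (int i) 0 \<times> ipaths (int j) 0"
    then obtain a c where q: "q = (a, c)" "a \<in> ipaths (int i) 0" "c \<in> ipaths (int j) 0" by auto
    let ?T = "(+) (int i) ` set (vis 0 c)"
    have d: "v \<notin> ?T" if "v \<in> set (vis 0 a)" for v
      using that sub[OF q(2)] sub[OF q(3)] by force
    have "Phi 0 (a @ c) = (\<Prod>v\<in>set (vis 0 a) \<union> ?T. \<phi> (loc 0 (a @ c) v))"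
      by (intro Phi_superset) (auto simp: v[OF q(2)])
    also have "\<dots> = (\<Prod>v\<in>set (vis 0 a). \<phi> (loc 0 (a @ c) v)) * (\<Prod>v\<in>?T. \<phi> (loc 0 (a @ c) v))"
      by (rule prod.union_disjoint) (use d in auto)
    also have "(\<Prod>v\<in>set (vis 0 a). \<phi> (loc 0 (a @ c) v)) = Phi 0 a"
      unfolding Phi_def using d
      by (intro prod.cong refl) (auto simp: v[OF q(2)] count_list_append)
    also have "(\<Prod>v\<in>?T. \<phi> (loc 0 (a @ c) v)) = Phi 0 c"
    proof -
      have "loc 0 (a @ c) (int i + w) = loc 0 c w" if "w \<in> set (vis 0 c)" for w
      proof -
        have "int i + w \<notin> set (vis 0 a)" using that d by blast
        then show ?thesis
          using count_list_map_conv[of "(+) (int i)" "vis 0 c" w]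
          by (simp add: v[OF q(2)] count_list_append)
      qed
      then show ?thesis unfolding Phi_def by (subst prod.reindex) (auto intro!: prod.cong)
    qed
    finally show "(\<lambda>(a, c). (half a * Phi 0 a) * (half c * Phi 0 c)) q
        \<le> half ((\<lambda>(a, c). a @ c) q) * Phi 0 ((\<lambda>(a, c). a @ c) q)"
      by (simp add: q(1) half_append mult_ac)
  qed
  finally show ?thesis .
qed

lemma cross_power: "cross i ^ k \<le> cross (i * k)"
proof (induction k)
  case (Suc k)
  have "cross i ^ Suc k \<le> cross i * cross (i * k)"
    using Suc by (simp add: mult_left_mono)
  also have "\<dots> \<le> cross (i * Suc k)" using cross_mult[of i "i * k"] by simp
  finally show ?case .
qed (simp add: cross_0)

text \<open>By supermultiplicativity a single \<open>N\<close> with \<open>cross N > p ^ N\<close>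
  suffices, and \<open>lam\<close> is the \<open>N\<close>-th root of \<open>cross N\<close>. The
  constant \<open>(f / 2) ^ N\<close> covers the remainder modulo \<open>N\<close> by crossings of
  single sites, each of weight at least \<open>f / 2\<close>.\<close>

lemma cross_exponential:
  assumes p: "\<And>l. ennreal p \<le> \<phi> l" "0 \<le> p" and f: "\<phi> 1 = ennreal f" "p < f"
  shows "\<exists>lam c. p < lam \<and> lam \<le> 1 \<and> 0 < c \<and> (\<forall>n. ennreal (c * lam ^ n) \<le> cross n)"
proof -
  obtain N where N: "ennreal (p ^ N) < cross N" using cross_grows[OF assms] by blast
  have N0: "0 < N"
  proof (rule ccontr)
    assume "\<not> 0 < N"
    with N show False by (simp add: cross_0)
  qed
  obtain b where b: "cross N = ennreal b" "0 \<le> b" using cross_le_1[of N] by (cases "cross N") (auto simp: top_unique)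
  have b1: "b \<le> 1" using cross_le_1[of N] b by (simp add: ennreal_le_1)
  have pb: "p ^ N < b" using N b p(2) by (simp add: ennreal_less_iff)
  define lam where "lam = root N b"
  have lN: "lam ^ N = b" using N0 b(2) by (simp add: lam_def)
  have l0: "0 \<le> lam" using b(2) by (simp add: lam_def real_root_ge_zero)
  have l1: "lam \<le> 1" using N0 b1 by (simp add: lam_def)
  have pl: "p < lam"
  proof (rule ccontr)
    assume "\<not> p < lam"
    then have "lam ^ N \<le> p ^ N" using l0 by (intro power_mono) auto
    with pb lN show False by simp
  qed
  have f1: "f \<le> 1" using phi_le_1[of 1] f(1) by (simp add: ennreal_le_1)
  have f0: "0 < f" using p(2) f(2) by simp
  have c1: "ennreal (f / 2) \<le> cross 1"
  proof -
    have "ennreal (f / 2) = ennreal (1/2) * \<phi> 1"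
      unfolding f(1) using f0 by (subst ennreal_mult[symmetric]) auto
    then show ?thesis using cross_ge[OF p, of 1] by (simp add: nocut_sum_0 cross_0)
  qed
  have "ennreal ((f / 2) ^ N * lam ^ n) \<le> cross n" for n
  proof -
    define k r where "k = n div N" and "r = n mod N"
    have n: "n = N * k + r" "r < N" using N0 by (auto simp: k_def r_def)
    have "(f / 2) ^ N * lam ^ n \<le> b ^ k * (f / 2) ^ r"
    proof -
      have "lam ^ n \<le> lam ^ (N * k)" using l0 l1 n by (intro power_decreasing) auto
      moreover have "(f / 2) ^ N \<le> (f / 2) ^ r" using f0 f1 n by (intro power_decreasing) auto
      moreover have "lam ^ (N * k) = b ^ k" by (simp add: power_mult lN)
      ultimately show ?thesis using l0 f0 by (subst mult.commute) (intro mult_mono, auto)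
    qed
    then have "ennreal ((f / 2) ^ N * lam ^ n) \<le> ennreal (b ^ k * (f / 2) ^ r)" by (rule ennreal_leI)
    also have "\<dots> = cross N ^ k * ennreal (f / 2) ^ r"
      using b f0 by (simp add: ennreal_mult ennreal_power)
    also have "\<dots> \<le> cross N ^ k * cross 1 ^ r"
      by (intro mult_left_mono power_mono c1) auto
    also have "\<dots> \<le> cross (N * k) * cross (1 * r)"
      by (intro mult_mono cross_power) auto
    also have "\<dots> \<le> cross n" using cross_mult[of "N * k" r] n by simp
    finally show ?thesis .
  qed
  with pl l1 f0 show ?thesis by (intro exI[of _ lam] exI[of _ "(f / 2) ^ N"]) auto
qed

lemma conn_ge_cross:
  fixes e :: "int ^ 'd::finite"
  assumes "CARD('d) = 1" "e \<in> unit_steps" "\<And>j. 0 \<le> j \<Longrightarrow> j < int n \<Longrightarrow> x + j *s e \<in> B"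
  shows "cross n \<le> conn B x (x + int n *s e)"
  unfolding cross_def conn_def
proof (rule psum_inj_le[of "emb e"])
  have e0: "e \<noteq> 0" by (rule unit_steps_card_1(2)[OF assms(1,2)])
  show "inj_on (emb e) (ipaths (int n) 0)"
    using inj_emb[OF e0] by (rule inj_on_subset) simp
  have z: "x + 0 *s e = x" by (simp add: vec_eq_iff)
  show "emb e ` ipaths (int n) 0 \<subseteq> {k \<in> paths x (x + int n *s e). set (vis x k) \<subseteq> B}"
  proof (rule image_subsetI)
    fix us assume "us \<in> ipaths (int n) 0"
    note emb_ipaths[OF assms(1,2) this, of x, unfolded z]
    then show "emb e us \<in> {k \<in> paths x (x + int n *s e). set (vis x k) \<subseteq> B}"
      using assms(3) by (fastforce simp: hpaths_def)
  qed
  fix us assume "us \<in> ipaths (int n) 0"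
  then have "us \<in> lists {1, -1}" by (simp add: ipaths_def)
  moreover have "Phi x (emb e us) = Phi 0 us"
    using vis_emb[of x 0 e us] z by (intro Phi_image[OF inj_smult[OF e0, of x]]) simp
  ultimately show "half us * Phi 0 us \<le> wt x (emb e us)"
    by (simp add: wt_def emb_lists(2)[OF assms(1,2)])
qed

text \<open>Only crossings of the segment from \<open>x1\<close> to \<open>x2\<close> are used. They
  never step behind \<open>x1\<close>, and \<open>x2\<close> is the first site outside, so they
  visit only sites of the cube.\<close>

lemma conn_card_1:
  fixes x1 x2 z :: "int ^ 'd::finite"
  assumes "CARD('d) = 1" "x1 \<in> cube z K" "x2 \<in> outer_boundary (cube z K)"
  shows "\<exists>n\<le>2 * K + 1. cross n \<le> conn (cube z K) x1 x2"
proof -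
  obtain i :: 'd where i: "UNIV = {i}" using assms(1) by (auto simp: card_1_singleton_iff)
  have all: "(\<forall>j. P j) \<longleftrightarrow> P i" for P :: "'d \<Rightarrow> bool" using i by (metis UNIV_I singletonD)
  define e where "e = (axis i (if x1 $ i < x2 $ i then 1 else - 1) :: int ^ 'd)"
  define n where "n = nat \<bar>x2 $ i - x1 $ i\<bar>"
  have e: "e \<in> unit_steps" by (simp add: e_def)
  have x2: "x2 = x1 + int n *s e"
    by (auto simp: vec_eq_iff all e_def axis_def n_def)
  have b1: "\<bar>x1 $ i - z $ i\<bar> \<le> int K" using assms(2) by (simp add: cube_def)
  obtain x' u where x': "x2 = x' + u" "x' \<in> cube z K" "u \<in> unit_steps" and n2: "x2 \<notin> cube z K"
    using assms(3) by (auto simp: outer_boundary_def)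
  have "\<bar>x' $ i - z $ i\<bar> \<le> int K" using x'(2) by (simp add: cube_def)
  moreover have "\<bar>u $ i\<bar> \<le> 1" using x'(3) by (auto simp: unit_steps_def axis_def)
  ultimately have b2: "\<bar>x2 $ i - z $ i\<bar> \<le> int K + 1" using x'(1) by simp
  have b3: "int K < \<bar>x2 $ i - z $ i\<bar>" using n2 by (simp add: cube_def all)
  have "n \<le> 2 * K + 1" using b1 b2 by (simp add: n_def)
  moreover have "cross n \<le> conn (cube z K) x1 x2"
    unfolding x2
  proof (rule conn_ge_cross[OF assms(1) e])
    fix j assume "0 \<le> j" "j < int n"
    then show "x1 + j *s e \<in> cube z K"
      using b1 b2 b3 by (auto simp: cube_def all e_def axis_def n_def)
  qed
  ultimately show ?thesis by blast
qed

end

section \<open>Linear bounds for the weighted path length\<close>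

lemma outer_boundary_cube: "outer_boundary (cube z K) \<subseteq> cube z (Suc K)"
proof
  fix v assume "v \<in> outer_boundary (cube z K)"
  then obtain x u where v: "v = x + u" "x \<in> cube z K" "u \<in> unit_steps" by (auto simp: outer_boundary_def)
  have "\<bar>v $ i - z $ i\<bar> \<le> int (Suc K)" for i
  proof -
    have "\<bar>x $ i - z $ i\<bar> \<le> int K" using v(2) by (simp add: cube_def)
    moreover have "\<bar>u $ i\<bar> \<le> 1" using v(3) by (auto simp: unit_steps_def axis_def)
    ultimately show ?thesis using v(1) by simp
  qed
  then show "v \<in> cube z (Suc K)" by (simp add: cube_def)
qed

lemma dist1_cube:
  fixes v w :: "int ^ 'd::finite"
  assumes "v \<in> cube z K" "w \<in> cube z K"
  shows "dist1 v w \<le> CARD('d) * (2 * K)"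
proof (rule dist1_le_cube)
  have "\<bar>w $ i - v $ i\<bar> \<le> int (2 * K)" for i
  proof -
    have "\<bar>v $ i - z $ i\<bar> \<le> int K" "\<bar>w $ i - z $ i\<bar> \<le> int K" using assms by (simp_all add: cube_def)
    then show ?thesis by linarith
  qed
  then show "w \<in> cube v (2 * K)" by (simp add: cube_def)
qed

lemma escape_prob_ge:
  fixes v w :: "int ^ 'd::finite"
  shows "ennreal (inverse (card (unit_steps :: (int ^ 'd) set)) ^ dist1 v w) \<le> escape_prob v w"
proof -
  obtain us where us: "us \<in> hpaths v w" "length us = dist1 v w" "v \<notin> set (tl (vis v us))"
    using shortest_path by blast
  then have "srw_prob us \<le> escape_prob v w"
    unfolding escape_prob_def by (intro psum_mem_le[of us]) simp
  then show ?thesis by (simp add: srw_prob_def us(2))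
qed

lemma ennreal_le_divide_mult:
  assumes "X * ennreal t \<le> ennreal a * Y" "0 < t" "0 \<le> a"
  shows "X \<le> ennreal (a / t) * Y"
proof -
  have "X = ennreal (1 / t) * (X * ennreal t)"
  proof -
    have "ennreal (1 / t) * ennreal t = 1" using assms(2) by (simp add: ennreal_mult[symmetric])
    then show ?thesis by (metis mult.commute mult.left_commute mult_1_right)
  qed
  also have "\<dots> \<le> ennreal (1 / t) * (ennreal a * Y)" by (intro mult_left_mono assms(1)) simp
  also have "\<dots> = ennreal (a / t) * Y"
    using assms(2,3) by (simp add: mult.assoc[symmetric] ennreal_mult[symmetric])
  finally show ?thesis .
qed

text \<open>Since the exponent of \<open>q\<close> is quadratic, the term is at most
  \<open>C * 3 ^ j\<close> times the \<open>K\<close>-th power of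
  \<open>3 ^ j * A * (q ^ 4) ^ K\<close>, and this base tends to 0.\<close>

lemma summable_gaussian:
  fixes q A C :: real
  assumes "0 \<le> q" "q < 1" "0 \<le> A" "0 \<le> C"
  shows "summable (\<lambda>K. C * real (2 * K + 3) ^ j * A ^ K * q ^ ((2 * K + 1)\<^sup>2))"
proof (rule summable_comparison_test_ev)
  have "(\<lambda>K. 3 ^ j * A * (q ^ 4) ^ K) \<longlonglongrightarrow> 3 ^ j * A * 0"
    using assms by (intro tendsto_intros LIMSEQ_power_zero) (auto simp: power_less_one_iff)
  then have "eventually (\<lambda>K. 3 ^ j * A * (q ^ 4) ^ K < 1/2) sequentially"
    by (rule order_tendstoD) simp
  then show "eventually (\<lambda>K. norm (C * real (2 * K + 3) ^ j * A ^ K * q ^ ((2 * K + 1)\<^sup>2)) \<le> C * 3 ^ j * (1/2) ^ K) sequentially"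
  proof eventually_elim
    case (elim K)
    have "2 * K + 3 \<le> 3 * 3 ^ K" by (induction K) auto
    then have "real (2 * K + 3) ^ j \<le> (3 * 3 ^ K) ^ j"
      by (intro power_mono) (metis of_nat_le_iff of_nat_mult of_nat_numeral of_nat_power, simp)
    also have "\<dots> = 3 ^ j * (3 ^ j) ^ K" by (simp add: power_mult_distrib power_mult[symmetric] mult.commute)
    finally have 1: "real (2 * K + 3) ^ j \<le> 3 ^ j * (3 ^ j) ^ K" .
    have 2: "q ^ ((2 * K + 1)\<^sup>2) \<le> ((q ^ 4) ^ K) ^ K"
    proof -
      have "((q ^ 4) ^ K) ^ K = q ^ (4 * K * K)" by (simp add: power_mult[symmetric] mult.assoc)
      then show ?thesis using assms by (simp only:) (intro power_decreasing, auto simp: power2_eq_square algebra_simps)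
    qed
    have "C * real (2 * K + 3) ^ j * A ^ K * q ^ ((2 * K + 1)\<^sup>2) \<le> C * (3 ^ j * (3 ^ j) ^ K) * A ^ K * ((q ^ 4) ^ K) ^ K"
      using assms by (intro mult_mono 1 2) auto
    also have "\<dots> = C * 3 ^ j * (3 ^ j * A * (q ^ 4) ^ K) ^ K" by (simp only: power_mult_distrib mult_ac)
    also have "\<dots> \<le> C * 3 ^ j * (1/2) ^ K"
      using elim assms by (intro mult_left_mono power_mono) auto
    finally show ?case using assms by (simp add: abs_mult)
  qed
  show "summable (\<lambda>K. C * 3 ^ j * (1/2) ^ K)" by (intro summable_mult summable_geometric) simp
qed

text \<open>About half of the exponent absorbs the polynomial: with \<open>\<eta>\<close> the fourth
  root of \<open>\<theta>\<close>, the product \<open>real (K + 1) * \<eta> ^ (K + 1)\<close> is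
  bounded.\<close>

lemma summable_poly_geometric:
  fixes \<theta> C :: real
  assumes "0 \<le> \<theta>" "\<theta> < 1" "0 \<le> C"
  shows "summable (\<lambda>K. C * real (2 * K + 3) ^ 4 * \<theta> ^ (2 * K + 1))"
proof (rule summable_comparison_test_ev)
  define \<eta> where "\<eta> = root 4 \<theta>"
  have \<eta>: "0 \<le> \<eta>" "\<eta> < 1" "\<eta> ^ 4 = \<theta>" using assms by (auto simp: \<eta>_def)
  show "eventually (\<lambda>K. norm (C * real (2 * K + 3) ^ 4 * \<theta> ^ (2 * K + 1)) \<le> C * 81 * (1 / (1 - \<eta>)) ^ 4 * \<theta> ^ K) sequentially"
  proof (intro always_eventually allI)
    fix K
    have "real (2 * K + 3) ^ 4 \<le> (3 * real (K + 1)) ^ 4" by (intro power_mono) auto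
    also have "\<dots> = 81 * real (K + 1) ^ 4" by (simp only: power_mult_distrib) simp
    finally have 1: "real (2 * K + 3) ^ 4 \<le> 81 * real (K + 1) ^ 4" .
    have "real (K + 1) ^ 4 * \<theta> ^ (K + 1) = (real (K + 1) * \<eta> ^ (K + 1)) ^ 4"
      unfolding \<eta>(3)[symmetric] power_mult_distrib power_mult[symmetric] by (simp add: mult.commute)
    also have "\<dots> \<le> (1 / (1 - \<eta>)) ^ 4"
      using \<eta> by (intro power_mono real_mult_power_le mult_nonneg_nonneg) auto
    finally have 2: "real (K + 1) ^ 4 * \<theta> ^ (K + 1) \<le> (1 / (1 - \<eta>)) ^ 4" .
    have "\<theta> ^ (2 * K + 1) = \<theta> ^ (K + 1) * \<theta> ^ K" 
      unfolding power_add[symmetric] by (intro arg_cong[where f = "\<lambda>n. \<theta> ^ n"]) simp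
    then have "C * real (2 * K + 3) ^ 4 * \<theta> ^ (2 * K + 1) \<le> C * (81 * real (K + 1) ^ 4) * (\<theta> ^ (K + 1) * \<theta> ^ K)"
      using assms by (simp only:) (intro mult_mono 1, auto)
    also have "\<dots> = C * 81 * (real (K + 1) ^ 4 * \<theta> ^ (K + 1)) * \<theta> ^ K" by (simp only: mult_ac)
    also have "\<dots> \<le> C * 81 * (1 / (1 - \<eta>)) ^ 4 * \<theta> ^ K"
      using assms by (intro mult_right_mono mult_left_mono 2) auto
    finally show "norm (C * real (2 * K + 3) ^ 4 * \<theta> ^ (2 * K + 1)) \<le> C * 81 * (1 / (1 - \<eta>)) ^ 4 * \<theta> ^ K"
      using assms by (simp add: abs_mult)
  qed
  show "summable (\<lambda>K. C * 81 * (1 / (1 - \<eta>)) ^ 4 * \<theta> ^ K)"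
    using assms by (intro summable_mult summable_geometric) simp
qed

context site_weights
begin

text \<open>The summand at scale \<open>K\<close> is the surgery rate with its two volume factors.
  Each dimension then has to supply the escape bound \<open>e\<close>, the connection bound
  \<open>s\<close> and the summability.\<close>

lemma length_le_range_real:
  fixes e s :: "nat \<Rightarrow> real"
  assumes "0 < m" and r: "\<phi> m = ennreal r" "0 \<le> r"
    and pos: "\<And>K. 0 < e K" "\<And>K. 0 < s K"
    and esc: "\<And>K (z :: int ^ 'd::finite) v w. v \<in> cube z (Suc K) \<Longrightarrow> w \<in> cube z (Suc K) \<Longrightarrow> ennreal (e K) \<le> escape_prob v w"
    and con: "\<And>K (z :: int ^ 'd) x1 x2. x1 \<in> cube z K \<Longrightarrow> x2 \<in> outer_boundary (cube z K) \<Longrightarrow> ennreal (s K) \<le> conn (cube z K) x1 x2"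
    and sum: "summable (\<lambda>K. real ((2 * Suc K + 1) ^ CARD('d)) * (r ^ ((2 * K + 1) ^ CARD('d)) * real m ^ 2 / (s K * (e K)\<^sup>2)) * real ((2 * K + 1) ^ CARD('d)))"
  shows "\<exists>L\<ge>0. \<forall>x y :: int ^ 'd. psum (hpaths x y) (\<lambda>us. of_nat (length us) * wt x us) \<le>
    ennreal L * psum (hpaths x y) (\<lambda>us. of_nat (card (set (vis x us))) * wt x us)"
proof -
  define \<rho> where "\<rho> K = r ^ ((2 * K + 1) ^ CARD('d)) * real m ^ 2 / (s K * (e K)\<^sup>2)" for K
  define t where "t K = real ((2 * Suc K + 1) ^ CARD('d)) * \<rho> K * real ((2 * K + 1) ^ CARD('d))" for K
  have \<rho>0: "0 \<le> \<rho> K" for K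
    unfolding \<rho>_def using r(2) pos[of K] by (intro divide_nonneg_pos mult_nonneg_nonneg mult_pos_pos) auto
  have t0: "0 \<le> t K" for K unfolding t_def using \<rho>0[of K] by (intro mult_nonneg_nonneg) auto
  have ts: "summable t" using sum unfolding t_def \<rho>_def .
  have "psum (hpaths x y) (\<lambda>us. of_nat (length us) * wt x us) \<le>
      ennreal (real m + suminf t) * psum (hpaths x y) (\<lambda>us. of_nat (card (set (vis x us))) * wt x us)" for x y :: "int ^ 'd"
  proof -
    have "psum {us \<in> hpaths x y. (\<forall>v\<in>cube z K. m \<le> loc x us v) \<and> loc x us w < m} (\<lambda>us. of_nat (loc x us z) * wt x us)
        \<le> ennreal (\<rho> K) * psum {us \<in> hpaths x y. set (vis x us) \<inter> cube z K \<noteq> {}} (wt x)"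
      if w: "w \<in> cube z (Suc K)" for K z w
    proof -
      have "psum {us \<in> hpaths x y. (\<forall>v\<in>cube z K. m \<le> loc x us v) \<and> loc x us w < m} (\<lambda>us. of_nat (loc x us z) * wt x us)
          * (ennreal (s K) * (ennreal (e K))\<^sup>2) \<le> \<phi> m ^ card (cube z K) * of_nat m ^ 2 *
          psum {us \<in> hpaths x y. set (vis x us) \<inter> cube z K \<noteq> {}} (wt x)"
      proof (rule surgery)
        fix v assume "v \<in> insert z (outer_boundary (cube z K))"
        then have "v \<in> cube z (Suc K)" using outer_boundary_cube by auto
        then show "ennreal (e K) \<le> escape_prob v w" using w by (rule esc)
      qed (use assms(1) con in auto)
      moreover have "ennreal (s K) * (ennreal (e K))\<^sup>2 = ennreal (s K * (e K)\<^sup>2)"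
        using pos[of K] by (simp add: ennreal_mult ennreal_power)
      moreover have "\<phi> m ^ card (cube z K) * of_nat m ^ 2 = ennreal (r ^ ((2 * K + 1) ^ CARD('d)) * real m ^ 2)"
        unfolding r(1) card_cube using r(2) by (simp add: ennreal_mult ennreal_power ennreal_of_nat_eq_real_of_nat)
      ultimately show ?thesis
        unfolding \<rho>_def using r(2) pos[of K] by (intro ennreal_le_divide_mult) auto
    qed
    then have "psum (hpaths x y) (\<lambda>us. of_nat (length us) * wt x us) \<le>
      (of_nat m + (\<Sum>K. of_nat ((2 * Suc K + 1) ^ CARD('d)) * ennreal (\<rho> K) * of_nat ((2 * K + 1) ^ CARD('d)))) *
      psum (hpaths x y) (\<lambda>us. of_nat (card (set (vis x us))) * wt x us)"
      by (rule length_le_range[OF assms(1)])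
    also have "(\<Sum>K. of_nat ((2 * Suc K + 1) ^ CARD('d)) * ennreal (\<rho> K) * of_nat ((2 * K + 1) ^ CARD('d))) = (\<Sum>K. ennreal (t K))"
    proof (rule arg_cong[where f = suminf], rule ext)
      fix K
      have "of_nat A * ennreal (\<rho> K) * of_nat B = ennreal (real A * \<rho> K * real B)" for A B :: nat
        using \<rho>0[of K] by (simp add: ennreal_mult ennreal_of_nat_eq_real_of_nat)
      then show "of_nat ((2 * Suc K + 1) ^ CARD('d)) * ennreal (\<rho> K) * of_nat ((2 * K + 1) ^ CARD('d)) = ennreal (t K)"
        unfolding t_def .
    qed
    also have "\<dots> = ennreal (suminf t)" by (rule suminf_ennreal2[OF t0 ts])
    also have "of_nat m + ennreal (suminf t) = ennreal (real m + suminf t)"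
      using suminf_nonneg[OF ts t0] by (simp add: ennreal_of_nat_eq_real_of_nat)
    finally show ?thesis .
  qed
  moreover have "0 \<le> real m + suminf t" using suminf_nonneg[OF ts t0] by simp
  ultimately show ?thesis by blast
qed

text \<open>Volume and maximal connection length are both \<open>2 * K + 1\<close>, so their factors
  combine to \<open>(r / lam) ^ (2 * K + 1)\<close> with \<open>r < lam\<close>. The volume factors
  and the squared escape bound contribute a polynomial of degree 4 only.\<close>

lemma length_le_range_dim1:
  assumes d: "CARD('d::finite) = 1"
    and p: "\<And>l. ennreal p \<le> \<phi> l" "0 \<le> p" and f: "\<phi> 1 = ennreal f" "p < f"
    and lim: "\<And>\<epsilon>. p < \<epsilon> \<Longrightarrow> \<exists>m>0. \<phi> m < ennreal \<epsilon>"
  shows "\<exists>L\<ge>0. \<forall>x y :: int ^ 'd. psum (hpaths x y) (\<lambda>us. of_nat (length us) * wt x us) \<le>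
    ennreal L * psum (hpaths x y) (\<lambda>us. of_nat (card (set (vis x us))) * wt x us)"
proof -
  obtain lam c where lc: "p < lam" "lam \<le> 1" "0 < c" "\<And>n. ennreal (c * lam ^ n) \<le> cross n"
    using cross_exponential[OF p f] by blast
  obtain m where m: "0 < m" "\<phi> m < ennreal lam" using lim[OF lc(1)] by blast
  obtain r where r: "\<phi> m = ennreal r" "0 \<le> r" using m(2) by (cases "\<phi> m") auto
  have rl: "r < lam" using m(2) r by (simp add: ennreal_less_iff)
  then have l0: "0 < lam" using r(2) by simp
  show ?thesis
  \<comment> \<open>Two sites of the cube of radius \<open>Suc K\<close> have distance at most
    \<open>2 * K + 2\<close>, to which \<open>escape_prob_card_1\<close> adds 1.\<close>
  proof (rule length_le_range_real[OF m(1) r, where e = "\<lambda>K. 1 / (2 * real (2 * K + 3))" and s = "\<lambda>K. c * lam ^ (2 * K + 1)"])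
    fix K and z v w :: "int ^ 'd"
    assume vw: "v \<in> cube z (Suc K)" "w \<in> cube z (Suc K)"
    have "dist1 v w \<le> 2 * K + 2" using dist1_cube[OF vw] d by simp
    then have "ennreal (1 / (2 * real (2 * K + 3))) \<le> ennreal (1 / (2 * real (dist1 v w + 1)))"
      by (intro ennreal_leI divide_left_mono) auto
    also have "\<dots> \<le> escape_prob v w" by (rule escape_prob_card_1[OF d])
    finally show "ennreal (1 / (2 * real (2 * K + 3))) \<le> escape_prob v w" .
  next
    fix K and z x1 x2 :: "int ^ 'd"
    assume x: "x1 \<in> cube z K" "x2 \<in> outer_boundary (cube z K)"
    obtain n where n: "n \<le> 2 * K + 1" "cross n \<le> conn (cube z K) x1 x2"
      using conn_card_1[OF d x] by blast
    have "ennreal (c * lam ^ (2 * K + 1)) \<le> ennreal (c * lam ^ n)"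
      using lc l0 n(1) by (intro ennreal_leI mult_left_mono power_decreasing) auto
    also have "\<dots> \<le> conn (cube z K) x1 x2" using lc(4)[of n] n(2) by (rule order_trans)
    finally show "ennreal (c * lam ^ (2 * K + 1)) \<le> conn (cube z K) x1 x2" .
  next
    have "summable (\<lambda>K. 4 * real m ^ 2 / c * real (2 * K + 3) ^ 4 * (r / lam) ^ (2 * K + 1))"
      using r rl l0 lc(3) by (intro summable_poly_geometric) auto
    then show "summable (\<lambda>K. real ((2 * Suc K + 1) ^ CARD('d)) * (r ^ ((2 * K + 1) ^ CARD('d)) * real m ^ 2 /
       (c * lam ^ (2 * K + 1) * (1 / (2 * real (2 * K + 3)))\<^sup>2)) * real ((2 * K + 1) ^ CARD('d)))"
    proof (rule summable_comparison_test'[where N = 0])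
      fix K :: nat
      let ?a = "real (2 * K + 3)"
      have "real ((2 * Suc K + 1) ^ CARD('d)) * (r ^ ((2 * K + 1) ^ CARD('d)) * real m ^ 2 /
         (c * lam ^ (2 * K + 1) * (1 / (2 * ?a))\<^sup>2)) * real ((2 * K + 1) ^ CARD('d)) =
         (4 * real m ^ 2 / c * ?a ^ 3 * (r / lam) ^ (2 * K + 1)) * real (2 * K + 1)"
      proof -
        have a: "real ((2 * Suc K + 1) ^ CARD('d)) = ?a" by (simp add: d)
        have b: "r ^ ((2 * K + 1) ^ CARD('d)) = r ^ (2 * K + 1)" "real ((2 * K + 1) ^ CARD('d)) = real (2 * K + 1)"
          by (simp_all only: d power_one_right)
        have g: "A * (R * M / (c * B * (1 / (2 * A))\<^sup>2)) * D = (4 * M / c * A ^ 3 * (R / B)) * D" if "A > 0" "B > 0" for A R M B D :: real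
          using that lc(3) by (simp add: field_simps power2_eq_square power3_eq_cube)
        show ?thesis unfolding a b power_divide[of r lam] by (rule g) (use l0 in auto)
      qed
      also have "norm \<dots> \<le> (4 * real m ^ 2 / c * ?a ^ 3 * (r / lam) ^ (2 * K + 1)) * ?a"
      proof -
        have n: "0 \<le> 4 * real m ^ 2 / c * ?a ^ 3 * (r / lam) ^ (2 * K + 1)"
          using r l0 lc(3) by (intro mult_nonneg_nonneg divide_nonneg_pos zero_le_power) auto
        have "norm ((4 * real m ^ 2 / c * ?a ^ 3 * (r / lam) ^ (2 * K + 1)) * real (2 * K + 1)) =
           (4 * real m ^ 2 / c * ?a ^ 3 * (r / lam) ^ (2 * K + 1)) * real (2 * K + 1)"
          unfolding real_norm_def by (rule abs_of_nonneg, rule mult_nonneg_nonneg[OF n]) simp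
        also have "\<dots> \<le> (4 * real m ^ 2 / c * ?a ^ 3 * (r / lam) ^ (2 * K + 1)) * ?a"
          using n by (intro mult_left_mono) auto
        finally show ?thesis .
      qed
      also have "\<dots> = 4 * real m ^ 2 / c * ?a ^ 4 * (r / lam) ^ (2 * K + 1)"
      proof -
        have "x ^ 4 = x ^ 3 * x" for x :: real by (simp add: eval_nat_numeral)
        then show ?thesis by (simp only: mult_ac)
      qed
      finally show "norm (real ((2 * Suc K + 1) ^ CARD('d)) * (r ^ ((2 * K + 1) ^ CARD('d)) * real m ^ 2 /
         (c * lam ^ (2 * K + 1) * (1 / (2 * ?a))\<^sup>2)) * real ((2 * K + 1) ^ CARD('d))) \<le> 4 * real m ^ 2 / c * ?a ^ 4 * (r / lam) ^ (2 * K + 1)" .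
    qed
  qed (use lc l0 in auto)
qed

text \<open>A shortest path to the inner neighbour of \<open>x2\<close> stays in a bounding box,
  hence in the cube, and one more step reaches \<open>x2\<close>.\<close>

lemma conn_ge:
  fixes x1 x2 z :: "int ^ 'd::finite"
  assumes c: "0 < c" "c \<le> 1" "\<And>l. ennreal (c ^ l) \<le> \<phi> l"
    and x: "x1 \<in> cube z K" "x2 \<in> outer_boundary (cube z K)"
  shows "ennreal ((c / card (unit_steps :: (int ^ 'd) set)) ^ (CARD('d) * (2 * K) + 1)) \<le> conn (cube z K) x1 x2"
proof -
  obtain x' u where x': "x2 = x' + u" "x' \<in> cube z K" "u \<in> unit_steps"
    using x(2) by (auto simp: outer_boundary_def)
  obtain us where us: "us \<in> hpaths x1 x'" "length us = dist1 x1 x'"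
      "\<And>v i. v \<in> set (vis x1 us) \<Longrightarrow> min (x1 $ i) (x' $ i) \<le> v $ i \<and> v $ i \<le> max (x1 $ i) (x' $ i)"
    using shortest_path[of x1 x'] by blast
  have "v \<in> cube z K" if "v \<in> set (vis x1 us)" for v
  proof -
    have "\<bar>v $ i - z $ i\<bar> \<le> int K" for i
    proof -
      have "\<bar>x1 $ i - z $ i\<bar> \<le> int K" "\<bar>x' $ i - z $ i\<bar> \<le> int K" using x(1) x'(2) by (simp_all add: cube_def)
      then show ?thesis using us(3)[OF that, of i] by linarith
    qed
    then show ?thesis by (simp add: cube_def)
  qed
  moreover have p: "us \<in> paths x1 x'" using us(1) by (simp add: hpaths_def)
  ultimately have "us @ [u] \<in> {k \<in> paths x1 x2. set (vis x1 k) \<subseteq> cube z K}"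
    using x' by (auto simp: vis_append paths_endpoint intro!: paths_append[OF p])
  then have "wt x1 (us @ [u]) \<le> conn (cube z K) x1 x2" unfolding conn_def by (rule psum_mem_le)
  moreover have "ennreal ((c / card (unit_steps :: (int ^ 'd) set)) ^ (CARD('d) * (2 * K) + 1)) \<le>
      ennreal ((c / card (unit_steps :: (int ^ 'd) set)) ^ length (us @ [u]))"
  proof (intro ennreal_leI power_decreasing)
    show "length (us @ [u]) \<le> CARD('d) * (2 * K) + 1" using dist1_cube[OF x(1) x'(2)] us(2) by simp
    show "0 \<le> c / real (card (unit_steps :: (int ^ 'd) set))" using c(1) by simp
    have "1 \<le> real (card (unit_steps :: (int ^ 'd) set))" using card_unit_steps_pos[where 'd = 'd] by linarith
    then show "c / real (card (unit_steps :: (int ^ 'd) set)) \<le> 1" using c(2) by (simp add: divide_le_eq)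
  qed
  ultimately show ?thesis using wt_ge[OF c(1,3), of "us @ [u]" x1] by (meson order_trans)
qed

lemma length_le_range_dim2:
  assumes d: "CARD('d::finite) \<noteq> 1"
    and c: "0 < c" "c \<le> 1" "\<And>l. ennreal (c ^ l) \<le> \<phi> l"
    and q: "\<phi> 1 = ennreal q" "0 \<le> q" "q < 1"
  shows "\<exists>L\<ge>0. \<forall>x y :: int ^ 'd. psum (hpaths x y) (\<lambda>us. of_nat (length us) * wt x us) \<le>
    ennreal L * psum (hpaths x y) (\<lambda>us. of_nat (card (set (vis x us))) * wt x us)"
proof -
  let ?D = "real (card (unit_steps :: (int ^ 'd) set))" and ?d = "CARD('d)"
  have D: "1 \<le> ?D" using card_unit_steps_pos[where 'd = 'd] by linarith
  have d2: "2 \<le> ?d" using d zero_less_card_finite[where 'a = 'd] by linarith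
  show ?thesis
  proof (rule length_le_range_real[of 1, OF _ q(1,2), where e = "\<lambda>K. inverse ?D ^ (?d * (2 * Suc K))" and s = "\<lambda>K. (c / ?D) ^ (?d * (2 * K) + 1)"])
    fix K and z v w :: "int ^ 'd"
    assume vw: "v \<in> cube z (Suc K)" "w \<in> cube z (Suc K)"
    have "ennreal (inverse ?D ^ (?d * (2 * Suc K))) \<le> ennreal (inverse ?D ^ dist1 v w)"
      using dist1_cube[OF vw] D by (intro ennreal_leI power_decreasing) (auto simp: inverse_le_1_iff)
    also have "\<dots> \<le> escape_prob v w" by (rule escape_prob_ge)
    finally show "ennreal (inverse ?D ^ (?d * (2 * Suc K))) \<le> escape_prob v w" .
  next
    fix K and z x1 x2 :: "int ^ 'd"
    assume "x1 \<in> cube z K" "x2 \<in> outer_boundary (cube z K)"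
    then show "ennreal ((c / ?D) ^ (?d * (2 * K) + 1)) \<le> conn (cube z K) x1 x2"
      by (rule conn_ge[OF c])
  next
    \<comment> \<open>Chosen so that the reciprocal of connection bound times squared escape bound
      is exactly \<open>C * A ^ K\<close>.\<close>
    define A where "A = (?D / c) ^ (2 * ?d) * ?D ^ (4 * ?d)"
    define C where "C = ?D / c * ?D ^ (4 * ?d)"
    have AC: "0 \<le> A" "0 \<le> C" using c D by (simp_all add: A_def C_def)
    have "summable (\<lambda>K. C * real (2 * K + 3) ^ (2 * ?d) * A ^ K * q ^ ((2 * K + 1)\<^sup>2))"
      using q AC by (intro summable_gaussian) auto
    then show "summable (\<lambda>K. real ((2 * Suc K + 1) ^ ?d) * (q ^ ((2 * K + 1) ^ ?d) * (real 1)\<^sup>2 /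
        ((c / ?D) ^ (?d * (2 * K) + 1) * (inverse ?D ^ (?d * (2 * Suc K)))\<^sup>2)) * real ((2 * K + 1) ^ ?d))"
    proof (rule summable_comparison_test'[where N = 0])
      fix K :: nat
      have 1: "1 / ((c / ?D) ^ (?d * (2 * K) + 1) * (inverse ?D ^ (?d * (2 * Suc K)))\<^sup>2) = C * A ^ K"
      proof -
        have a: "1 / ((c / ?D) ^ (?d * (2 * K) + 1)) = ((?D / c) ^ (2 * ?d)) ^ K * (?D / c)"
          using c D by (simp add: power_mult[symmetric] power_divide mult_ac)
        have "1 / (inverse ?D ^ (?d * (2 * Suc K)))\<^sup>2 = ?D ^ (?d * (2 * Suc K) * 2)"
          unfolding power_mult[symmetric] using D by (simp add: inverse_eq_divide power_divide)
        also have "?d * (2 * Suc K) * 2 = 4 * ?d * K + 4 * ?d" by simp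
        finally have b: "1 / (inverse ?D ^ (?d * (2 * Suc K)))\<^sup>2 = (?D ^ (4 * ?d)) ^ K * ?D ^ (4 * ?d)"
          by (simp only: power_add power_mult)
        have "1 / ((c / ?D) ^ (?d * (2 * K) + 1) * (inverse ?D ^ (?d * (2 * Suc K)))\<^sup>2) =
            (1 / ((c / ?D) ^ (?d * (2 * K) + 1))) * (1 / (inverse ?D ^ (?d * (2 * Suc K)))\<^sup>2)" by simp
        also have "\<dots> = C * A ^ K" unfolding a b A_def C_def power_mult_distrib by (simp only: mult_ac)
        finally show ?thesis .
      qed
      have "(2 * K + 1)\<^sup>2 \<le> (2 * K + 1) ^ ?d" using d2 by (intro power_increasing) auto
      then have 2: "q ^ ((2 * K + 1) ^ ?d) \<le> q ^ ((2 * K + 1)\<^sup>2)" by (rule power_decreasing) (use q in auto)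
      have 3: "real ((2 * K + 1) ^ ?d) \<le> real (2 * K + 3) ^ ?d" unfolding of_nat_power by (intro power_mono) auto
      have 4: "real ((2 * Suc K + 1) ^ ?d) = real (2 * K + 3) ^ ?d" unfolding of_nat_power by (intro arg_cong[where f = "\<lambda>x. x ^ _"]) simp
      have "real ((2 * Suc K + 1) ^ ?d) * (q ^ ((2 * K + 1) ^ ?d) * (real 1)\<^sup>2 /
        ((c / ?D) ^ (?d * (2 * K) + 1) * (inverse ?D ^ (?d * (2 * Suc K)))\<^sup>2)) * real ((2 * K + 1) ^ ?d)
        = real (2 * K + 3) ^ ?d * (q ^ ((2 * K + 1) ^ ?d) * (1 / ((c / ?D) ^ (?d * (2 * K) + 1) * (inverse ?D ^ (?d * (2 * Suc K)))\<^sup>2))) * real ((2 * K + 1) ^ ?d)"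
        unfolding 4 by simp
      also have "norm \<dots> = real (2 * K + 3) ^ ?d * (q ^ ((2 * K + 1) ^ ?d) * (C * A ^ K)) * real ((2 * K + 1) ^ ?d)"
        unfolding 1 real_norm_def using q AC by (intro abs_of_nonneg mult_nonneg_nonneg) auto
      also have "\<dots> \<le> real (2 * K + 3) ^ ?d * (q ^ ((2 * K + 1)\<^sup>2) * (C * A ^ K)) * real (2 * K + 3) ^ ?d"
        using q AC by (intro mult_mono 2 3 mult_nonneg_nonneg) auto
      also have "\<dots> = C * real (2 * K + 3) ^ (2 * ?d) * A ^ K * q ^ ((2 * K + 1)\<^sup>2)"
      proof -
        have "x ^ (2 * ?d) = x ^ ?d * x ^ ?d" for x :: real by (simp only: mult_2 power_add)
        then show ?thesis by (simp only: mult_ac)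
      qed
      finally show "norm (real ((2 * Suc K + 1) ^ ?d) * (q ^ ((2 * K + 1) ^ ?d) * (real 1)\<^sup>2 /
        ((c / ?D) ^ (?d * (2 * K) + 1) * (inverse ?D ^ (?d * (2 * Suc K)))\<^sup>2)) * real ((2 * K + 1) ^ ?d))
        \<le> C * real (2 * K + 3) ^ (2 * ?d) * A ^ K * q ^ ((2 * K + 1)\<^sup>2)" .
    qed
  qed (use c D in auto)
qed

text \<open>\<open>range_bound\<close> is used with \<open>n = k * dist1 x y\<close>. Here
  \<open>\<kappa>\<close> bounds from below the weight per step of a shortest path, and
  \<open>q ^ k < \<kappa>\<close> makes the error term at most a constant times the partition
  function.\<close>

lemma range_le_dist:
  assumes c: "0 < c" "c \<le> 1" "\<And>l. ennreal (c ^ l) \<le> \<phi> l"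
    and q: "\<phi> 1 = ennreal q" "0 \<le> q" "q < 1"
  shows "\<exists>R\<ge>0. \<forall>x y :: int ^ 'd::finite. x \<noteq> y \<longrightarrow>
    psum (hpaths x y) (\<lambda>us. of_nat (card (set (vis x us))) * wt x us)
     \<le> ennreal (R * real (dist1 x y)) * psum (hpaths x y) (wt x)"
proof -
  define \<kappa> where "\<kappa> = c / real (card (unit_steps :: (int ^ 'd) set))"
  have \<kappa>: "0 < \<kappa>" using c card_unit_steps_pos[where 'd = 'd] by (simp add: \<kappa>_def)
  obtain k where k: "q ^ k < \<kappa>" using real_arch_pow_inv[OF \<kappa> q(3)] by blast
  have "psum (hpaths x y) (\<lambda>us. of_nat (card (set (vis x us))) * wt x us)
     \<le> ennreal ((real k + 1 / (1 - q)) * real (dist1 x y)) * psum (hpaths x y) (wt x)" if "x \<noteq> y" for x y :: "int ^ 'd"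
  proof -
    let ?n = "dist1 x y" and ?Z = "psum (hpaths x y) (wt x)"
    have n: "1 \<le> real ?n" using that dist1_eq_0_iff[of x y] by (cases ?n) auto
    have Z: "ennreal (q ^ (k * ?n)) \<le> ?Z"
    proof -
      have "ennreal (q ^ (k * ?n)) \<le> ennreal (\<kappa> ^ ?n)"
        unfolding power_mult using k q by (intro ennreal_leI power_mono) auto
      also have "\<dots> \<le> ?Z" unfolding \<kappa>_def by (rule partition_ge[OF c(1,3)])
      finally show ?thesis .
    qed
    have "psum (hpaths x y) (\<lambda>us. of_nat (card (set (vis x us))) * wt x us)
        \<le> of_nat (k * ?n) * ?Z + ennreal (q ^ (k * ?n) / (1 - q))"
      by (rule range_bound[OF q])
    also have "ennreal (q ^ (k * ?n) / (1 - q)) = ennreal (1 / (1 - q)) * ennreal (q ^ (k * ?n))"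
      using q by (subst ennreal_mult[symmetric]) auto
    also have "\<dots> \<le> ennreal (1 / (1 - q)) * ?Z" by (intro mult_left_mono Z) simp
    also have "of_nat (k * ?n) * ?Z + ennreal (1 / (1 - q)) * ?Z = ennreal (real k * real ?n + 1 / (1 - q)) * ?Z"
    proof -
      have "of_nat (k * ?n) = ennreal (real k * real ?n)"
        unfolding of_nat_mult[where 'a = real, symmetric] by (rule ennreal_of_nat_eq_real_of_nat)
      then show ?thesis
        unfolding distrib_right[symmetric] using q by (subst ennreal_plus) auto
    qed
    also have "\<dots> \<le> ennreal ((real k + 1 / (1 - q)) * real ?n) * ?Z"
    proof (intro mult_right_mono ennreal_leI)
      have "1 / (1 - q) * 1 \<le> 1 / (1 - q) * real ?n" using q n by (intro mult_left_mono) auto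
      then show "real k * real ?n + 1 / (1 - q) \<le> (real k + 1 / (1 - q)) * real ?n"
        by (simp only: distrib_right mult_1_right add_left_mono)
    qed simp
    finally show ?thesis by (simp add: add_left_mono)
  qed
  moreover have "0 \<le> real k + 1 / (1 - q)" using q by simp
  ultimately show ?thesis by blast
qed

lemma length_le_dist:
  assumes c: "0 < c" "c \<le> 1" "\<And>l. ennreal (c ^ l) \<le> \<phi> l"
    and q: "\<phi> 1 = ennreal q" "0 \<le> q" "q < 1"
    and one_dim: "CARD('d::finite) = 1 \<Longrightarrow> \<exists>p\<ge>0. p < q \<and> (\<forall>l. ennreal p \<le> \<phi> l) \<and> (\<forall>\<epsilon>>p. \<exists>m>0. \<phi> m < ennreal \<epsilon>)"
  shows "\<exists>R\<ge>0. \<forall>x y :: int ^ 'd. x \<noteq> y \<longrightarrow>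
    psum (hpaths x y) (\<lambda>us. of_nat (length us) * wt x us) \<le> ennreal (R * real (dist1 x y)) * psum (hpaths x y) (wt x)"
proof -
  have "\<exists>L\<ge>0. \<forall>x y :: int ^ 'd. psum (hpaths x y) (\<lambda>us. of_nat (length us) * wt x us) \<le>
    ennreal L * psum (hpaths x y) (\<lambda>us. of_nat (card (set (vis x us))) * wt x us)"
  proof (cases "CARD('d) = 1")
    case True
    from one_dim[OF this] obtain p where p: "0 \<le> p" "p < q" "\<And>l. ennreal p \<le> \<phi> l" "\<And>\<epsilon>. p < \<epsilon> \<Longrightarrow> \<exists>m>0. \<phi> m < ennreal \<epsilon>"
      by blast
    show ?thesis by (rule length_le_range_dim1[OF True p(3,1) q(1) p(2,4)])
  next
    case False
    then show ?thesis by (rule length_le_range_dim2[OF _ c q])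
  qed
  then obtain L where L: "0 \<le> L" "\<And>x y :: int ^ 'd. psum (hpaths x y) (\<lambda>us. of_nat (length us) * wt x us) \<le>
    ennreal L * psum (hpaths x y) (\<lambda>us. of_nat (card (set (vis x us))) * wt x us)" by blast
  obtain R where R: "0 \<le> R" "\<And>x y :: int ^ 'd. x \<noteq> y \<Longrightarrow>
    psum (hpaths x y) (\<lambda>us. of_nat (card (set (vis x us))) * wt x us) \<le> ennreal (R * real (dist1 x y)) * psum (hpaths x y) (wt x)"
    using range_le_dist[OF c q] by blast
  have "psum (hpaths x y) (\<lambda>us. of_nat (length us) * wt x us) \<le> ennreal (L * R * real (dist1 x y)) * psum (hpaths x y) (wt x)"
    if "x \<noteq> y" for x y :: "int ^ 'd"
  proof -
    have "psum (hpaths x y) (\<lambda>us. of_nat (length us) * wt x us) \<le> ennreal L * (ennreal (R * real (dist1 x y)) * psum (hpaths x y) (wt x))"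
      by (rule order_trans[OF L(2) mult_left_mono[OF R(2)[OF that]]]) simp
    also have "\<dots> = ennreal (L * R * real (dist1 x y)) * psum (hpaths x y) (wt x)"
      using L(1) R(1) by (simp add: ennreal_mult mult_ac)
    finally show ?thesis .
  qed
  with L(1) R(1) show ?thesis by (intro exI[of _ "L * R"]) auto
qed

end

section \<open>From the annealed path measure to path sums\<close>

lemma hit_eq_enat_iff: "hit y S = enat n \<longleftrightarrow> S n = y \<and> (\<forall>k<n. S k \<noteq> y)"
proof -
  have *: "hit y S = enat n" if "S n = y" "\<forall>k<n. S k \<noteq> y" for n
    unfolding hit_def
  proof (rule antisym)
    show "(INF n\<in>{n. S n = y}. enat n) \<le> enat n" using that by (intro INF_lower) auto
    show "enat n \<le> (INF n\<in>{n. S n = y}. enat n)"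
      using that by (intro INF_greatest) (auto simp: not_less[symmetric])
  qed
  show ?thesis
  proof
    assume h: "hit y S = enat n"
    have "\<exists>m. S m = y"
    proof (rule ccontr)
      assume "\<nexists>m. S m = y"
      then have "{n. S n = y} = {}" by blast
      then have "hit y S = \<infinity>" by (simp add: hit_def top_enat_def)
      with h show False by simp
    qed
    then obtain m where m: "S m = y" "\<forall>k<m. S k \<noteq> y"
      using exists_least_iff[of "\<lambda>n. S n = y"] by blast
    from *[OF m] h have "m = n" by simp
    with m show "S n = y \<and> (\<forall>k<n. S k \<noteq> y)" by simp
  qed (use * in blast)
qed

lemma exp_neg_add: "0 \<le> a \<Longrightarrow> 0 \<le> b \<Longrightarrow> exp_neg (a + b) = exp_neg a * exp_neg b"
  by (cases a b rule: ereal2_cases) (simp_all add: exp_neg_def ennreal_mult[symmetric] mult_exp_exp)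

lemma exp_neg_0 [simp]: "exp_neg 0 = 1"
  by (simp add: exp_neg_def zero_ereal_def)

lemma exp_neg_sum:
  assumes "\<And>n. 0 \<le> f n" shows "exp_neg (\<Sum>n<k::nat. f n) = (\<Prod>n<k. exp_neg (f n))"
proof (induction k)
  case (Suc k)
  have "exp_neg (\<Sum>n<Suc k. f n) = exp_neg (\<Sum>n<k. f n) * exp_neg (f k)"
    unfolding sum.lessThan_Suc by (intro exp_neg_add sum_nonneg assms)
  with Suc show ?case by simp
qed simp

lemma exp_neg_le_1: "0 \<le> v \<Longrightarrow> exp_neg v \<le> 1"
  by (cases v) (auto simp: exp_neg_def)

lemma exp_neg_eq_1_iff: "0 \<le> v \<Longrightarrow> exp_neg v = 1 \<longleftrightarrow> v = 0"
  by (cases v) (auto simp: exp_neg_def zero_ereal_def)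

lemma exp_neg_ge:
  assumes "0 \<le> v" "v < 1" shows "ennreal (exp (-1)) \<le> exp_neg v"
  using assms by (cases v) (auto simp: exp_neg_def one_ereal_def intro!: ennreal_leI)

lemma exp_neg_pos: "0 \<le> v \<Longrightarrow> v < \<infinity> \<Longrightarrow> 0 < exp_neg v"
  by (cases v) (auto simp: exp_neg_def)

lemma prod_nth_eq_prod_count:
  "(\<Prod>n<length xs. g (xs ! n)) = (\<Prod>z\<in>set xs. g z ^ count_list xs z :: 'a :: comm_monoid_mult)"
proof -
  have "(\<Prod>n<length xs. g (xs ! n)) = (\<Prod>z\<in>set xs. \<Prod>n\<in>{n\<in>{..<length xs}. xs ! n = z}. g (xs ! n))"
    by (rule prod.group[symmetric]) auto
  also have "\<dots> = (\<Prod>z\<in>set xs. g z ^ count_list xs z)"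
  proof (rule prod.cong[OF refl])
    fix z
    have "count_list xs z = card {n. n < length xs \<and> z = xs ! n}"
      by (simp add: count_list_eq_length_filter length_filter_conv_card)
    also have "{n. n < length xs \<and> z = xs ! n} = {n\<in>{..<length xs}. xs ! n = z}" by auto
    finally show "(\<Prod>n\<in>{n\<in>{..<length xs}. xs ! n = z}. g (xs ! n)) = g z ^ count_list xs z"
      by simp
  qed
  finally show ?thesis .
qed

lemma finite_paths_length: "finite {us \<in> hpaths x (y :: int ^ 'd::finite). length us = n}"
proof (rule finite_subset)
  show "{us \<in> hpaths x y. length us = n} \<subseteq> {us. set us \<subseteq> unit_steps \<and> length us = n}"
    by (auto simp: hpaths_def paths_def lists_eq_set)
qed (rule finite_lists_length_eq, simp)

lemma measurable_component_step [measurable]: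
  "(\<lambda>\<xi>. \<xi> k) \<in> step_space \<rightarrow>\<^sub>M count_space (UNIV :: (int ^ 'd::finite) set)"
  using measurable_component_singleton[of k UNIV "\<lambda>_. measure_pmf (pmf_of_set (unit_steps :: (int ^ 'd) set))"]
  by (simp cong: measurable_cong_sets)

lemma measurable_walk [measurable]:
  "(\<lambda>\<xi> n. x + (\<Sum>k<n. \<xi> k)) \<in> step_space \<rightarrow>\<^sub>M (path_space :: (nat \<Rightarrow> int ^ 'd::finite) measure)"
proof (rule measurable_PiM_single')
  show "(\<lambda>\<xi>. x + (\<Sum>k<n. \<xi> k)) \<in> step_space \<rightarrow>\<^sub>M count_space (UNIV :: (int ^ 'd) set)" for n
  proof (induction n)
    case (Suc n)
    have "(\<lambda>\<xi>. (\<lambda>(a, b). a + b) (x + (\<Sum>k<n. \<xi> k), \<xi> n)) \<in> step_space \<rightarrow>\<^sub>M count_space (UNIV :: (int ^ 'd) set)"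
      by (rule measurable_compose[OF measurable_Pair[OF Suc measurable_component_step]])
        (auto simp: pair_measure_countable)
    then show ?case by (simp add: add.assoc)
  qed simp
qed auto

lemma AE_step_space: "AE \<xi> in step_space. \<forall>k. \<xi> k \<in> (unit_steps :: (int ^ 'd::finite) set)"
proof -
  have "AE u in measure_pmf (pmf_of_set (unit_steps :: (int ^ 'd) set)). u \<in> unit_steps"
    using AE_measure_pmf[of "pmf_of_set (unit_steps :: (int ^ 'd) set)"] by simp
  then have "AE \<xi> in step_space. \<xi> k \<in> (unit_steps :: (int ^ 'd) set)" for k
    by (intro AE_PiM_component) (auto intro: measure_pmf.prob_space_axioms)
  then show ?thesis by (simp add: AE_all_countable)
qed

lemma measurable_path_weight_path:
  fixes V :: "int ^ 'd::finite \<Rightarrow> 'w \<Rightarrow> ereal"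
  assumes "\<And>z. V z \<in> borel_measurable M" "\<omega> \<in> space M"
  shows "path_weight V y \<omega> \<in> borel_measurable path_space"
  using measurable_compose[OF measurable_Pair1'[OF assms(2)] measurable_path_weight[OF assms(1), where y = y]]
  by simp

lemma hit_set_measurable [measurable]: "{S. hit y S = t} \<in> sets path_space"
proof -
  have "hit y -` {t} \<inter> space path_space \<in> sets path_space"
    by (rule measurable_sets[OF measurable_hit]) simp
  moreover have "hit y -` {t} \<inter> space path_space = {S. hit y S = t}"
    by (auto simp: space_PiM)
  ultimately show ?thesis by simp
qed

text \<open>On the event that \<open>y\<close> is hit at time \<open>n\<close>, the weight depends
  on the first \<open>n\<close> steps only. Almost surely these are unit steps, so the integral is a
  finite sum over cylinders.\<close>

lemma quenched_integral_hit:
  fixes V :: "int ^ 'd::finite \<Rightarrow> 'w \<Rightarrow> ereal"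
  assumes V: "\<And>z. V z \<in> borel_measurable M" and \<omega>: "\<omega> \<in> space M"
  shows "(\<integral>\<^sup>+S. indicator {S. hit y S = enat n} S * path_weight V y \<omega> S \<partial>srw x) =
    (\<Sum>us\<in>{us \<in> hpaths x y. length us = n}. srw_prob us * exp_neg (\<Sum>k<n. V (vis x us ! k) \<omega>))"
proof -
  let ?H = "{us \<in> hpaths x y. length us = n}" and ?W = "\<lambda>us. exp_neg (\<Sum>k<n. V (vis x us ! k) \<omega>)"
  let ?walk = "\<lambda>\<xi> n. x + (\<Sum>k<n. \<xi> k)"
  note [measurable] = measurable_path_weight_path[OF V \<omega>]
  have cyl [measurable]: "cyl us \<in> sets step_space" "emeasure step_space (cyl us) = srw_prob us" if "us \<in> ?H" for us
    using that cyl_step_space[of us] by (auto simp: hpaths_def paths_def lists_eq_set)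
  have "(\<integral>\<^sup>+S. indicator {S. hit y S = enat n} S * path_weight V y \<omega> S \<partial>srw x) =
      (\<integral>\<^sup>+\<xi>. indicator {S. hit y S = enat n} (?walk \<xi>) * path_weight V y \<omega> (?walk \<xi>) \<partial>step_space)"
    unfolding srw_def by (rule nn_integral_distr) measurable
  also have "\<dots> = (\<integral>\<^sup>+\<xi>. (\<Sum>us\<in>?H. ?W us * indicator (cyl us) \<xi>) \<partial>step_space)"
    using AE_step_space[where 'd = 'd]
  proof (intro nn_integral_cong_AE, eventually_elim)
    case (elim \<xi>)
    define us where "us = map \<xi> [0..<n]"
    have len: "length us = n" by (simp add: us_def)
    have tk: "sum_list (take k us) = (\<Sum>j<k. \<xi> j)" if "k \<le> n" for k
      using that by (simp add: us_def take_map sum_list_sum_nth atLeast0LessThan)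
    have w: "?walk \<xi> k = vis x us ! k" if "k < n" for k
      using that by (simp add: nth_vis len tk)
    have wn: "?walk \<xi> n = x + sum_list us" using tk[of n] by (simp add: len)
    have "us \<in> lists unit_steps" using elim by (auto simp: us_def)
    then have mem: "us \<in> ?H \<longleftrightarrow> hit y (?walk \<xi>) = enat n"
      unfolding hit_eq_enat_iff using w wn len
      by (auto simp: hpaths_def paths_def in_set_conv_nth)
    have c: "\<xi> \<in> cyl us' \<longleftrightarrow> us' = us" if "us' \<in> ?H" for us'
    proof
      assume "\<xi> \<in> cyl us'"
      then show "us' = us" using that by (intro nth_equalityI) (auto simp: cyl_def us_def)
    next
      assume e: "us' = us"
      show "\<xi> \<in> cyl us'" unfolding e by (simp add: cyl_def us_def)
    qed
    have "(\<Sum>us'\<in>?H. ?W us' * indicator (cyl us') \<xi>) = (\<Sum>us'\<in>?H. if us' = us then ?W us' else 0)"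
      using c by (intro sum.cong refl) (auto split: split_indicator)
    also have "\<dots> = (if us \<in> ?H then ?W us else 0)"
      using finite_paths_length[of x y n] by simp
    also have "\<dots> = indicator {S. hit y S = enat n} (?walk \<xi>) * path_weight V y \<omega> (?walk \<xi>)"
    proof (cases "us \<in> ?H")
      case True
      then have "hit y (?walk \<xi>) = enat n" using mem by blast
      then show ?thesis using True w by (simp add: path_weight_def)
    next
      case False
      then have "hit y (?walk \<xi>) \<noteq> enat n" using mem by blast
      then show ?thesis unfolding if_not_P[OF False] by simp
    qed
    finally show ?case ..
  qed
  also have "\<dots> = (\<Sum>us\<in>?H. \<integral>\<^sup>+\<xi>. ?W us * indicator (cyl us) \<xi> \<partial>step_space)"
    by (rule nn_integral_sum) measurable
  also have "\<dots> = (\<Sum>us\<in>?H. srw_prob us * ?W us)"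
  proof (rule sum.cong[OF refl])
    fix us assume us: "us \<in> ?H"
    show "(\<integral>\<^sup>+\<xi>. ?W us * indicator (cyl us) \<xi> \<partial>step_space) = srw_prob us * ?W us"
      unfolding nn_integral_cmult_indicator[OF cyl(1)[OF us]] cyl(2)[OF us] by (rule mult.commute)
  qed
  finally show ?thesis .
qed

lemma path_weight_eq_suminf:
  "path_weight V y \<omega> S = (\<Sum>n. indicator {S. hit y S = enat n} S * path_weight V y \<omega> S)"
proof (cases "hit y S")
  case (enat k)
  have "(\<Sum>n. indicator {S. hit y S = enat n} S * path_weight V y \<omega> S) =
      (\<Sum>n\<in>{k}. indicator {S. hit y S = enat n} S * path_weight V y \<omega> S)"
    by (rule suminf_finite) (auto simp: enat)
  then show ?thesis by (simp add: enat)
qed (simp add: path_weight_def)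

lemma psum_by_length: "psum A f = (\<Sum>n. psum {us \<in> A. length us = n} f)"
proof -
  have "psum A f = psum A (\<lambda>us. psum UNIV (\<lambda>n. if length us = n then f us else 0))"
  proof (rule psum_cong[OF refl])
    fix us :: "'a list"
    have "psum UNIV (\<lambda>n. if length us = n then f us else 0) = psum {length us} (\<lambda>n. f us)"
      using psum_restrict[of UNIV "\<lambda>n. length us = n" "\<lambda>_. f us"] by simp
    then show "f us = psum UNIV (\<lambda>n. if length us = n then f us else 0)" by simp
  qed
  then show ?thesis by (simp add: psum_suminf psum_nat psum_restrict[of A])
qed

section \<open>The i.i.d. potential and its Laplace transform\<close>

locale iid_potential = prob_space M for M :: "'w measure" +
  fixes V :: "int ^ 'd::finite \<Rightarrow> 'w \<Rightarrow> ereal"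
  assumes indep: "indep_vars (\<lambda>_. borel) V UNIV"
    and ident: "distr M borel (V z) = distr M borel (V 0)"
    and nonneg: "AE \<omega> in M. 0 \<le> V 0 \<omega>"
begin

text \<open>The Laplace transform of \<open>V 0\<close> at the integers, which takes the role of
  \<open>\<phi>\<close>. The power makes the integrand 1 at \<open>l = 0\<close> even where the
  potential is infinite.\<close>

definition lap :: "nat \<Rightarrow> ennreal" where
  "lap l = (\<integral>\<^sup>+\<omega>. exp_neg (V 0 \<omega>) ^ l \<partial>M)"

lemma V_meas [measurable]: "V z \<in> borel_measurable M"
  using indep by (simp add: indep_vars_def)

lemma AE_V_nonneg: "AE \<omega> in M. \<forall>z. 0 \<le> V z \<omega>"
proof -
  have "AE \<omega> in M. 0 \<le> V z \<omega>" for z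
  proof -
    have m: "{v \<in> space borel. (0::ereal) \<le> v} \<in> sets borel" by measurable
    have "AE v in distr M borel (V 0). 0 \<le> v"
      using nonneg by (subst AE_distr_iff[OF V_meas m])
    then have "AE v in distr M borel (V z). 0 \<le> v" unfolding ident[of z] .
    then show ?thesis by (subst (asm) AE_distr_iff[OF V_meas m])
  qed
  then show ?thesis by (simp add: AE_all_countable)
qed

lemma lap_site: "(\<integral>\<^sup>+\<omega>. exp_neg (V z \<omega>) ^ l \<partial>M) = lap l"
proof -
  have "(\<integral>\<^sup>+\<omega>. exp_neg (V z \<omega>) ^ l \<partial>M) = (\<integral>\<^sup>+v. exp_neg v ^ l \<partial>distr M borel (V z))" for z
    by (rule nn_integral_distr[symmetric]) measurable
  then show ?thesis by (simp add: lap_def ident[of z])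
qed

sublocale W: site_weights lap
proof
  show "lap 0 = 1" by (simp add: lap_def emeasure_space_1)
  show "antimono lap"
  proof (rule antimonoI)
    fix i j :: nat assume "i \<le> j"
    show "lap j \<le> lap i"
      unfolding lap_def using nonneg
    proof (intro nn_integral_mono_AE, eventually_elim)
      case (elim \<omega>)
      then show ?case using \<open>i \<le> j\<close> exp_neg_le_1[of "V 0 \<omega>"] by (intro power_decreasing) auto
    qed
  qed
qed

lemma lap_product:
  assumes "finite F"
  shows "(\<integral>\<^sup>+\<omega>. (\<Prod>z\<in>F. exp_neg (V z \<omega>) ^ l z) \<partial>M) = (\<Prod>z\<in>F. lap (l z))"
proof -
  have "indep_vars (\<lambda>_. borel) (\<lambda>z \<omega>. exp_neg (V z \<omega>) ^ l z) F"
    by (rule indep_vars_compose2[OF indep_vars_subset[OF indep]]) auto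
  then have "(\<integral>\<^sup>+\<omega>. (\<Prod>z\<in>F. exp_neg (V z \<omega>) ^ l z) \<partial>M) = (\<Prod>z\<in>F. \<integral>\<^sup>+\<omega>. exp_neg (V z \<omega>) ^ l z \<partial>M)"
    by (intro indep_vars_nn_integral assms) auto
  then show ?thesis by (simp add: lap_site)
qed

text \<open>Grouping the steps by site turns the weight into a product with one factor for each
  distinct visited site, and these factors are independent.\<close>

lemma annealed_path: "(\<integral>\<^sup>+\<omega>. exp_neg (\<Sum>k<length us. V (vis x us ! k) \<omega>) \<partial>M) = W.Phi x us"
proof -
  have "(\<integral>\<^sup>+\<omega>. exp_neg (\<Sum>k<length us. V (vis x us ! k) \<omega>) \<partial>M) =
      (\<integral>\<^sup>+\<omega>. (\<Prod>z\<in>set (vis x us). exp_neg (V z \<omega>) ^ loc x us z) \<partial>M)"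
    using AE_V_nonneg
  proof (intro nn_integral_cong_AE, eventually_elim)
    case (elim \<omega>)
    have "exp_neg (\<Sum>k<length us. V (vis x us ! k) \<omega>) = (\<Prod>k<length us. exp_neg (V (vis x us ! k) \<omega>))"
      using elim by (intro exp_neg_sum) auto
    then show ?case
      using prod_nth_eq_prod_count[of "\<lambda>z. exp_neg (V z \<omega>)" "vis x us"] by simp
  qed
  then show ?thesis by (simp add: lap_product W.Phi_def)
qed

lemma annealed_integral_hit:
  "annealed_integral M V x y {S. hit y S = enat n} = psum {us \<in> hpaths x y. length us = n} (W.wt x)"
proof -
  let ?H = "{us \<in> hpaths x y. length us = n}"
  have "annealed_integral M V x y {S. hit y S = enat n} =
      (\<integral>\<^sup>+\<omega>. (\<Sum>us\<in>?H. srw_prob us * exp_neg (\<Sum>k<n. V (vis x us ! k) \<omega>)) \<partial>M)"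
    unfolding annealed_integral_def by (rule nn_integral_cong) (rule quenched_integral_hit[OF V_meas])
  also have "\<dots> = (\<Sum>us\<in>?H. \<integral>\<^sup>+\<omega>. srw_prob us * exp_neg (\<Sum>k<n. V (vis x us ! k) \<omega>) \<partial>M)"
    by (rule nn_integral_sum) measurable
  also have "\<dots> = (\<Sum>us\<in>?H. W.wt x us)"
  proof (rule sum.cong[OF refl])
    fix us assume "us \<in> ?H"
    then have "n = length us" by simp
    then show "(\<integral>\<^sup>+\<omega>. srw_prob us * exp_neg (\<Sum>k<n. V (vis x us ! k) \<omega>) \<partial>M) = W.wt x us"
      by (simp add: nn_integral_cmult annealed_path W.wt_def)
  qed
  finally show ?thesis by (simp add: psum_finite[OF finite_paths_length])
qed

lemma partition_function_eq: "partition_function M V x y = psum (hpaths x y) (W.wt x)"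
proof -
  let ?H = "\<lambda>n. {us \<in> hpaths x y. length us = n}"
  have q: "(\<integral>\<^sup>+S. path_weight V y \<omega> S \<partial>srw x) =
      (\<Sum>n. \<integral>\<^sup>+S. indicator {S. hit y S = enat n} S * path_weight V y \<omega> S \<partial>srw x)" if "\<omega> \<in> space M" for \<omega>
  proof -
    note [measurable] = measurable_path_weight_path[OF V_meas that]
    show ?thesis
      by (subst path_weight_eq_suminf, rule nn_integral_suminf) measurable
  qed
  have "partition_function M V x y =
      (\<integral>\<^sup>+\<omega>. (\<Sum>n. \<integral>\<^sup>+S. indicator {S. hit y S = enat n} S * path_weight V y \<omega> S \<partial>srw x) \<partial>M)"
    unfolding partition_function_def by (rule nn_integral_cong) (rule q)
  also have "\<dots> = (\<Sum>n. \<integral>\<^sup>+\<omega>. (\<integral>\<^sup>+S. indicator {S. hit y S = enat n} S * path_weight V y \<omega> S \<partial>srw x) \<partial>M)"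
  proof (rule nn_integral_suminf)
    fix n
    have "(\<lambda>\<omega>. \<Sum>us\<in>?H n. srw_prob us * exp_neg (\<Sum>k<n. V (vis x us ! k) \<omega>)) \<in> borel_measurable M"
      by measurable
    then show "(\<lambda>\<omega>. \<integral>\<^sup>+S. indicator {S. hit y S = enat n} S * path_weight V y \<omega> S \<partial>srw x) \<in> borel_measurable M"
      by (rule measurable_cong[THEN iffD2, rotated]) (rule quenched_integral_hit[OF V_meas])
  qed
  also have "\<dots> = (\<Sum>n. annealed_integral M V x y {S. hit y S = enat n})"
    unfolding annealed_integral_def ..
  also have "\<dots> = psum (hpaths x y) (W.wt x)"
    unfolding annealed_integral_hit by (rule psum_by_length[symmetric])
  finally show ?thesis .
qed

text \<open>The event that \<open>y\<close> is never hit has no mass, because its path weight is 0.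
  On the others the hitting time is the length of the stopped path.\<close>

lemma expected_hit:
  "(\<integral>\<^sup>+S. ennreal_of_enat (hit y S) \<partial>annealed_path_measure M V x y) =
    inverse (partition_function M V x y) * psum (hpaths x y) (\<lambda>us. of_nat (length us) * W.wt x us)"
proof -
  let ?Q = "annealed_path_measure M V x y" and ?Z = "partition_function M V x y"
  let ?h = "\<lambda>n. {S. hit y S = enat n}"
  have hm: "{S. hit y S = t} \<in> sets ?Q" for t by simp
  have "annealed_integral M V x y {S. hit y S = \<infinity>} = 0"
  proof -
    have "indicator {S. hit y S = \<infinity>} S * path_weight V y \<omega> S = 0" for \<omega> S
      by (simp add: path_weight_def split: split_indicator)
    then show ?thesis unfolding annealed_integral_def by (simp only: nn_integral_const mult_zero_left)
  qed
  then have "emeasure ?Q {S. hit y S = \<infinity>} = 0"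
    by (subst emeasure_annealed_path_measure) (auto intro: V_meas)
  then have "AE S in ?Q. hit y S \<noteq> \<infinity>"
    using hm[of \<infinity>] by (intro AE_I[of _ _ "{S. hit y S = \<infinity>}"]) auto
  then have "(\<integral>\<^sup>+S. ennreal_of_enat (hit y S) \<partial>?Q) = (\<integral>\<^sup>+S. (\<Sum>n. of_nat n * indicator (?h n) S) \<partial>?Q)"
  proof (intro nn_integral_cong_AE, eventually_elim)
    case (elim S)
    then obtain k where k: "hit y S = enat k" by auto
    have "(\<Sum>n. of_nat n * indicator (?h n) S) = (\<Sum>n\<in>{k}. of_nat n * indicator (?h n) S :: ennreal)"
      by (rule suminf_finite) (auto simp: k)
    then show ?case by (simp add: k)
  qed
  also have "\<dots> = (\<Sum>n. \<integral>\<^sup>+S. of_nat n * indicator (?h n) S \<partial>?Q)"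
    by (rule nn_integral_suminf) (use hm in measurable)
  also have "\<dots> = (\<Sum>n. inverse ?Z * (of_nat n * psum {us \<in> hpaths x y. length us = n} (W.wt x)))"
  proof (rule arg_cong[where f = suminf], rule ext)
    fix n
    have "(\<integral>\<^sup>+S. of_nat n * indicator (?h n) S \<partial>?Q) = of_nat n * emeasure ?Q (?h n)"
      by (rule nn_integral_cmult_indicator[OF hm])
    also have "emeasure ?Q (?h n) = inverse ?Z * annealed_integral M V x y (?h n)"
      by (rule emeasure_annealed_path_measure) (auto intro: V_meas)
    finally show "(\<integral>\<^sup>+S. of_nat n * indicator (?h n) S \<partial>?Q) =
        inverse ?Z * (of_nat n * psum {us \<in> hpaths x y. length us = n} (W.wt x))"
      by (simp add: annealed_integral_hit mult_ac)
  qed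
  also have "\<dots> = inverse ?Z * (\<Sum>n. of_nat n * psum {us \<in> hpaths x y. length us = n} (W.wt x))"
    by (rule ennreal_suminf_cmult)
  also have "(\<Sum>n. of_nat n * psum {us \<in> hpaths x y. length us = n} (W.wt x)) =
      psum (hpaths x y) (\<lambda>us. of_nat (length us) * W.wt x us)"
    unfolding psum_by_length[of "hpaths x y"] psum_cmult[symmetric]
    by (intro arg_cong[where f = suminf] ext psum_cong) auto
  finally show ?thesis .
qed

text \<open>The event \<open>V 0 < 1\<close> has positive probability because the essential infimum
  is 0, and on it the integrand is at least \<open>exp (-1) ^ l\<close>. For \<open>l > 0\<close>
  the probability itself dominates its \<open>l\<close>-th power, so \<open>c\<close> can be the
  product of the two constants.\<close>

lemma lap_ge_power:
  assumes "essinf M (V 0) = 0"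
  shows "\<exists>c>0. c \<le> 1 \<and> (\<forall>l. ennreal (c ^ l) \<le> lap l)"
proof -
  let ?B = "{\<omega> \<in> space M. V 0 \<omega> < 1}"
  have "\<not> (AE \<omega> in M. 1 \<le> V 0 \<omega>)"
  proof
    assume "AE \<omega> in M. 1 \<le> V 0 \<omega>"
    then have "1 \<le> essinf M (V 0)" unfolding essinf_def by (intro Liminf_bounded)
    with assms show False by simp
  qed
  moreover have "?B \<in> sets M" by measurable
  ultimately have "emeasure M ?B \<noteq> 0"
    by (subst (asm) AE_iff_measurable[of ?B]) (auto simp: not_le)
  then have b: "0 < prob ?B" by (simp add: emeasure_eq_measure less_le)
  define c where "c = exp (-1) * prob ?B"
  have c: "0 < c" "c \<le> 1" unfolding c_def using b by (auto intro: mult_le_one)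
  have "ennreal (c ^ l) \<le> lap l" for l
  proof (cases "l = 0")
    case True
    then show ?thesis by (simp add: W.phi_0)
  next
    case False
    have "c ^ l \<le> exp (-1) ^ l * prob ?B"
      unfolding c_def power_mult_distrib
      using False b power_decreasing[of 1 l "prob ?B"] by (intro mult_left_mono) auto
    then have "ennreal (c ^ l) \<le> ennreal (exp (-1)) ^ l * emeasure M ?B"
      using b by (simp add: emeasure_eq_measure ennreal_power ennreal_mult[symmetric] ennreal_leI)
    also have "\<dots> = (\<integral>\<^sup>+\<omega>. ennreal (exp (-1)) ^ l * indicator ?B \<omega> \<partial>M)"
      by (rule nn_integral_cmult_indicator[symmetric]) measurable
    also have "\<dots> \<le> lap l"
      unfolding lap_def using nonneg
    proof (intro nn_integral_mono_AE, eventually_elim)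
      case (elim \<omega>)
      then show ?case
        by (auto split: split_indicator intro!: power_mono exp_neg_ge)
    qed
    finally show ?thesis .
  qed
  with c show ?thesis by blast
qed

text \<open>Almost surely \<open>exp_neg (V 0)\<close> is at most 1; mean 1 would force it to be 1,
  that is \<open>V 0 = 0\<close>, almost surely.\<close>

lemma lap_1_less_1:
  assumes "prob {\<omega> \<in> space M. V 0 \<omega> = 0} < 1"
  shows "lap 1 < 1"
proof (rule ccontr)
  assume "\<not> lap 1 < 1"
  then have "lap 1 = 1" using W.phi_le_1[of 1] by simp
  then have e: "(\<integral>\<^sup>+\<omega>. exp_neg (V 0 \<omega>) \<partial>M) = 1" by (simp add: lap_def)
  have le: "AE \<omega> in M. exp_neg (V 0 \<omega>) \<le> 1" using nonneg by eventually_elim (rule exp_neg_le_1)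
  have "(\<integral>\<^sup>+\<omega>. 1 - exp_neg (V 0 \<omega>) \<partial>M) = (\<integral>\<^sup>+\<omega>. 1 \<partial>M) - (\<integral>\<^sup>+\<omega>. exp_neg (V 0 \<omega>) \<partial>M)"
    by (rule nn_integral_diff) (use le e in auto)
  also have "\<dots> = 0" by (simp add: e emeasure_space_1)
  finally have "AE \<omega> in M. 1 - exp_neg (V 0 \<omega>) = 0"
    by (subst (asm) nn_integral_0_iff_AE) auto
  with le nonneg have "AE \<omega> in M. V 0 \<omega> = 0"
  proof eventually_elim
    case (elim \<omega>)
    then have "exp_neg (V 0 \<omega>) = 1" by (metis diff_eq_0_iff_ennreal order_antisym less_imp_le)
    then show ?case using elim(2) by (simp add: exp_neg_eq_1_iff)
  qed
  then have "prob {\<omega> \<in> space M. V 0 \<omega> = 0} = 1" by (simp add: prob_Collect_eq_1)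
  with assms show False by simp
qed

text \<open>By dominated convergence \<open>lap m\<close> tends to the probability that
  \<open>V 0\<close> vanishes: a value of \<open>exp_neg (V 0)\<close> below 1 has powers tending to
  0.\<close>

lemma lap_limit:
  assumes "prob {\<omega> \<in> space M. V 0 \<omega> = 0} < \<epsilon>"
  shows "\<exists>m>0. lap m < ennreal \<epsilon>"
proof -
  let ?A = "{\<omega> \<in> space M. V 0 \<omega> = 0}"
  have "(\<lambda>m. \<integral>\<^sup>+\<omega>. exp_neg (V 0 \<omega>) ^ m \<partial>M) \<longlonglongrightarrow> (\<integral>\<^sup>+\<omega>. indicator ?A \<omega> \<partial>M)"
  proof (rule nn_integral_dominated_convergence[where w = "\<lambda>_. 1"])
    show "AE \<omega> in M. exp_neg (V 0 \<omega>) ^ j \<le> 1" for j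
      using nonneg by eventually_elim (intro power_le_one exp_neg_le_1, auto)
    have "AE \<omega> in M. \<omega> \<in> space M" by simp
    with nonneg show "AE \<omega> in M. (\<lambda>m. exp_neg (V 0 \<omega>) ^ m) \<longlonglongrightarrow> indicator ?A \<omega>"
    proof eventually_elim
      case (elim \<omega>)
      show ?case
      proof (cases "V 0 \<omega> = 0")
        case False
        then have "exp_neg (V 0 \<omega>) < 1"
          using elim exp_neg_le_1[of "V 0 \<omega>"] exp_neg_eq_1_iff[of "V 0 \<omega>"] by (auto simp: less_le)
        then obtain r where r: "exp_neg (V 0 \<omega>) = ennreal r" "0 \<le> r" "r < 1"
          by (cases "exp_neg (V 0 \<omega>)") (auto simp: ennreal_less_iff simp flip: ennreal_1)
        then have "(\<lambda>m. ennreal (r ^ m)) \<longlonglongrightarrow> ennreal 0"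
          by (intro tendsto_ennrealI LIMSEQ_power_zero) simp
        then show ?thesis using False r by (simp add: ennreal_power)
      qed (use elim in simp)
    qed
  qed (auto simp: emeasure_space_1)
  then have "lap \<longlonglongrightarrow> ennreal (prob ?A)"
    unfolding lap_def[abs_def] by (simp add: emeasure_eq_measure)
  moreover have "ennreal (prob ?A) < ennreal \<epsilon>" using assms by (simp add: ennreal_less_iff)
  ultimately have "eventually (\<lambda>m. lap m < ennreal \<epsilon>) sequentially" by (rule order_tendstoD)
  then have "eventually (\<lambda>m. lap m < ennreal \<epsilon> \<and> 0 < m) sequentially"
    using eventually_gt_at_top[of 0] by eventually_elim simp
  then show ?thesis by (auto dest: eventually_happens)
qed

lemma lap_ge_prob: "ennreal (prob {\<omega> \<in> space M. V 0 \<omega> = 0}) \<le> lap l"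
proof -
  have "ennreal (prob {\<omega> \<in> space M. V 0 \<omega> = 0}) = (\<integral>\<^sup>+\<omega>. indicator {\<omega> \<in> space M. V 0 \<omega> = 0} \<omega> \<partial>M)"
    by (simp add: emeasure_eq_measure)
  also have "\<dots> \<le> lap l"
    unfolding lap_def by (intro nn_integral_mono) (auto split: split_indicator)
  finally show ?thesis .
qed

text \<open>Where \<open>V 0\<close> is positive and finite, \<open>exp_neg (V 0)\<close> is
  positive and adds to the contribution of \<open>V 0 = 0\<close>. This is the strict gap
  \<open>p < f\<close> on which the renewal argument rests.\<close>

lemma prob_less_lap_1:
  assumes "prob {\<omega> \<in> space M. 0 < V 0 \<omega> \<and> V 0 \<omega> < \<infinity>} > 0"
  shows "ennreal (prob {\<omega> \<in> space M. V 0 \<omega> = 0}) < lap 1"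
proof (rule ccontr)
  let ?A = "{\<omega> \<in> space M. V 0 \<omega> = 0}" and ?B = "{\<omega> \<in> space M. 0 < V 0 \<omega> \<and> V 0 \<omega> < \<infinity>}"
  assume "\<not> ?thesis"
  then have l: "lap 1 \<le> emeasure M ?A" by (simp add: not_less emeasure_eq_measure)
  have "emeasure M ?A + (\<integral>\<^sup>+\<omega>. exp_neg (V 0 \<omega>) * indicator ?B \<omega> \<partial>M) =
      (\<integral>\<^sup>+\<omega>. indicator ?A \<omega> + exp_neg (V 0 \<omega>) * indicator ?B \<omega> \<partial>M)"
    by (subst nn_integral_add) auto
  also have "\<dots> \<le> lap 1"
    unfolding lap_def by (intro nn_integral_mono) (auto split: split_indicator)
  also note l
  finally have "emeasure M ?A + (\<integral>\<^sup>+\<omega>. exp_neg (V 0 \<omega>) * indicator ?B \<omega> \<partial>M) \<le> emeasure M ?A + 0"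
    by simp
  then have "(\<integral>\<^sup>+\<omega>. exp_neg (V 0 \<omega>) * indicator ?B \<omega> \<partial>M) = 0"
    using emeasure_finite[of ?A] unfolding ennreal_add_left_cancel_le by simp
  then have "AE \<omega> in M. exp_neg (V 0 \<omega>) * indicator ?B \<omega> = 0"
    by (subst (asm) nn_integral_0_iff_AE) auto
  with nonneg have "AE \<omega> in M. \<omega> \<notin> ?B"
  proof eventually_elim
    case (elim \<omega>)
    then show ?case using exp_neg_pos[of "V 0 \<omega>"] by (auto split: split_indicator_asm)
  qed
  then have "prob ?B = 0" by (simp add: prob_eq_0)
  with assms show False by simp
qed

lemma expected_hit_le:
  assumes nontrivial: "prob {\<omega> \<in> space M. V 0 \<omega> = 0} < 1"
    and inf_zero: "essinf M (V 0) = 0"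
    and one_dim: "CARD('d) = 1 \<Longrightarrow> prob {\<omega> \<in> space M. 0 < V 0 \<omega> \<and> V 0 \<omega> < \<infinity>} > 0"
  shows "\<exists>R\<ge>0. \<forall>x y. x \<noteq> y \<longrightarrow>
    (\<integral>\<^sup>+S. ennreal_of_enat (hit y S) \<partial>annealed_path_measure M V x y) \<le> ennreal (R * real (dist1 x y))"
proof -
  obtain c where c: "0 < c" "c \<le> 1" "\<And>l. ennreal (c ^ l) \<le> lap l"
    using lap_ge_power[OF inf_zero] by blast
  obtain q where q: "lap 1 = ennreal q" "0 \<le> q" "q < 1"
    using lap_1_less_1[OF nontrivial] by (cases "lap 1") (auto simp: ennreal_less_iff simp flip: ennreal_1)
  let ?p = "prob {\<omega> \<in> space M. V 0 \<omega> = 0}"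
  have "\<exists>R\<ge>0. \<forall>x y :: int ^ 'd. x \<noteq> y \<longrightarrow> psum (hpaths x y) (\<lambda>us. of_nat (length us) * W.wt x us)
      \<le> ennreal (R * real (dist1 x y)) * psum (hpaths x y) (W.wt x)"
  proof (rule W.length_le_dist[OF c q])
    assume "CARD('d) = 1"
    from prob_less_lap_1[OF one_dim[OF this]] have "?p < q"
      unfolding q(1) by (simp add: ennreal_less_iff)
    then show "\<exists>p\<ge>0. p < q \<and> (\<forall>l. ennreal p \<le> lap l) \<and> (\<forall>\<epsilon>>p. \<exists>m>0. lap m < ennreal \<epsilon>)"
      using lap_ge_prob lap_limit by (intro exI[of _ ?p]) auto
  qed
  then obtain R where R: "0 \<le> R" "\<And>x y :: int ^ 'd. x \<noteq> y \<Longrightarrow> psum (hpaths x y) (\<lambda>us. of_nat (length us) * W.wt x us)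
      \<le> ennreal (R * real (dist1 x y)) * psum (hpaths x y) (W.wt x)" by blast
  have "(\<integral>\<^sup>+S. ennreal_of_enat (hit y S) \<partial>annealed_path_measure M V x y) \<le> ennreal (R * real (dist1 x y))"
    if "x \<noteq> y" for x y
  proof -
    let ?Z = "psum (hpaths x y) (W.wt x)"
    have "(\<integral>\<^sup>+S. ennreal_of_enat (hit y S) \<partial>annealed_path_measure M V x y)
        \<le> inverse ?Z * (ennreal (R * real (dist1 x y)) * ?Z)"
      unfolding expected_hit partition_function_eq by (intro mult_left_mono R(2)[OF that]) simp
    also have "\<dots> = ennreal (R * real (dist1 x y)) * (inverse ?Z * ?Z)" by (simp only: mult_ac)
    also have "\<dots> \<le> ennreal (R * real (dist1 x y)) * 1"
    proof (rule mult_left_mono)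
      \<comment> \<open>In \<open>ennreal\<close> the product is 0 when \<open>?Z\<close> is 0 or
        infinite, and 1 otherwise.\<close>
      show "inverse ?Z * ?Z \<le> 1"
      proof (cases ?Z)
        case (real z)
        then show ?thesis
          by (cases "z = 0") (auto simp: inverse_ennreal ennreal_mult[symmetric])
      qed simp
    qed simp
    finally show ?thesis by simp
  qed
  with R(1) show ?thesis by blast
qed

end

text \<open>Expanding in the standard basis shows that \<open>N\<close> is Lipschitz for the
  Euclidean norm, so it attains a positive minimum on the compact unit sphere; homogeneity does the
  rest.\<close>

lemma norm_le_is_norm:
  fixes N :: "real ^ 'd::finite \<Rightarrow> real"
  assumes "is_norm N"
  shows "\<exists>k>0. \<forall>v. norm v \<le> k * N v"
proof -
  have N: "\<And>x. 0 \<le> N x" "\<And>x. N x = 0 \<longleftrightarrow> x = 0" "\<And>a x. N (a *\<^sub>R x) = \<bar>a\<bar> * N x" "\<And>x y. N (x + y) \<le> N x + N y"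
    using assms by (auto simp: is_norm_def)
  define B where "B = (\<Sum>i\<in>UNIV. N (axis i 1 :: real ^ 'd))"
  have Nsum: "N (\<Sum>i\<in>F. f i) \<le> (\<Sum>i\<in>F. N (f i))" if "finite F" for F and f :: "'d \<Rightarrow> real ^ 'd"
    using that
  proof (induction F rule: finite_induct)
    case (insert i F)
    then show ?case using N(4)[of "f i" "sum f F"] by simp
  qed (use N(2)[of 0] in simp)
  have le: "N x \<le> B * norm x" for x
  proof -
    have "x = (\<Sum>i\<in>UNIV. (x $ i) *\<^sub>R axis i 1)"
      using basis_expansion[of x] by (simp add: scalar_mult_eq_scaleR)
    then have "N x \<le> (\<Sum>i\<in>UNIV. N ((x $ i) *\<^sub>R axis i 1))" using Nsum[OF finite] by metis
    also have "\<dots> \<le> (\<Sum>i\<in>UNIV. norm x * N (axis i 1))"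
      unfolding N(3) by (intro sum_mono mult_right_mono component_le_norm_cart N(1))
    finally show ?thesis by (simp add: B_def sum_distrib_left[symmetric] mult.commute)
  qed
  have "continuous_on UNIV N"
  proof (rule lipschitz_on_continuous_on[OF lipschitz_onI])
    show "0 \<le> B" unfolding B_def by (intro sum_nonneg N(1))
    show "dist (N x) (N y) \<le> B * dist x y" for x y
    proof -
      have "N x \<le> N y + N (x - y)" using N(4)[of y "x - y"] by simp
      moreover have "N y \<le> N x + N (y - x)" using N(4)[of x "y - x"] by simp
      moreover have "N (y - x) = N (x - y)" using N(3)[of "-1" "x - y"] by simp
      ultimately show ?thesis using le[of "x - y"] unfolding dist_real_def dist_norm by linarith
    qed
  qed
  then have "continuous_on (sphere 0 1) N" by (rule continuous_on_subset) simp
  moreover have "sphere (0 :: real ^ 'd) 1 \<noteq> {}" by simp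
  ultimately obtain u where u: "u \<in> sphere 0 1" "\<And>x. x \<in> sphere 0 1 \<Longrightarrow> N u \<le> N x"
    using continuous_attains_inf[of "sphere 0 1" N] by auto
  have u0: "0 < N u" using u(1) N(1)[of u] N(2)[of u] by (auto simp: less_le)
  have "norm v \<le> 1 / N u * N v" for v
  proof (cases "v = 0")
    case False
    have "N u \<le> N (inverse (norm v) *\<^sub>R v)" using False by (intro u(2)) simp
    also have "\<dots> = inverse (norm v) * N v" by (simp add: N(3))
    finally show ?thesis using False u0 by (simp add: field_simps)
  qed (use N(2)[of 0] in simp)
  with u0 show ?thesis by (intro exI[of _ "1 / N u"]) auto
qed

lemma dist1_le_norm: "real (dist1 0 y) \<le> real CARD('d) * norm (real_vec y)" for y :: "int ^ 'd::finite"
proof -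
  have "real (dist1 0 y) = (\<Sum>i\<in>(UNIV :: 'd set). \<bar>real_vec y $ i\<bar>)"
    by (simp add: dist1_def real_vec_def)
  also have "\<dots> \<le> (\<Sum>i\<in>(UNIV :: 'd set). norm (real_vec y))"
    by (intro sum_mono component_le_norm_cart)
  finally show ?thesis by simp
qed

theorem theorem1p1:
  fixes M :: "'w measure"
    and V :: "int ^ 'd::finite \<Rightarrow> 'w \<Rightarrow> ereal"
    and N :: "real ^ 'd \<Rightarrow> real"
  assumes "prob_space M"
    and "is_norm N"
    and indep: "prob_space.indep_vars M (\<lambda>_. borel) V UNIV"
    and ident: "\<And>z. distr M borel (V z) = distr M borel (V 0)"
    and nonneg: "AE \<omega> in M. 0 \<le> V 0 \<omega>"
    and nontrivial: "measure M {\<omega> \<in> space M. V 0 \<omega> = 0} < 1"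
    and inf_zero: "essinf M (V 0) = 0"
    and one_dim: "CARD('d) = 1 \<Longrightarrow> measure M {\<omega> \<in> space M. 0 < V 0 \<omega> \<and> V 0 \<omega> < \<infinity>} > 0"
  shows "\<exists>C::real. C > 0 \<and>
    Limsup (inf (filtercomap (\<lambda>y. N (real_vec y)) at_top) (principal (- {0})))
      (\<lambda>y. (\<integral>\<^sup>+S. ennreal_of_enat (hit y S) \<partial>annealed_path_measure M V 0 y) / ennreal (N (real_vec y)))
    \<le> ennreal C"
proof -
  interpret prob_space M by fact
  interpret iid_potential M V
    using indep ident nonneg by unfold_locales auto
  obtain R where R: "0 \<le> R" "\<And>x y. x \<noteq> y \<Longrightarrow>
    (\<integral>\<^sup>+S. ennreal_of_enat (hit y S) \<partial>annealed_path_measure M V x y) \<le> ennreal (R * real (dist1 x y))"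
    using expected_hit_le[OF nontrivial inf_zero one_dim] by blast
  obtain k where k: "0 < k" "\<And>v. norm v \<le> k * N v"
    using norm_le_is_norm[OF \<open>is_norm N\<close>] by blast
  \<comment> \<open>The summand 1 keeps \<open>C\<close> positive when \<open>R = 0\<close>. The
    quotient is bounded by \<open>C\<close> for every nonzero \<open>y\<close>, so the limit
    superior inherits the bound.\<close>
  define C where "C = R * (real CARD('d) * k) + 1"
  have "(\<integral>\<^sup>+S. ennreal_of_enat (hit y S) \<partial>annealed_path_measure M V 0 y) / ennreal (N (real_vec y)) \<le> ennreal C"
    if "y \<noteq> 0" for y
  proof -
    have "real_vec y \<noteq> 0" using that by (auto simp: real_vec_def vec_eq_iff)
    then have N: "0 < N (real_vec y)"
      using \<open>is_norm N\<close> by (metis is_norm_def less_le)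
    have "real (dist1 0 y) \<le> real CARD('d) * (k * N (real_vec y))"
      using dist1_le_norm[of y] k(2)[of "real_vec y"] by (meson mult_left_mono of_nat_0_le_iff order_trans)
    then have "R * real (dist1 0 y) \<le> R * (real CARD('d) * (k * N (real_vec y)))"
      using R(1) by (rule mult_left_mono)
    also have "\<dots> \<le> C * N (real_vec y)" using N by (simp add: C_def algebra_simps)
    finally have "ennreal (R * real (dist1 0 y)) \<le> ennreal (C * N (real_vec y))" by (rule ennreal_leI)
    then have "(\<integral>\<^sup>+S. ennreal_of_enat (hit y S) \<partial>annealed_path_measure M V 0 y) \<le> ennreal (C * N (real_vec y))"
      using R(2)[OF that[symmetric]] by (rule order_trans[rotated])
    then have "(\<integral>\<^sup>+S. ennreal_of_enat (hit y S) \<partial>annealed_path_measure M V 0 y) / ennreal (N (real_vec y))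
        \<le> ennreal (C * N (real_vec y)) / ennreal (N (real_vec y))"
      by (rule divide_right_mono_ennreal)
    also have "\<dots> = ennreal C"
      using N k(1) R(1) by (simp add: divide_ennreal C_def)
    finally show ?thesis .
  qed
  then have "eventually (\<lambda>y. (\<integral>\<^sup>+S. ennreal_of_enat (hit y S) \<partial>annealed_path_measure M V 0 y) / ennreal (N (real_vec y))
      \<le> ennreal C) (inf (filtercomap (\<lambda>y. N (real_vec y)) at_top) (principal (- {0})))"
    by (auto simp: eventually_inf_principal)
  then have "Limsup (inf (filtercomap (\<lambda>y. N (real_vec y)) at_top) (principal (- {0})))
      (\<lambda>y. (\<integral>\<^sup>+S. ennreal_of_enat (hit y S) \<partial>annealed_path_measure M V 0 y) / ennreal (N (real_vec y))) \<le> ennreal C"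
    by (rule Limsup_bounded)
  moreover have "0 < C" using R(1) k(1) by (simp add: C_def add_nonneg_pos)
  ultimately show ?thesis by blast
qed

end
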